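(* Let $\alpha>0$ and let $D\subset\mathbb{R}^2$ be a bounded multi-connected domain whose boundary consists of finitely many smooth curves $(\partial D)_0$ (outer boundary) and $(\partial D)_1,\dots,(\partial D)_n$ (inner boundaries). Let $\mathbf{v}^0$ be a steady state solution of the $\alpha$-Euler equations on $D$ with stream function $\phi^0$ (so $\mathbf{v}^0=-\nabla^{\perp}\phi^0$) and vorticity $\omega^0=\operatorname{curl}(1-\alpha^2\Delta)\mathbf{v}^0$. Assume that there is a differentiable function $F$ on the closed interval $[\min_{\overline D}\omega^0,\max_{\overline D}\omega^0]$ such that $\phi^0(x,y)=F(\omega^0(x,y))$ for every $(x,y)\in D$, and suppose that $$0<\inf_{(x,y)\in D}-F'(\omega^0(x,y))\le\sup_{(x,y)\in D}-F'(\omega^0(x,y))<+\infty.$$ Then there exists a constant $K>0$ such that if $\mathbf{v}(\cdot,t)=\mathbf{v}^0+\delta\mathbf{v}(\cdot,t)$, $t\in I$, solves the $\alpha$-Euler equations on $D$, then for all times $t\in I$ $$\|\mathbf{v}(\cdot,t)-\mathbf{v}^0\|_2^2+\alpha^2\|\nabla(\mathbf{v}(\cdot,t)-\mathbf{v}^0)\|_2^2+\|\omega(\cdot,t)-\omega^0\|_2^2\le K\Big(\|\mathbf{v}(\cdot,0)-\mathbf{v}^0\|_2^2+\alpha^2\|\nabla(\mathbf{v}(\cdot,0)-\mathbf{v}^0)\|_2^2+\|\omega(\cdot,0)-\omega^0\|_2^2\Big),$$ where $\omega(\cdot,t)=\operatorname{curl}(1-\alpha^2\Delta)\mathbf{v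}(\cdot,t)$.
   Context: The $\alpha$-Euler equations on $D$ are $\mathbf{u}_t+(\mathbf{v}\cdot\nabla)\mathbf{u}+(\nabla\mathbf{v})^{\top}\mathbf{u}+\nabla\pi=0$, $(1-\alpha^2\Delta)\mathbf{v}=\mathbf{u}$, $\operatorname{div}\mathbf{u}=\operatorname{div}\mathbf{v}=0$, where $\nabla\mathbf{v}$ is the Jacobi matrix $(\partial v_i/\partial x_j)$ and $\pi$ is a scalar function on $D$, with boundary conditions $\mathbf{v}\cdot\mathbf{n}=0$ and $(\mathbf{n}\cdot\nabla)\mathbf{v}$ parallel to $\mathbf{n}$ on $\partial D$ ($\mathbf{n}$ the unit outer normal). Solutions (and steady states) are understood to be smooth enough for the equations to hold classically up to the boundary. $I$ is the time interval of existence of the solution, containing $0$. Notation: $\nabla^{\perp}=(-\partial_y,\partial_x)$, $\operatorname{curl}\mathbf{v}=\partial_xv_2-\partial_yv_1$, $\|\cdot\|_2$ is the $L^2(D)$ norm, and $\|\nabla\mathbf{v}\|_2^2=\int_D|\nabla\mathbf{v}|^2\,d\mathbf{x}$ with $|\nabla\mathbf{v}|^2=\operatorname{tr}(\nabla\mathbf{v}\,(\nabla\mathbf{v})^{\top})$. *)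

theory Defs
  imports "HOL-Analysis.Analysis"
begin

section \<open>Multi-connected plane domains with smooth boundary\<close>

text \<open>A smooth simple closed curve, given by a regular \<open>1\<close>-periodic parametrisation of class
  \<open>C\<^sup>\<infinity>\<close> on the whole line; \<^const>\<open>simple_path\<close> and \<^const>\<open>path_image\<close> look at it on \<open>[0,1]\<close>.\<close>

definition smooth_closed_curve :: "(real \<Rightarrow> real^2) \<Rightarrow> bool" where
  "smooth_closed_curve g \<longleftrightarrow>
     simple_path g \<and> (\<forall>t. g (t + 1) = g t) \<and>
     (\<forall>k t. ((\<lambda>h s. vector_derivative h (at s)) ^^ k) g differentiable (at t)) \<and>
     (\<forall>t. vector_derivative g (at t) \<noteq> 0)"

text \<open>\<open>\<gamma> 0\<close> is the outer boundary, \<open>\<gamma> 1, \<dots>, \<gamma> n\<close> are the inner boundaries.\<close>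

definition multiconnected_domain :: "(real^2) set \<Rightarrow> nat \<Rightarrow> (nat \<Rightarrow> real \<Rightarrow> real^2) \<Rightarrow> bool" where
  "multiconnected_domain D n \<gamma> \<longleftrightarrow>
     open D \<and> connected D \<and> bounded D \<and>
     (\<forall>i\<le>n. smooth_closed_curve (\<gamma> i)) \<and>
     (\<forall>i\<le>n. \<forall>j\<le>n. i \<noteq> j \<longrightarrow> path_image (\<gamma> i) \<inter> path_image (\<gamma> j) = {}) \<and>
     frontier D = (\<Union>i\<le>n. path_image (\<gamma> i)) \<and>
     D \<subseteq> inside (path_image (\<gamma> 0)) \<and>
     (\<forall>i\<in>{1..n}. D \<subseteq> outside (path_image (\<gamma> i)))"

text \<open>The unit outer normal of \<open>D\<close> at the boundary point \<open>g t\<close>: of the two unit vectors orthogonal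
  to the tangent, the one that points out of \<open>D\<close>.\<close>

definition outer_normal :: "(real^2) set \<Rightarrow> (real \<Rightarrow> real^2) \<Rightarrow> real \<Rightarrow> real^2" where
  "outer_normal D g t =
     (let T = vector_derivative g (at t);
          N = (1 / norm T) *\<^sub>R (vector [T$2, - T$1] :: real^2)
      in if (\<forall>\<^sub>F s in at_right 0. g t + s *\<^sub>R N \<notin> D) then N else - N)"


section \<open>Differential operators up to the boundary\<close>

text \<open>The partial derivative in the \<open>i\<close>-th coordinate, relative to the set \<open>S\<close>. With
  \<open>S = closure D\<close> for a domain \<open>D\<close> as above, this is the usual partial derivative at points of
  \<open>D\<close>, and at boundary points it is the one-sided derivative. The latter is unique because a domain
  with smooth boundary contains a cone at each of its boundary points.\<close>

definition pd :: "(real^2) set \<Rightarrow> 2 \<Rightarrow> (real^2 \<Rightarrow> 'b::real_normed_vector) \<Rightarrow> real^2 \<Rightarrow> 'b" where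
  "pd S i f x = frechet_derivative f (at x within S) (axis i 1)"

definition laplacian :: "(real^2) set \<Rightarrow> (real^2 \<Rightarrow> 'b::real_normed_vector) \<Rightarrow> real^2 \<Rightarrow> 'b" where
  "laplacian S f x = (\<Sum>i\<in>UNIV. pd S i (pd S i f) x)"

definition jacobi :: "(real^2) set \<Rightarrow> (real^2 \<Rightarrow> real^2) \<Rightarrow> real^2 \<Rightarrow> real^2^2" where
  "jacobi S v x = (\<chi> i j. pd S j v x $ i)"

definition gradient :: "(real^2) set \<Rightarrow> (real^2 \<Rightarrow> real) \<Rightarrow> real^2 \<Rightarrow> real^2" where
  "gradient S f x = (\<chi> i. pd S i f x)"

definition perp_gradient :: "(real^2) set \<Rightarrow> (real^2 \<Rightarrow> real) \<Rightarrow> real^2 \<Rightarrow> real^2" where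
  "perp_gradient S f x = vector [- pd S 2 f x, pd S 1 f x]"

definition divergence :: "(real^2) set \<Rightarrow> (real^2 \<Rightarrow> real^2) \<Rightarrow> real^2 \<Rightarrow> real" where
  "divergence S v x = (\<Sum>i\<in>UNIV. pd S i v x $ i)"

definition curl :: "(real^2) set \<Rightarrow> (real^2 \<Rightarrow> real^2) \<Rightarrow> real^2 \<Rightarrow> real" where
  "curl S v x = pd S 1 v x $ 2 - pd S 2 v x $ 1"

definition helmholtz :: "real \<Rightarrow> (real^2) set \<Rightarrow> (real^2 \<Rightarrow> real^2) \<Rightarrow> real^2 \<Rightarrow> real^2" where
  "helmholtz \<alpha> S v x = v x - \<alpha>\<^sup>2 *\<^sub>R laplacian S v x"

definition vorticity :: "real \<Rightarrow> (real^2) set \<Rightarrow> (real^2 \<Rightarrow> real^2) \<Rightarrow> real^2 \<Rightarrow> real" where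
  "vorticity \<alpha> S v = curl S (helmholtz \<alpha> S v)"

text \<open>All spatial derivatives of \<open>f t\<close>, \<open>t \<in> I\<close>, up to order \<open>k\<close> exist on \<open>S\<close> and are jointly
  continuous in time and space.\<close>

primrec C_space :: "nat \<Rightarrow> real set \<Rightarrow> (real^2) set \<Rightarrow> (real \<Rightarrow> real^2 \<Rightarrow> 'b::real_normed_vector) \<Rightarrow> bool"
where
  "C_space 0 I S f \<longleftrightarrow> continuous_on (I \<times> S) (\<lambda>(t, x). f t x)"
| "C_space (Suc k) I S f \<longleftrightarrow>
     continuous_on (I \<times> S) (\<lambda>(t, x). f t x) \<and>
     (\<forall>t\<in>I. f t differentiable_on S) \<and>
     (\<forall>i. C_space k I S (\<lambda>t. pd S i (f t)))"


section \<open>The \<open>\<alpha>\<close>-Euler equations\<close>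

definition alpha_euler_boundary ::
  "(real^2) set \<Rightarrow> nat \<Rightarrow> (nat \<Rightarrow> real \<Rightarrow> real^2) \<Rightarrow> (real^2 \<Rightarrow> real^2) \<Rightarrow> bool" where
  "alpha_euler_boundary D n \<gamma> v \<longleftrightarrow>
     (\<forall>i\<le>n. \<forall>s. let x = \<gamma> i s; \<nu> = outer_normal D (\<gamma> i) s in
        v x \<bullet> \<nu> = 0 \<and> (\<exists>c. jacobi (closure D) v x *v \<nu> = c *\<^sub>R \<nu>))"

text \<open>Classical solutions on the time interval \<open>I\<close>. The regularity required is that of the
  derivatives which occur in the equations: third order space derivatives of \<open>v\<close> and the time
  derivative \<open>ut\<close> of \<open>u = (1 - \<alpha>\<^sup>2\<Delta>)v\<close> are continuous up to the boundary, which by the equation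
  entails the same for the gradient of \<open>\<pi>\<close>. The time derivative is one-sided at end points of \<open>I\<close>
  that belong to \<open>I\<close>.\<close>

definition alpha_euler_solution ::
  "real \<Rightarrow> (real^2) set \<Rightarrow> nat \<Rightarrow> (nat \<Rightarrow> real \<Rightarrow> real^2) \<Rightarrow> real set \<Rightarrow> (real \<Rightarrow> real^2 \<Rightarrow> real^2) \<Rightarrow> bool"
where
  "alpha_euler_solution \<alpha> D n \<gamma> I v \<longleftrightarrow>
     (let S = closure D; u = (\<lambda>t. helmholtz \<alpha> S (v t)) in
      C_space 3 I S v \<and>
      (\<exists>ut \<pi>.
         continuous_on (I \<times> S) (\<lambda>(t, x). ut t x) \<and>
         (\<forall>t\<in>I. \<pi> t differentiable_on S) \<and>
         (\<forall>t\<in>I. \<forall>x\<in>S.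
            ((\<lambda>s. u s x) has_vector_derivative ut t x) (at t within I) \<and>
            ut t x + jacobi S (u t) x *v v t x + transpose (jacobi S (v t) x) *v u t x
              + gradient S (\<pi> t) x = 0)) \<and>
      (\<forall>t\<in>I. \<forall>x\<in>S. divergence S (u t) x = 0 \<and> divergence S (v t) x = 0) \<and>
      (\<forall>t\<in>I. alpha_euler_boundary D n \<gamma> (v t)))"

definition steady_state ::
  "real \<Rightarrow> (real^2) set \<Rightarrow> nat \<Rightarrow> (nat \<Rightarrow> real \<Rightarrow> real^2) \<Rightarrow> (real^2 \<Rightarrow> real^2) \<Rightarrow> bool" where
  "steady_state \<alpha> D n \<gamma> v \<longleftrightarrow> alpha_euler_solution \<alpha> D n \<gamma> UNIV (\<lambda>t. v)"

definition stream_function :: "(real^2) set \<Rightarrow> (real^2 \<Rightarrow> real) \<Rightarrow> (real^2 \<Rightarrow> real^2) \<Rightarrow> bool" where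
  "stream_function D \<phi> v \<longleftrightarrow>
     \<phi> differentiable_on D \<and> (\<forall>x\<in>D. v x = - perp_gradient D \<phi> x)"


section \<open>Norms\<close>

definition L2_norm_on :: "(real^2) set \<Rightarrow> (real^2 \<Rightarrow> 'b::real_normed_vector) \<Rightarrow> real" where
  "L2_norm_on D f = sqrt (LINT x:D|lborel. (norm (f x))\<^sup>2)"

definition L2_norm_grad :: "(real^2) set \<Rightarrow> (real^2 \<Rightarrow> real^2) \<Rightarrow> real" where
  "L2_norm_grad D v =
     sqrt (LINT x:D|lborel. trace (jacobi (closure D) v x ** transpose (jacobi (closure D) v x)))"

end

theory Submission
  imports Defs
begin

text \<open>
  Energy-Casimir method. With \<open>p = \<pi> + v \<bullet> u\<close> the equation reads
  \<open>u\<^sub>t + \<omega> v\<^sup>\<perp> + \<nabla>p = 0\<close>. For a function \<open>C\<close> with \<open>C' = -F\<close> (extended beyond the range of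
  \<open>\<omega>\<^sub>0\<close> with the same bounds on the slope) the functional
  \<open>\<integral> (|\<delta>v|\<^sup>2 + \<alpha>\<^sup>2 |\<nabla>\<delta>v|\<^sup>2) / 2 + \<integral> (C(\<omega>) - C(\<omega>\<^sub>0) - C'(\<omega>\<^sub>0) (\<omega> - \<omega>\<^sub>0))\<close>
  is conserved, and by the bounds on \<open>-F'\<close> it is comparable to the quantity to be estimated.
  Since \<open>-C'(\<omega>\<^sub>0) = \<phi>\<^sub>0\<close> and \<open>v\<^sub>0 = -\<nabla>\<^sup>\<perp>\<phi>\<^sub>0\<close>, the change of \<open>\<integral> \<phi>\<^sub>0 \<omega>\<close> cancels that of the energy of \<open>\<delta>v\<close>
  without any reference to circulations along the boundary curves.

  The vorticity of a classical solution is merely continuous, so that it is transported only in the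
  weak sense, and the conservation of \<open>\<integral> C(\<omega>)\<close> is obtained by mollification. Fields tangential to
  the boundary are integrated by parts with cutoff functions of a smoothed distance to the boundary;
  no boundary integral occurs.
\<close>


section \<open>Integration over bounded sets\<close>

text \<open>A cutoff varying over a strip of width eps has a gradient of size 1/eps on an area of
  order eps. By size alone its contribution is of order 1; it becomes small only through direction,
  the field being nearly tangential there and the gradient of the cutoff nearly normal. Normality
  survives smoothing of the distance because every boundary point that is almost nearest to
  \<open>x\<close> sees \<open>x\<close> almost along its normal, with an error governed by the
  second derivative of the parametrisation. Continuity of the field is enough for this, and the
  estimate is uniform in time.

  Solutions come with a time derivative of \<open>u\<close>, not of \<open>v\<close>. Energies at
  two times are therefore compared by polarising the Green form, which leaves only increments of
  \<open>u\<close>.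

  In the commutator the scale of mollification cancels: velocity increments of size
  \<open>L * \<delta>\<close> meet a kernel gradient of mass at most \<open>29 / \<delta>\<close>.
  The smallness comes from the oscillation of the vorticity.

  The final constant is \<open>max 1 c2 / min 1 c1\<close> with bounds \<open>c1\<close> and
  \<open>c2\<close> for \<open>- F'\<close>, so it depends on the steady state alone.\<close>

lemma abs_le_mult_eps_imp_zero:
  fixes x C :: real
  assumes "C \<ge> 0" "\<And>e. e > 0 \<Longrightarrow> \<bar>x\<bar> \<le> C * e"
  shows "x = 0"
proof (rule ccontr)
  assume "x \<noteq> 0"
  then have "\<bar>x\<bar> \<le> C * (\<bar>x\<bar> / (2 * (C + 1)))" using assms by (intro assms(2)) auto
  also have "\<dots> < \<bar>x\<bar>"
  proof -
    have "C * \<bar>x\<bar> + 2 * \<bar>x\<bar> > 0" using \<open>x \<noteq> 0\<close> assms(1) by (simp add: add_nonneg_pos)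
    then show ?thesis using assms(1) by (simp add: field_simps)
  qed
  finally show False by simp
qed

lemma set_bounded_convergence:
  fixes f :: "nat \<Rightarrow> 'a \<Rightarrow> real"
  assumes D: "D \<in> sets M" "emeasure M D < \<infinity>"
    and meas: "\<And>n. set_borel_measurable M D (f n)"
    and bound: "\<And>n x. x \<in> D \<Longrightarrow> \<bar>f n x\<bar> \<le> B"
    and lim: "\<And>x. x \<in> D \<Longrightarrow> (\<lambda>n. f n x) \<longlonglongrightarrow> g x"
  shows "(\<lambda>n. LINT x:D|M. f n x) \<longlonglongrightarrow> (LINT x:D|M. g x)" "set_integrable M D g"
proof -
  have m: "(\<lambda>x. indicator D x *\<^sub>R f n x) \<in> borel_measurable M" for n
    using meas by (simp add: set_borel_measurable_def)
  have l: "(\<lambda>n. indicator D x *\<^sub>R f n x) \<longlonglongrightarrow> indicator D x *\<^sub>R g x" for x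
    by (cases "x \<in> D") (auto simp: lim)
  have gm: "(\<lambda>x. indicator D x *\<^sub>R g x) \<in> borel_measurable M"
    by (rule borel_measurable_LIMSEQ_metric[OF m l])
  have w: "integrable M (\<lambda>x. indicator D x * B)"
    using D by (simp add: integrable_mult_left integrable_indicator_iff less_top[symmetric])
  have b: "norm (indicator D x *\<^sub>R f n x) \<le> indicator D x * B" for n x
    by (cases "x \<in> D") (auto simp: bound)
  show "(\<lambda>n. LINT x:D|M. f n x) \<longlonglongrightarrow> (LINT x:D|M. g x)"
    unfolding set_lebesgue_integral_def
    by (rule integral_dominated_convergence[OF gm m w]) (use l b in auto)
  show "set_integrable M D g"
    unfolding set_integrable_def
    by (rule integrable_dominated_convergence[OF gm m w, of "\<lambda>n. n"]) (use l b in auto)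
qed

text \<open>Dominated convergence is sequential; first countability makes sequences that avoid
  \<open>a\<close> sufficient. One lemma then serves difference quotients in time and in space as
  well as the continuity of convolutions.\<close>

lemma set_bounded_convergence_at:
  fixes f :: "'b::first_countable_topology \<Rightarrow> 'a \<Rightarrow> real"
  assumes D: "D \<in> sets M" "emeasure M D < \<infinity>"
    and meas: "\<And>s. s \<in> S - {a} \<Longrightarrow> set_borel_measurable M D (f s)"
    and bound: "\<And>s x. s \<in> S - {a} \<Longrightarrow> x \<in> D \<Longrightarrow> \<bar>f s x\<bar> \<le> B"
    and lim: "\<And>x. x \<in> D \<Longrightarrow> ((\<lambda>s. f s x) \<longlongrightarrow> g x) (at a within S)"
  shows "((\<lambda>s. LINT x:D|M. f s x) \<longlongrightarrow> (LINT x:D|M. g x)) (at a within S)"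
  unfolding tendsto_at_iff_sequentially
proof (intro allI impI)
  fix X assume X: "\<forall>i. X i \<in> S - {a}" "X \<longlonglongrightarrow> a"
  have "(\<lambda>n. LINT x:D|M. f (X n) x) \<longlonglongrightarrow> (LINT x:D|M. g x)"
  proof (rule set_bounded_convergence[OF D, where B=B])
    fix x assume "x \<in> D"
    with lim X show "(\<lambda>n. f (X n) x) \<longlonglongrightarrow> g x"
      unfolding tendsto_at_iff_sequentially by (auto simp: o_def)
  qed (use X meas bound in auto)
  then show "((\<lambda>s. LINT x:D|M. f s x) \<circ> X) \<longlonglongrightarrow> (LINT x:D|M. g x)"
    by (simp add: o_def)
qed

lemma emeasure_bounded_lborel: "bounded D \<Longrightarrow> emeasure lborel (D::'a::euclidean_space set) < \<infinity>"
proof -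
  assume "bounded D"
  then obtain a where "D \<subseteq> cbox (-a) a" using bounded_subset_cbox_symmetric by metis
  then have "emeasure lborel D \<le> emeasure lborel (cbox (-a) a)"
    by (intro emeasure_mono) auto
  also have "\<dots> < \<infinity>" by (simp add: emeasure_lborel_cbox_eq)
  finally show ?thesis .
qed

lemma set_borel_measurable_open:
  fixes f :: "'a::euclidean_space \<Rightarrow> real"
  assumes "open D" "continuous_on D f"
  shows "set_borel_measurable lborel D f"
  using borel_measurable_continuous_on_indicator[of D f] assms
  by (auto simp: set_borel_measurable_def)

lemma set_integrable_bounded:
  fixes f :: "'a::euclidean_space \<Rightarrow> real"
  assumes "D \<in> sets borel" "bounded D" "set_borel_measurable lborel D f" "\<And>x. x \<in> D \<Longrightarrow> \<bar>f x\<bar> \<le> B"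
  shows "set_integrable lborel D f"
  using assms emeasure_bounded_lborel[OF assms(2)]
  by (intro set_bounded_convergence(2)[where f="\<lambda>n. f" and B=B]) auto

lemma set_integrable_bounded_continuous:
  fixes f :: "'a::euclidean_space \<Rightarrow> real"
  assumes "open D" "bounded D" "continuous_on D f" "\<And>x. x \<in> D \<Longrightarrow> \<bar>f x\<bar> \<le> B"
  shows "set_integrable lborel D f"
  using assms by (intro set_integrable_bounded set_borel_measurable_open) auto

lemma set_integral_abs_le:
  fixes f :: "'a::euclidean_space \<Rightarrow> real"
  assumes "D \<in> sets borel" "bounded D" "\<And>x. x \<in> D \<Longrightarrow> \<bar>f x\<bar> \<le> B" "B \<ge> 0"
  shows "\<bar>LINT x:D|lborel. f x\<bar> \<le> B * measure lborel D"
proof -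
  have fin: "emeasure lborel D < \<infinity>" using assms emeasure_bounded_lborel by blast
  have i: "set_integrable lborel D (\<lambda>x. B)"
    using assms fin by (simp add: set_integrable_def integrable_mult_left integrable_indicator_iff less_top[symmetric])
  show ?thesis
  proof (cases "set_integrable lborel D f")
    case True
    have "\<bar>LINT x:D|lborel. f x\<bar> \<le> (LINT x:D|lborel. \<bar>f x\<bar>)"
      using set_integral_norm_bound[OF True] by simp
    also have "\<dots> \<le> (LINT x:D|lborel. B)"
      by (rule set_integral_mono[OF set_integrable_abs[OF True] i]) (use assms in auto)
    also have "\<dots> = B * measure lborel D"
      using fin assms by (simp add: set_lebesgue_integral_def)
    finally show ?thesis .
  next
    case False
    \<comment> \<open>A non-integrable function has integral 0 by convention, so the bound holds for
      every \<open>f\<close>.\<close>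
    then have "(LINT x:D|lborel. f x) = 0"
      by (simp add: set_integrable_def set_lebesgue_integral_def not_integrable_integral_eq)
    then show ?thesis using assms by simp
  qed
qed

lemma set_integral_abs_le_integral:
  fixes f g :: "'a::euclidean_space \<Rightarrow> real"
  assumes "set_integrable lborel D f" "set_integrable lborel D g" "\<And>x. x \<in> D \<Longrightarrow> \<bar>f x\<bar> \<le> g x"
  shows "\<bar>LINT x:D|lborel. f x\<bar> \<le> (LINT x:D|lborel. g x)"
proof -
  have "\<bar>LINT x:D|lborel. f x\<bar> \<le> (LINT x:D|lborel. \<bar>f x\<bar>)"
    using set_integral_norm_bound[OF assms(1)] by simp
  also have "\<dots> \<le> (LINT x:D|lborel. g x)"
    by (rule set_integral_mono[OF set_integrable_abs[OF assms(1)] assms(2)]) (use assms in auto)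
  finally show ?thesis .
qed

lemma continuous_on_set_integral:
  fixes f :: "'b::first_countable_topology \<Rightarrow> 'a::euclidean_space \<Rightarrow> real"
  assumes "D \<in> sets borel" "bounded D"
    and "\<And>s. s \<in> S \<Longrightarrow> set_borel_measurable lborel D (f s)"
    and "\<And>s x. s \<in> S \<Longrightarrow> x \<in> D \<Longrightarrow> \<bar>f s x\<bar> \<le> B"
    and "\<And>x. x \<in> D \<Longrightarrow> continuous_on S (\<lambda>s. f s x)"
  shows "continuous_on S (\<lambda>s. LINT x:D|lborel. f s x)"
  unfolding continuous_on_def
proof
  fix a assume "a \<in> S"
  show "((\<lambda>s. LINT x:D|lborel. f s x) \<longlongrightarrow> (LINT x:D|lborel. f a x)) (at a within S)"
    by (rule set_bounded_convergence_at[where B=B])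
      (use assms emeasure_bounded_lborel[OF assms(2)] \<open>a \<in> S\<close> in \<open>auto simp: continuous_on_def\<close>)
qed

lemma real_quotient_bound:
  fixes f :: "real \<Rightarrow> real"
  assumes "convex J" "\<And>s. s \<in> J \<Longrightarrow> (f has_real_derivative f' s) (at s within J)"
    "\<And>s. s \<in> J \<Longrightarrow> \<bar>f' s\<bar> \<le> B" "s \<in> J" "t \<in> J"
  shows "\<bar>f s - f t\<bar> \<le> B * \<bar>s - t\<bar>"
  using field_differentiable_bound[of J f f' B s t] assms by (auto simp: real_norm_def)

text \<open>The mean value inequality on the convex set \<open>J\<close> bounds all difference
  quotients by \<open>B\<close>, so bounded convergence applies. Derivatives within \<open>J\<close>
  cover the one-sided ones at the ends of a time interval.\<close>

lemma has_real_derivative_set_integral: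
  fixes f :: "real \<Rightarrow> 'a::euclidean_space \<Rightarrow> real"
  assumes D: "D \<in> sets borel" "bounded D" and J: "convex J" "t \<in> J"
    and int: "\<And>s. s \<in> J \<Longrightarrow> set_integrable lborel D (f s)"
    and der: "\<And>s x. s \<in> J \<Longrightarrow> x \<in> D \<Longrightarrow> ((\<lambda>s. f s x) has_real_derivative f' s x) (at s within J)"
    and bound: "\<And>s x. s \<in> J \<Longrightarrow> x \<in> D \<Longrightarrow> \<bar>f' s x\<bar> \<le> B"
  shows "((\<lambda>s. LINT x:D|lborel. f s x) has_real_derivative (LINT x:D|lborel. f' t x)) (at t within J)"
proof -
  have "((\<lambda>s. LINT x:D|lborel. (f s x - f t x) / (s - t)) \<longlongrightarrow> (LINT x:D|lborel. f' t x)) (at t within J)"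
  proof (rule set_bounded_convergence_at[where B=B])
    fix s assume s: "s \<in> J - {t}"
    have "set_integrable lborel D (\<lambda>x. f s x - f t x)"
      by (rule set_integral_diff) (use s J int in auto)
    then have "set_integrable lborel D (\<lambda>x. (f s x - f t x) / (s - t))"
      by (rule set_integrable_divide)
    then show "set_borel_measurable lborel D (\<lambda>x. (f s x - f t x) / (s - t))"
      by (simp add: set_integrable_def set_borel_measurable_def)
    fix x assume "x \<in> D"
    then have "\<bar>f s x - f t x\<bar> \<le> B * \<bar>s - t\<bar>"
      using s J by (intro real_quotient_bound[of J _ "\<lambda>s. f' s x"] der bound) auto
    then show "\<bar>(f s x - f t x) / (s - t)\<bar> \<le> B"
      using s by (simp add: field_simps)
  next
    fix x assume "x \<in> D"
    then show "((\<lambda>s. (f s x - f t x) / (s - t)) \<longlongrightarrow> f' t x) (at t within J)"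
      using der[OF J(2)] by (simp add: has_field_derivative_iff)
  qed (use D emeasure_bounded_lborel[OF D(2)] in auto)
  moreover have "(LINT x:D|lborel. (f s x - f t x) / (s - t))
      = ((LINT x:D|lborel. f s x) - (LINT x:D|lborel. f t x)) / (s - t)" if "s \<in> J" for s
    by (simp add: int that J set_integral_diff)
  ultimately show ?thesis
    unfolding has_field_derivative_iff
    by (rule Lim_transform_within[OF _ zero_less_one]) auto
qed

lemma lborel_integrable_translate:
  fixes f :: "'a::euclidean_space \<Rightarrow> real"
  assumes "integrable lborel f"
  shows "integrable lborel (\<lambda>x. f (c + x))"
  using integrable_distr[of "(+) c" lborel borel f] assms by (simp add: lborel_distr_plus)

lemma lborel_integral_translate:
  fixes f :: "'a::euclidean_space \<Rightarrow> real"
  assumes "f \<in> borel_measurable borel"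
  shows "(LINT x|lborel. f (c + x)) = (LINT x|lborel. f x)"
  using assms by (subst (2) lborel_distr_plus[of c, symmetric]) (simp add: integral_distr)


section \<open>Partial derivatives and test functions\<close>

text \<open>Differentiability along a coordinate line only, so that one-variable calculus applies
  directly and mollified or composed functions need no total derivative.\<close>

definition has_pderiv :: "(real^2 \<Rightarrow> real) \<Rightarrow> 2 \<Rightarrow> real \<Rightarrow> real^2 \<Rightarrow> bool" where
  "has_pderiv f i d x \<longleftrightarrow> ((\<lambda>s. f (x + s *\<^sub>R axis i 1)) has_real_derivative d) (at 0)"

lemma has_pderiv_add: "has_pderiv f i a x \<Longrightarrow> has_pderiv g i b x \<Longrightarrow> has_pderiv (\<lambda>x. f x + g x) i (a + b) x"
  unfolding has_pderiv_def by (rule DERIV_add)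

lemma has_pderiv_diff: "has_pderiv f i a x \<Longrightarrow> has_pderiv g i b x \<Longrightarrow> has_pderiv (\<lambda>x. f x - g x) i (a - b) x"
  unfolding has_pderiv_def by (rule DERIV_diff)

lemma has_pderiv_const: "has_pderiv (\<lambda>x. c) i 0 x"
  unfolding has_pderiv_def by simp

lemma has_pderiv_cmult: "has_pderiv f i a x \<Longrightarrow> has_pderiv (\<lambda>x. c * f x) i (c * a) x"
  unfolding has_pderiv_def by (rule DERIV_cmult)

lemma has_pderiv_mult:
  "has_pderiv f i a x \<Longrightarrow> has_pderiv g i b x \<Longrightarrow> has_pderiv (\<lambda>x. f x * g x) i (a * g x + f x * b) x"
  unfolding has_pderiv_def by (auto intro!: derivative_eq_intros)

lemma has_pderiv_sum:
  "(\<And>k. k \<in> A \<Longrightarrow> has_pderiv (f k) i (d k) x) \<Longrightarrow> has_pderiv (\<lambda>x. \<Sum>k\<in>A. f k x) i (\<Sum>k\<in>A. d k) x"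
  unfolding has_pderiv_def by (rule DERIV_sum)

lemma has_pderiv_chain:
  "(G has_real_derivative G') (at (f x)) \<Longrightarrow> has_pderiv f i a x \<Longrightarrow> has_pderiv (\<lambda>x. G (f x)) i (G' * a) x"
  unfolding has_pderiv_def by (rule DERIV_chain2) auto

lemma has_pderiv_shift:
  "has_pderiv f i d (x + s *\<^sub>R axis i 1) \<longleftrightarrow> ((\<lambda>s. f (x + s *\<^sub>R axis i 1)) has_real_derivative d) (at s)"
  unfolding has_pderiv_def
  using DERIV_shift[of "\<lambda>s. f (x + s *\<^sub>R axis i 1)" d 0 s]
  by (simp add: algebra_simps)

lemma has_pderiv_translate: "has_pderiv f i d (c + x) \<Longrightarrow> has_pderiv (\<lambda>x. f (c + x)) i d x"
  unfolding has_pderiv_def by (simp add: add.assoc)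

lemma has_pderiv_reflect: "has_pderiv f i d (c - x) \<Longrightarrow> has_pderiv (\<lambda>x. f (c - x)) i (- d) x"
  unfolding has_pderiv_def
  using DERIV_mirror[of "\<lambda>s. f (c - (x + s *\<^sub>R axis i 1))" "- d" 0] by (simp add: algebra_simps)

lemma has_pderiv_transform_open:
  assumes "has_pderiv f i d x" "open A" "x \<in> A" "\<And>y. y \<in> A \<Longrightarrow> f y = g y"
  shows "has_pderiv g i d x"
proof -
  have "open ((\<lambda>s. x + s *\<^sub>R axis i 1) -` A)"
    by (intro open_vimage assms continuous_intros)
  then show ?thesis
    using assms unfolding has_pderiv_def
    by (elim has_field_derivative_transform_within_open) auto
qed

lemma has_pderiv_unique: "has_pderiv f i a x \<Longrightarrow> has_pderiv f i b x \<Longrightarrow> a = b"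
  unfolding has_pderiv_def by (rule DERIV_unique)

lemma has_pderiv_of_derivative:
  fixes f :: "real^2 \<Rightarrow> real"
  assumes "(f has_derivative f') (at x)"
  shows "has_pderiv f i (f' (axis i 1)) x"
proof -
  interpret f': bounded_linear f' using assms by (rule has_derivative_bounded_linear)
  have "((\<lambda>s. x + s *\<^sub>R axis i 1) has_derivative (\<lambda>s. s *\<^sub>R axis i 1)) (at 0)"
    by (auto intro!: derivative_eq_intros)
  then have "((\<lambda>s. f (x + s *\<^sub>R axis i 1)) has_derivative (\<lambda>s. f' (s *\<^sub>R axis i 1))) (at 0)"
    by (rule has_derivative_compose) (simp add: assms)
  then show ?thesis
    unfolding has_pderiv_def has_field_derivative_def by (simp add: f'.scaleR mult.commute[of _ "f' _"] fun_eq_iff)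
qed

lemma has_pderiv_line_bound:
  assumes "\<And>s. s \<in> closed_segment 0 h \<Longrightarrow> has_pderiv f i (g (x + s *\<^sub>R axis i 1)) (x + s *\<^sub>R axis i 1)"
    and "\<And>s. s \<in> closed_segment 0 h \<Longrightarrow> \<bar>g (x + s *\<^sub>R axis i 1)\<bar> \<le> B"
  shows "\<bar>f (x + h *\<^sub>R axis i 1) - f x\<bar> \<le> B * \<bar>h\<bar>"
proof -
  have "\<bar>f (x + h *\<^sub>R axis i 1) - f (x + 0 *\<^sub>R axis i 1)\<bar> \<le> B * \<bar>h - 0\<bar>"
    using assms unfolding has_pderiv_shift
    by (intro real_quotient_bound[where J="closed_segment 0 h" and f'="\<lambda>s. g (x + s *\<^sub>R axis i 1)"])
      (auto intro: has_field_derivative_at_within)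
  then show ?thesis by simp
qed

lemma has_pderiv_quotient_tendsto:
  "has_pderiv f i d x \<Longrightarrow> ((\<lambda>h. (f (x + h *\<^sub>R axis i 1) - f x) / h) \<longlongrightarrow> d) (at 0)"
  unfolding has_pderiv_def has_field_derivative_iff by simp

text \<open>By translation invariance every difference quotient of \<open>f\<close> has integral
  zero, and all of them are bounded by \<open>B\<close>; the claim is the limit. Measurability of
  \<open>g\<close> comes for free, \<open>g\<close> being a limit of the quotients.\<close>

lemma integral_pderiv_zero_UNIV:
  assumes f: "continuous_on UNIV f" and der: "\<And>x. has_pderiv f i (g x) x"
    and B: "\<And>x. \<bar>g x\<bar> \<le> B" and A: "bounded A" "\<And>x. x \<notin> A \<Longrightarrow> f x = 0"
  shows "(LINT x|lborel. g x) = 0"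
proof -
  let ?e = "axis i 1 :: real^2"
  obtain r where r: "r > 0" "A \<subseteq> ball 0 r"
    using A bounded_subset_ballD by blast
  \<comment> \<open>The margin 1 keeps points outside \<open>D\<close> off the support of
    \<open>f\<close> when they are shifted by at most 1.\<close>
  define D where "D = ball (0::real^2) (r + 1)"
  have D: "D \<in> sets borel" "bounded D" "emeasure lborel D < \<infinity>"
    unfolding D_def using emeasure_bounded_lborel by auto
  have out: "f (x + h *\<^sub>R ?e) = 0" if "x \<notin> D" "\<bar>h\<bar> \<le> 1" for x h
  proof -
    have "norm x \<le> norm (x + h *\<^sub>R ?e) + norm (h *\<^sub>R ?e)" using norm_triangle_sub[of x "x + h *\<^sub>R ?e"]
      by (simp add: norm_minus_commute add.commute)
    then have "norm (x + h *\<^sub>R ?e) \<ge> r" using that by (simp add: D_def norm_axis_1)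
    then have "x + h *\<^sub>R ?e \<notin> A" using r by auto
    then show ?thesis using A by auto
  qed
  have g0: "g x = 0" if "x \<notin> D" for x
  proof -
    have "((\<lambda>s. f (x + s *\<^sub>R ?e)) has_real_derivative 0) (at 0)"
      by (rule has_field_derivative_transform_within_open[where f="\<lambda>_. 0" and S="{-1<..<1}"])
        (use out[OF that] in auto)
    then show ?thesis using der[of x] unfolding has_pderiv_def by (rule DERIV_unique[symmetric])
  qed
  have fm: "(\<lambda>x. f (x + h *\<^sub>R ?e)) \<in> borel_measurable borel" for h
    by (intro borel_measurable_continuous_onI continuous_on_compose2[OF f] continuous_intros) auto
  have fm0: "f \<in> borel_measurable borel"
    by (intro borel_measurable_continuous_onI f)
  have Bf: "bounded (range f)"
  proof -
    have "range f \<subseteq> insert 0 (f ` cball 0 r)" using A r by fastforce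
    moreover have "compact (f ` cball 0 r)"
      by (intro compact_continuous_image continuous_on_subset[OF f]) auto
    ultimately show ?thesis
      by (meson bounded_subset compact_imp_bounded bounded_insert)
  qed
  then obtain M where M: "\<And>x. \<bar>f x\<bar> \<le> M" by (auto simp: bounded_iff)
  have fi: "set_integrable lborel D (\<lambda>x. f (x + h *\<^sub>R ?e))" for h
    by (rule set_integrable_bounded[OF D(1,2), where B=M]) (use fm M D in \<open>auto simp: set_borel_measurable_def\<close>)
  have zero: "(LINT x:D|lborel. (f (x + h *\<^sub>R ?e) - f x) / h) = 0" if "\<bar>h\<bar> \<le> 1" for h
  proof -
    have "(LINT x:D|lborel. f (x + h *\<^sub>R ?e)) = (LINT x|lborel. f (x + h *\<^sub>R ?e))"
      unfolding set_lebesgue_integral_def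
      by (rule Bochner_Integration.integral_cong) (use out that in \<open>auto simp: indicator_def\<close>)
    also have "\<dots> = (LINT x|lborel. f x)"
      using lborel_integral_translate[OF fm0, of "h *\<^sub>R ?e"] by (simp add: add.commute)
    also have "\<dots> = (LINT x:D|lborel. f x)"
      unfolding set_lebesgue_integral_def
      by (rule Bochner_Integration.integral_cong) (use out[of _ 0] in \<open>auto simp: indicator_def\<close>)
    finally show ?thesis using fi[of h] fi[of 0] by simp
  qed
  have "((\<lambda>h. LINT x:D|lborel. (f (x + h *\<^sub>R ?e) - f x) / h) \<longlongrightarrow> (LINT x:D|lborel. g x)) (at 0)"
  proof (rule set_bounded_convergence_at[where B=B])
    fix h :: real and x assume "h \<in> UNIV - {0}"
    moreover have "\<bar>f (x + h *\<^sub>R ?e) - f x\<bar> \<le> B * \<bar>h\<bar>"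
      using has_pderiv_line_bound[of h f i g x B] der B by auto
    ultimately show "\<bar>(f (x + h *\<^sub>R ?e) - f x) / h\<bar> \<le> B" by (simp add: field_simps)
  next
    fix h :: real
    have [measurable]: "f \<in> borel_measurable borel" "(\<lambda>x. f (x + h *\<^sub>R ?e)) \<in> borel_measurable borel" "D \<in> sets borel"
      using fm fm0 D by auto
    show "set_borel_measurable lborel D (\<lambda>x. (f (x + h *\<^sub>R ?e) - f x) / h)"
      unfolding set_borel_measurable_def by measurable
  qed (use D der has_pderiv_quotient_tendsto in auto)
  moreover have "((\<lambda>h. LINT x:D|lborel. (f (x + h *\<^sub>R ?e) - f x) / h) \<longlongrightarrow> 0) (at 0)"
    by (rule Lim_transform_within[OF tendsto_const zero_less_one]) (use zero in \<open>simp del: set_integral_divide_zero\<close>)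
  ultimately have "(LINT x:D|lborel. g x) = 0"
    by (rule tendsto_unique[rotated]) simp
  moreover have "(LINT x:D|lborel. g x) = (LINT x|lborel. g x)"
    unfolding set_lebesgue_integral_def
    by (rule Bochner_Integration.integral_cong) (use g0 in \<open>auto simp: indicator_def\<close>)
  ultimately show ?thesis by simp
qed

text \<open>Only class C^1 is asked: the test functions that occur, such as a cutoff times
  \<open>G\<close> of the mollified vorticity, are not known to have more derivatives. The gradient
  is an argument so that statements can name it.\<close>

definition test_fun :: "(real^2) set \<Rightarrow> (real^2 \<Rightarrow> real) \<Rightarrow> (real^2 \<Rightarrow> real^2) \<Rightarrow> bool" where
  "test_fun D \<psi> g \<longleftrightarrow> continuous_on UNIV \<psi> \<and> continuous_on UNIV g \<and>
     (\<forall>x i. has_pderiv \<psi> i (g x $ i) x) \<and> (\<exists>K. compact K \<and> K \<subseteq> D \<and> (\<forall>x. x \<notin> K \<longrightarrow> \<psi> x = 0))"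

lemma has_pderiv_zero_outside:
  assumes "has_pderiv f i d x" "closed K" "x \<notin> K" "\<And>y. y \<notin> K \<Longrightarrow> f y = 0"
  shows "d = 0"
proof -
  have "has_pderiv f i 0 x"
    by (rule has_pderiv_transform_open[OF has_pderiv_const[of 0], of "-K"]) (use assms in auto)
  with assms(1) show ?thesis by (rule has_pderiv_unique)
qed

lemma test_fun_continuous:
  assumes "test_fun D \<psi> g"
  shows "continuous_on A \<psi>" "continuous_on A g"
  using assms continuous_on_subset[of UNIV \<psi> A] continuous_on_subset[of UNIV g A] by (auto simp: test_fun_def)

lemma test_fun_grad_zero:
  assumes "test_fun D \<psi> g" "compact K" "\<And>x. x \<notin> K \<Longrightarrow> \<psi> x = 0" "x \<notin> K"
  shows "g x = 0"
proof -
  have "g x $ i = 0" for i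
    by (rule has_pderiv_zero_outside[of \<psi> i _ x K])
      (use assms compact_imp_closed in \<open>auto simp: test_fun_def\<close>)
  then show ?thesis by (simp add: vec_eq_iff)
qed

lemma test_fun_bounded:
  assumes "test_fun D \<psi> g"
  obtains B where "B \<ge> 0" "\<And>x. \<bar>\<psi> x\<bar> \<le> B" "\<And>x. norm (g x) \<le> B"
proof -
  obtain K where K: "compact K" "\<And>x. x \<notin> K \<Longrightarrow> \<psi> x = 0" using assms by (auto simp: test_fun_def)
  have "bounded (\<psi> ` K)" "bounded (g ` K)"
    using assms K by (auto simp: test_fun_def intro!: compact_imp_bounded compact_continuous_image intro: continuous_on_subset)
  then obtain a b where a: "\<And>x. x \<in> K \<Longrightarrow> norm (\<psi> x) \<le> a" "\<And>x. x \<in> K \<Longrightarrow> norm (g x) \<le> b" "a > 0" "b > 0"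
    unfolding bounded_pos by auto
  show ?thesis
  proof
    show "max a b \<ge> 0" using a by auto
    fix x show "\<bar>\<psi> x\<bar> \<le> max a b" "norm (g x) \<le> max a b"
      using a(1,2)[of x] a(3,4) K(2)[of x] test_fun_grad_zero[OF assms K(1,2), of x] by (cases "x \<in> K"; simp add: max_def)+
  qed
qed

text \<open>Since \<open>K\<close> lies in \<open>D\<close>, the open sets \<open>D\<close> and
  \<open>- K\<close> cover the plane, and the extension by zero is C^1 on each. This turns products
  of a cutoff with functions controlled only inside \<open>D\<close>, such as the stream function,
  into test functions.\<close>

lemma test_fun_extend:
  assumes D: "open D" and f: "continuous_on D f" and g: "continuous_on D g"
    and der: "\<And>x i. x \<in> D \<Longrightarrow> has_pderiv f i (g x $ i) x"
    and K: "compact K" "K \<subseteq> D" "\<And>x. x \<in> D \<Longrightarrow> x \<notin> K \<Longrightarrow> f x = 0"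
  shows "test_fun D (\<lambda>x. if x \<in> D then f x else 0) (\<lambda>x. if x \<in> D then g x else 0)"
proof -
  have op: "open (D - K)" "open (- K)" using D K(1) by (auto simp: compact_imp_closed open_Diff)
  have g0: "g x = 0" if "x \<in> D" "x \<notin> K" for x
  proof -
    have "g x $ i = 0" for i
    proof -
      have "has_pderiv f i 0 x"
        by (rule has_pderiv_transform_open[OF has_pderiv_const[of 0] op(1)]) (use that K in auto)
      then show ?thesis using der[OF that(1)] has_pderiv_unique by blast
    qed
    then show ?thesis by (simp add: vec_eq_iff)
  qed
  have c: "continuous_on UNIV (\<lambda>x. if x \<in> D then h x else 0)"
    if h: "continuous_on D h" and h0: "\<And>x. x \<in> D \<Longrightarrow> x \<notin> K \<Longrightarrow> h x = 0" for h :: "real^2 \<Rightarrow> 'z::real_normed_vector"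
  proof -
    have "continuous_on (D \<union> -K) (\<lambda>x. if x \<in> D then h x else 0)"
    proof (rule continuous_on_open_Un[OF D op(2)])
      show "continuous_on D (\<lambda>x. if x \<in> D then h x else 0)" using h by (rule continuous_on_eq) auto
      show "continuous_on (-K) (\<lambda>x. if x \<in> D then h x else 0)"
        by (rule continuous_on_eq[OF continuous_on_const[of _ 0]]) (use h0 in auto)
    qed
    moreover have "D \<union> -K = UNIV" using K by auto
    ultimately show ?thesis by simp
  qed
  have p: "has_pderiv (\<lambda>x. if x \<in> D then f x else 0) i ((if x \<in> D then g x else 0) $ i) x" for x i
  proof (cases "x \<in> D")
    case True
    then show ?thesis by (auto intro!: has_pderiv_transform_open[OF der D])
  next
    case False
    then show ?thesis
      by (auto intro!: has_pderiv_transform_open[OF has_pderiv_const[of 0] op(2)] simp: K) (use K in auto)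
  qed
  show ?thesis
    unfolding test_fun_def using c[OF f] c[OF g] p K g0 by (intro conjI allI exI[of _ K]) auto
qed

text \<open>Extension by zero reduces this to the whole plane; compactness of \<open>K\<close>
  supplies the bound on the derivative.\<close>

lemma integral_pderiv_zero:
  assumes D: "open D" and f: "continuous_on D f" and g: "continuous_on D g"
    and der: "\<And>x. x \<in> D \<Longrightarrow> has_pderiv f i (g x) x"
    and K: "compact K" "K \<subseteq> D" "\<And>x. x \<in> D \<Longrightarrow> x \<notin> K \<Longrightarrow> f x = 0"
  shows "(LINT x:D|lborel. g x) = 0"
proof -
  have op: "open (D - K)" "open (- K)" using D K(1) by (auto simp: compact_imp_closed open_Diff)
  have g0: "g x = 0" if "x \<in> D" "x \<notin> K" for x
  proof -
    have "has_pderiv f i 0 x"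
      by (rule has_pderiv_transform_open[OF has_pderiv_const[of 0] op(1)]) (use that K in auto)
    then show ?thesis using der[OF that(1)] has_pderiv_unique by blast
  qed
  define F where "F x = (if x \<in> D then f x else 0)" for x
  define G where "G x = (if x \<in> D then g x else 0)" for x
  have "continuous_on (D \<union> -K) F"
  proof (rule continuous_on_open_Un[OF D op(2)])
    show "continuous_on D F" using f by (rule continuous_on_eq) (auto simp: F_def)
    show "continuous_on (-K) F"
      by (rule continuous_on_eq[OF continuous_on_const[of _ 0]]) (use K in \<open>auto simp: F_def\<close>)
  qed
  moreover have "D \<union> -K = UNIV" using K by auto
  ultimately have Fc: "continuous_on UNIV F" by simp
  have p: "has_pderiv F i (G x) x" for x
  proof (cases "x \<in> D")
    case True
    then show ?thesis by (auto intro!: has_pderiv_transform_open[OF der D] simp: F_def G_def)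
  next
    case False
    then show ?thesis
      using has_pderiv_transform_open[OF has_pderiv_const[of 0] op(2), of x F i] K
      by (fastforce simp: F_def G_def)
  qed
  have "bounded (g ` K)"
    using g K by (auto intro!: compact_imp_bounded compact_continuous_image intro: continuous_on_subset)
  then obtain b where b: "\<And>x. x \<in> K \<Longrightarrow> norm (g x) \<le> b" "b > 0"
    unfolding bounded_pos by auto
  have "(LINT x|lborel. G x) = 0"
  proof (rule integral_pderiv_zero_UNIV[OF Fc p, of b K])
    show "\<bar>G x\<bar> \<le> b" for x using b(1)[of x] b(2) g0[of x] by (cases "x \<in> K") (auto simp: G_def)
  qed (use K in \<open>auto simp: F_def compact_imp_bounded\<close>)
  moreover have "(LINT x|lborel. G x) = (LINT x:D|lborel. g x)"
    unfolding set_lebesgue_integral_def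
    by (rule Bochner_Integration.integral_cong) (auto simp: indicator_def G_def)
  ultimately show ?thesis by simp
qed

lemma test_fun_translate:
  assumes "test_fun D \<psi> g" "compact K" "\<And>x. x \<notin> K \<Longrightarrow> \<psi> x = 0" "(\<lambda>x. x - c) ` K \<subseteq> D"
  shows "test_fun D (\<lambda>x. \<psi> (c + x)) (\<lambda>x. g (c + x))"
  unfolding test_fun_def
proof (intro conjI allI exI[of _ "(\<lambda>x. x - c) ` K"] impI)
  show "continuous_on UNIV (\<lambda>x. \<psi> (c + x))" "continuous_on UNIV (\<lambda>x. g (c + x))"
    using assms(1) unfolding test_fun_def
    by (auto intro!: continuous_on_compose2[where g=\<psi> and t=UNIV] continuous_on_compose2[where g=g and t=UNIV] continuous_intros)
  show "has_pderiv (\<lambda>x. \<psi> (c + x)) i (g (c + x) $ i) x" for x i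
    using assms(1) by (intro has_pderiv_translate) (auto simp: test_fun_def)
  show "compact ((\<lambda>x. x - c) ` K)"
    using assms(2) by (intro compact_continuous_image continuous_intros)
  show "\<psi> (c + x) = 0" if "x \<notin> (\<lambda>x. x - c) ` K" for x
    by (rule assms(3)) (use that in \<open>auto simp: image_iff\<close>)
qed (use assms in auto)

lemma test_fun_linear:
  assumes f: "test_fun D f f'" and g: "test_fun D g g'"
  shows "test_fun D (\<lambda>x. a * f x + b * g x) (\<lambda>x. a *\<^sub>R f' x + b *\<^sub>R g' x)"
proof -
  obtain K L where "compact K" "K \<subseteq> D" "\<forall>x. x \<notin> K \<longrightarrow> f x = 0" "compact L" "L \<subseteq> D" "\<forall>x. x \<notin> L \<longrightarrow> g x = 0"
    using f g unfolding test_fun_def by blast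
  then have "\<exists>K. compact K \<and> K \<subseteq> D \<and> (\<forall>x. x \<notin> K \<longrightarrow> a * f x + b * g x = 0)"
    by (intro exI[of _ "K \<union> L"]) (auto simp: compact_Un)
  moreover have "has_pderiv (\<lambda>x. a * f x + b * g x) i ((a *\<^sub>R f' x + b *\<^sub>R g' x) $ i) x" for i x
    using f g by (auto simp: test_fun_def intro!: has_pderiv_add has_pderiv_cmult)
  ultimately show ?thesis
    using f g unfolding test_fun_def by (auto intro!: continuous_intros)
qed

text \<open>Both terms stay under one integral, which is that of a derivative of
  \<open>\<psi> * p\<close>. This product has compact support in \<open>D\<close>, so
  \<open>p\<close> may be unbounded near the frontier.\<close>

lemma test_fun_integral_pderiv:
  assumes D: "open D" and \<psi>: "test_fun D \<psi> g"
    and p: "continuous_on D p" "continuous_on D p'" "\<And>x. x \<in> D \<Longrightarrow> has_pderiv p i (p' x) x"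
  shows "(LINT x:D|lborel. g x $ i * p x + \<psi> x * p' x) = 0"
proof -
  obtain K where K: "compact K" "K \<subseteq> D" "\<And>x. x \<notin> K \<Longrightarrow> \<psi> x = 0" using \<psi> by (auto simp: test_fun_def)
  note c = test_fun_continuous[OF \<psi>, of D]
  show ?thesis
  proof (rule integral_pderiv_zero[OF D, where f="\<lambda>x. \<psi> x * p x" and K=K and i=i])
    show "has_pderiv (\<lambda>x. \<psi> x * p x) i (g x $ i * p x + \<psi> x * p' x) x" if "x \<in> D" for x
      using \<psi> p that by (intro has_pderiv_mult) (auto simp: test_fun_def)
  qed (use K c p in \<open>auto intro!: continuous_intros\<close>)
qed

lemma set_integrable_test:
  fixes \<psi> p :: "real^2 \<Rightarrow> real"
  assumes D: "open D" "bounded D" and c: "continuous_on D \<psi>" "continuous_on D p"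
    and "\<And>x. x \<in> D \<Longrightarrow> \<bar>\<psi> x\<bar> \<le> A" "\<And>x. x \<in> D \<Longrightarrow> \<bar>p x\<bar> \<le> B"
  shows "set_integrable lborel D (\<lambda>x. \<psi> x * p x)"
proof (rule set_integrable_bounded_continuous[OF D, of _ "A * B"])
  show "\<bar>\<psi> x * p x\<bar> \<le> A * B" if "x \<in> D" for x
    unfolding abs_mult using assms(5,6)[OF that] by (intro mult_mono) linarith+
qed (use c in \<open>auto intro!: continuous_intros\<close>)

lemma test_fun_integral_by_parts:
  assumes D: "open D" "bounded D" and \<psi>: "test_fun D \<psi> g"
    and p: "continuous_on D p" "continuous_on D p'" "\<And>x. x \<in> D \<Longrightarrow> has_pderiv p i (p' x) x"
      "\<And>x. x \<in> D \<Longrightarrow> \<bar>p x\<bar> \<le> B" "\<And>x. x \<in> D \<Longrightarrow> \<bar>p' x\<bar> \<le> B"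
  shows "(LINT x:D|lborel. \<psi> x * p' x) = - (LINT x:D|lborel. g x $ i * p x)"
proof -
  obtain A where A: "A \<ge> 0" "\<And>x. \<bar>\<psi> x\<bar> \<le> A" "\<And>x. norm (g x) \<le> A" using test_fun_bounded[OF \<psi>] by blast
  have A': "\<bar>g x $ i\<bar> \<le> A" for x
    using A(3)[of x] component_le_norm_cart[of "g x" i] by linarith
  note c = test_fun_continuous(1)[OF \<psi>, of D] continuous_on_component[OF test_fun_continuous(2)[OF \<psi>, of D], of i]
  have "set_integrable lborel D (\<lambda>x. g x $ i * p x)"
    by (rule set_integrable_test[OF D c(2) p(1), of A B]) (use A' p in auto)
  moreover have "set_integrable lborel D (\<lambda>x. \<psi> x * p' x)"
    by (rule set_integrable_test[OF D c(1) p(2), of A B]) (use A p in auto)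
  ultimately have "(LINT x:D|lborel. g x $ i * p x + \<psi> x * p' x)
      = (LINT x:D|lborel. g x $ i * p x) + (LINT x:D|lborel. \<psi> x * p' x)"
    by (rule set_integral_add(2))
  then show ?thesis
    using test_fun_integral_pderiv[OF D(1) \<psi> p(1-3)] by linarith
qed

text \<open>Moving a difference quotient from one factor to the other replaces the second derivatives
  of the test function that a direct integration by parts would need.\<close>

lemma test_fun_integral_swap:
  assumes D: "open D" "bounded D" and \<psi>: "test_fun D \<psi> g"
    and p: "continuous_on D p" "continuous_on D q" "\<And>x k. x \<in> D \<Longrightarrow> has_pderiv p k (q x $ k) x"
      "\<And>x. x \<in> D \<Longrightarrow> \<bar>p x\<bar> \<le> B" "\<And>x. x \<in> D \<Longrightarrow> norm (q x) \<le> B"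
  shows "(LINT x:D|lborel. g x $ i * q x $ j) = (LINT x:D|lborel. g x $ j * q x $ i)"
proof -
  let ?e = "axis i 1 :: real^2"
  obtain K where K: "compact K" "K \<subseteq> D" "\<And>x. x \<notin> K \<Longrightarrow> \<psi> x = 0" using \<psi> by (auto simp: test_fun_def)
  \<comment> \<open>Room to shift \<open>K\<close> by up to \<open>r\<close> without leaving
    \<open>D\<close>.\<close>
  obtain r where r: "r > 0" "(\<Union>x\<in>K. cball x r) \<subseteq> D"
    using compact_subset_open_imp_cball_epsilon_subset[OF K(1) D(1) K(2)] by blast
  note g0 = test_fun_grad_zero[OF \<psi> K(1,3)]
  have qc: "\<bar>q x $ k\<bar> \<le> B" if "x \<in> D" for x k
    using p(5)[OF that] component_le_norm_cart[of "q x" k] by linarith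
  obtain A where A: "A \<ge> 0" "\<And>x. \<bar>\<psi> x\<bar> \<le> A" "\<And>x. norm (g x) \<le> A" using test_fun_bounded[OF \<psi>] by blast
  have Ac: "\<bar>g x $ k\<bar> \<le> A" for x k
    using A(3)[of x] component_le_norm_cart[of "g x" k] by linarith
  have gc: "continuous_on UNIV (\<lambda>x. g x $ k)" and \<psi>c: "continuous_on UNIV \<psi>" for k
    using \<psi> by (auto simp: test_fun_def intro!: continuous_intros)
  have qcc: "continuous_on D (\<lambda>x. q x $ k)" for k using p by (auto intro!: continuous_intros)
  have fin: "D \<in> sets lborel" "emeasure lborel D < \<infinity>" using D emeasure_bounded_lborel by auto
  have tr: "continuous_on S (\<lambda>x. f (h *\<^sub>R ?e + x))" if "continuous_on UNIV f" for f :: "real^2 \<Rightarrow> real" and h S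
    by (rule continuous_on_compose2[OF that]) (auto intro!: continuous_intros)
  have inD: "x + h *\<^sub>R ?e \<in> D" if "x \<in> K" "\<bar>h\<bar> \<le> r" for x h
    using that r by (auto simp: dist_norm intro!: subsetD[OF r(2)])
  \<comment> \<open>The difference quotient of \<open>\<psi>\<close> in direction \<open>i\<close>
    is itself a test function, so integration by parts in direction \<open>j\<close> applies to it.
    A translation then moves the quotient onto \<open>p\<close>, with \<open>- h\<close> in place of
    \<open>h\<close>.\<close>
  have key: "(LINT x:D|lborel. (\<psi> (x + h *\<^sub>R ?e) - \<psi> x) / h * q x $ j)
      = (LINT x:D|lborel. g x $ j * ((p (x + (-h) *\<^sub>R ?e) - p x) / (-h)))" if h: "h \<noteq> 0" "\<bar>h\<bar> < r" for h
  proof -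
    define c where "c = h *\<^sub>R ?e"
    have t1: "test_fun D (\<lambda>x. \<psi> (c + x)) (\<lambda>x. g (c + x))"
    proof (rule test_fun_translate[OF \<psi> K(1,3)])
      show "(\<lambda>x. x - c) ` K \<subseteq> D"
        using inD[of _ "-h"] h by (auto simp: c_def)
    qed
    have t: "test_fun D (\<lambda>x. (1/h) * \<psi> (c + x) + (- 1/h) * \<psi> x) (\<lambda>x. (1/h) *\<^sub>R g (c + x) + (-1/h) *\<^sub>R g x)"
      by (rule test_fun_linear[OF t1 \<psi>])
    have ibp: "(LINT x:D|lborel. ((1/h) * \<psi> (c + x) + (- 1/h) * \<psi> x) * q x $ j)
       = - (LINT x:D|lborel. ((1/h) *\<^sub>R g (c + x) + (-1/h) *\<^sub>R g x) $ j * p x)"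
      by (rule test_fun_integral_by_parts[OF D t p(1) _ p(3), where B=B]) (use p qcc qc in auto)
    have gt: "continuous_on UNIV (\<lambda>x. g (c + x) $ j)" unfolding c_def by (rule tr[OF gc])
    have i1: "set_integrable lborel D (\<lambda>x. g (c + x) $ j * p x)"
      by (rule set_integrable_test[OF D, of _ _ A B]) (use continuous_on_subset[OF gt subset_UNIV] Ac p in auto)
    have i2: "set_integrable lborel D (\<lambda>x. g x $ j * p x)"
      by (rule set_integrable_test[OF D, of _ _ A B]) (use continuous_on_subset[OF gc subset_UNIV] Ac p in auto)
    have pm: "(\<lambda>x. indicator D x * p x) \<in> borel_measurable borel"
      using borel_measurable_continuous_on_indicator[of D p] D p by (simp add: scaleR_conv_of_real)
    have pmc: "(\<lambda>x. indicator D (x - c) * p (x - c)) \<in> borel_measurable borel"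
      by (rule measurable_compose[OF _ pm, where f="\<lambda>x. x - c"]) auto
    have [measurable]: "(\<lambda>x. g x $ j) \<in> borel_measurable borel" by (rule borel_measurable_continuous_onI[OF gc])
    \<comment> \<open>\<open>g\<close> vanishes off \<open>K\<close>, and for \<open>x\<close> in
      \<open>K\<close> both \<open>x\<close> and \<open>x - c\<close> lie in \<open>D\<close>; so
      the translated indicator may be exchanged for the original one.\<close>
    have eqK: "g x $ j * (indicator D (x - c) * p (x - c)) = g x $ j * (indicator D x * p (x - c))" for x
      using g0[of x] inD[of x "-h"] h K(2) by (cases "x \<in> K") (auto simp: c_def)
    have m1: "(\<lambda>x. g x $ j * (indicator D (x - c) * p (x - c))) \<in> borel_measurable borel"
      using pmc by measurable
    have "(LINT x:D|lborel. g (c + x) $ j * p x)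
       = (LINT x|lborel. g (c + x) $ j * (indicator D ((c + x) - c) * p ((c + x) - c)))"
      unfolding set_lebesgue_integral_def by (intro Bochner_Integration.integral_cong) auto
    also have "\<dots> = (LINT x|lborel. g x $ j * (indicator D (x - c) * p (x - c)))"
      by (rule lborel_integral_translate[OF m1])
    also have "\<dots> = (LINT x:D|lborel. g x $ j * p (x - c))"
      unfolding set_lebesgue_integral_def eqK by (intro Bochner_Integration.integral_cong) auto
    finally have e1: "(LINT x:D|lborel. g (c + x) $ j * p x) = (LINT x:D|lborel. g x $ j * p (x - c))" .
    have i3: "set_integrable lborel D (\<lambda>x. g x $ j * p (x - c))"
    proof (rule set_integrable_bounded[OF _ D(2), of _ "A * B"])
      show "set_borel_measurable lborel D (\<lambda>x. g x $ j * p (x - c))"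
        using m1 unfolding eqK set_borel_measurable_def by (simp add: mult_ac)
      show "\<bar>g x $ j * p (x - c)\<bar> \<le> A * B" if "x \<in> D" for x
      proof (cases "x \<in> K")
        case True
        then have "\<bar>p (x - c)\<bar> \<le> B" using inD[of x "-h"] h p by (auto simp: c_def)
        then show ?thesis unfolding abs_mult using Ac[of x j] by (intro mult_mono) linarith+
      next
        case False
        then show ?thesis using g0 A p(4)[OF that] by auto
      qed
    qed (use D in auto)
    have "(LINT x:D|lborel. ((1/h) *\<^sub>R g (c + x) + (-1/h) *\<^sub>R g x) $ j * p x)
       = (LINT x:D|lborel. (1/h) * (g (c + x) $ j * p x) - (1/h) * (g x $ j * p x))"
      by (intro set_lebesgue_integral_cong) (use D in \<open>auto simp: algebra_simps\<close>)
    also have "\<dots> = (1/h) * (LINT x:D|lborel. g (c + x) $ j * p x) - (1/h) * (LINT x:D|lborel. g x $ j * p x)"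
      using i1 i2 by (subst set_integral_diff) (auto simp del: divide_inverse intro: set_integrable_mult_right)
    also have "\<dots> = (1/h) * (LINT x:D|lborel. g x $ j * p (x - c)) - (1/h) * (LINT x:D|lborel. g x $ j * p x)"
      unfolding e1 ..
    also have "\<dots> = (LINT x:D|lborel. (1/h) * (g x $ j * p (x - c)) - (1/h) * (g x $ j * p x))"
      using i3 i2 by (subst set_integral_diff) (auto simp del: divide_inverse intro: set_integrable_mult_right)
    also have "\<dots> = - (LINT x:D|lborel. g x $ j * ((p (x + (-h) *\<^sub>R ?e) - p x) / (-h)))"
      unfolding set_lebesgue_integral_def Bochner_Integration.integral_minus[symmetric]
      by (intro Bochner_Integration.integral_cong) (use h in \<open>auto simp: c_def field_simps\<close>)
    finally show ?thesis using ibp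
      by (simp add: c_def add.commute diff_divide_distrib)
  qed
  have L: "((\<lambda>h. LINT x:D|lborel. (\<psi> (x + h *\<^sub>R ?e) - \<psi> x) / h * q x $ j) \<longlongrightarrow> (LINT x:D|lborel. g x $ i * q x $ j)) (at 0 within {-r<..<r})"
  proof (rule set_bounded_convergence_at[where B="A * B"])
    fix h assume h: "h \<in> {-r<..<r} - {0}"
    have "continuous_on D (\<lambda>x. (\<psi> (x + h *\<^sub>R ?e) - \<psi> x) / h * q x $ j)"
      using tr[OF \<psi>c, of D h] h continuous_on_subset[OF \<psi>c subset_UNIV, of D] qcc[of j]
      by (auto intro!: continuous_intros simp: add.commute)
    then show "set_borel_measurable lborel D (\<lambda>x. (\<psi> (x + h *\<^sub>R ?e) - \<psi> x) / h * q x $ j)"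
      by (rule set_borel_measurable_open[OF D(1)])
    fix x assume x: "x \<in> D"
    have "\<bar>\<psi> (x + h *\<^sub>R ?e) - \<psi> x\<bar> \<le> A * \<bar>h\<bar>"
      by (rule has_pderiv_line_bound[where g="\<lambda>x. g x $ i"]) (use \<psi> Ac in \<open>auto simp: test_fun_def\<close>)
    then have "\<bar>(\<psi> (x + h *\<^sub>R ?e) - \<psi> x) / h\<bar> \<le> A" using h by (simp add: field_simps)
    then show "\<bar>(\<psi> (x + h *\<^sub>R ?e) - \<psi> x) / h * q x $ j\<bar> \<le> A * B"
      unfolding abs_mult using qc[OF x, of j] A by (intro mult_mono) auto
  next
    fix x assume x: "x \<in> D"
    have "((\<lambda>h. (\<psi> (x + h *\<^sub>R ?e) - \<psi> x) / h * q x $ j) \<longlongrightarrow> g x $ i * q x $ j) (at 0)"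
      by (intro tendsto_intros has_pderiv_quotient_tendsto) (use \<psi> in \<open>auto simp: test_fun_def\<close>)
    then show "((\<lambda>h. (\<psi> (x + h *\<^sub>R ?e) - \<psi> x) / h * q x $ j) \<longlongrightarrow> g x $ i * q x $ j) (at 0 within {-r<..<r})"
      by (rule tendsto_within_subset) auto
  qed (use fin in auto)
  have R: "((\<lambda>h. LINT x:D|lborel. g x $ j * ((p (x + (-h) *\<^sub>R ?e) - p x) / (-h))) \<longlongrightarrow> (LINT x:D|lborel. g x $ j * q x $ i)) (at 0 within {-r<..<r})"
  proof (rule set_bounded_convergence_at[where B="A * B"])
    fix h assume h: "h \<in> {-r<..<r} - {0}"
    define k where "k x = g x $ j * ((p (x + (-h) *\<^sub>R ?e) - p x) / (-h))" for x
    \<comment> \<open>\<open>p\<close> is controlled only on \<open>D\<close>, so measurability is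
      first obtained where both \<open>x\<close> and its shift lie in \<open>D\<close>; on the rest
      of \<open>D\<close> the factor \<open>g\<close> vanishes.\<close>
    have "continuous_on (D \<inter> (\<lambda>x. x + (-h) *\<^sub>R ?e) -` D) k"
      unfolding k_def using h
      by (intro continuous_intros continuous_on_subset[OF gc] continuous_on_subset[OF p(1)] continuous_on_compose2[OF p(1)]) auto
    moreover have o2: "open (D \<inter> (\<lambda>x. x + (-h) *\<^sub>R ?e) -` D)"
      by (intro open_Int open_vimage D continuous_intros)
    ultimately have "set_borel_measurable lborel (D \<inter> (\<lambda>x. x + (-h) *\<^sub>R ?e) -` D) k"
      by (intro set_borel_measurable_open)
    moreover have "indicator (D \<inter> (\<lambda>x. x + (-h) *\<^sub>R ?e) -` D) x *\<^sub>R k x = indicator D x *\<^sub>R k x" for x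
      using g0[of x] inD[of x "-h"] h by (cases "x \<in> K") (auto simp: k_def indicator_def abs_if split: if_splits)
    ultimately have "set_borel_measurable lborel D k"
      unfolding set_borel_measurable_def by (rule subst[where P="\<lambda>f. f \<in> borel_measurable lborel", rotated, OF _ ext])
    then show "set_borel_measurable lborel D (\<lambda>x. g x $ j * ((p (x + (-h) *\<^sub>R ?e) - p x) / (-h)))"
      unfolding k_def .
    fix x assume x: "x \<in> D"
    show "\<bar>g x $ j * ((p (x + (-h) *\<^sub>R ?e) - p x) / (-h))\<bar> \<le> A * B"
    proof (cases "x \<in> K")
      case True
      have s: "x + s *\<^sub>R ?e \<in> D" if "s \<in> closed_segment 0 (-h)" for s
      proof (rule inD[OF True])
        have "\<bar>s\<bar> \<le> \<bar>h\<bar>" using segment_bound(1)[OF that] by simp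
        then show "\<bar>s\<bar> \<le> r" using h by auto
      qed
      have "\<bar>p (x + (-h) *\<^sub>R ?e) - p x\<bar> \<le> B * \<bar>-h\<bar>"
        by (rule has_pderiv_line_bound[where g="\<lambda>x. q x $ i"]) (use s p(3) qc in auto)
      then have "\<bar>(p (x + (-h) *\<^sub>R ?e) - p x) / (-h)\<bar> \<le> B" using h by (simp add: field_simps)
      then show ?thesis
        unfolding abs_mult using Ac[of x j] by (intro mult_mono) linarith+
    next
      case False
      then show ?thesis using g0 A p(4)[OF x] by auto
    qed
  next
    fix x assume x: "x \<in> D"
    have "filterlim (\<lambda>h. - h) (at 0) (at (0::real))"
      unfolding filterlim_at by (auto intro!: tendsto_eq_intros simp: eventually_at_filter)
    from filterlim_compose[OF has_pderiv_quotient_tendsto[OF p(3)[OF x, of i]] this]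
    have "((\<lambda>h. g x $ j * ((p (x + (-h) *\<^sub>R ?e) - p x) / (-h))) \<longlongrightarrow> g x $ j * q x $ i) (at 0)"
      by (intro tendsto_intros)
    then show "((\<lambda>h. g x $ j * ((p (x + (-h) *\<^sub>R ?e) - p x) / (-h))) \<longlongrightarrow> g x $ j * q x $ i) (at 0 within {-r<..<r})"
      by (rule tendsto_within_subset) auto
  qed (use fin in auto)
  have nt: "at 0 within {-r<..<r} \<noteq> bot" using r by (simp add: at_within_open_NO_MATCH)
  have "((\<lambda>h. LINT x:D|lborel. g x $ j * ((p (x + (-h) *\<^sub>R ?e) - p x) / (-h))) \<longlongrightarrow> (LINT x:D|lborel. g x $ i * q x $ j)) (at 0 within {-r<..<r})"
    by (rule Lim_transform_within[OF L r(1)]) (use key in auto)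
  from tendsto_unique[OF nt this R] show ?thesis .
qed


section \<open>Cutoff functions near the boundary\<close>

text \<open>A step of length proportional to the slope \<open>q' r\<close> lowers \<open>q\<close>
  by at least \<open>(q' r)\<^sup>2 / (4 * B)\<close>, which cannot exceed the gap
  \<open>\<kappa>\<close> between \<open>q r\<close> and a lower bound. The interval
  \<open>{-1..2}\<close> leaves room for steps of length at most 1 from points of
  \<open>{0..1}\<close>.\<close>

lemma near_minimum_derivative:
  fixes q q' :: "real \<Rightarrow> real"
  assumes der: "\<And>s. s \<in> {-1..2} \<Longrightarrow> (q has_real_derivative q' s) (at s)"
    and lip: "\<And>s t. s \<in> {-1..2} \<Longrightarrow> t \<in> {-1..2} \<Longrightarrow> \<bar>q' s - q' t\<bar> \<le> B * \<bar>s - t\<bar>"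
    and B: "B > 0" "\<bar>q' r\<bar> \<le> 2 * B" and r: "r \<in> {0..1}"
    and m: "\<And>s. s \<in> {-1..2} \<Longrightarrow> m \<le> q s" "q r \<le> m + \<kappa>"
  shows "(q' r)\<^sup>2 \<le> 4 * B * \<kappa>"
proof (cases "q' r = 0")
  case True
  then show ?thesis using m(1)[of r] m(2) r B by (auto simp: zero_le_mult_iff)
next
  case False
  \<comment> \<open>The minimiser of \<open>\<tau> * q' r + B * \<tau>\<^sup>2\<close>, a bound for
    the increment of \<open>q\<close>. The bound \<open>2 * B\<close> on the slope makes it at most
    1 in absolute value.\<close>
  define \<tau> where "\<tau> = - q' r / (2 * B)"
  have \<tau>: "\<bar>\<tau>\<bar> \<le> 1" "\<tau> \<noteq> 0" using B False by (auto simp: \<tau>_def field_simps)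
  have "\<exists>\<xi>. \<xi> \<in> closed_segment r (r + \<tau>) \<and> q (r + \<tau>) - q r = \<tau> * q' \<xi>"
  proof (cases "\<tau> > 0")
    case True
    then have "\<exists>z. r < z \<and> z < r + \<tau> \<and> q (r + \<tau>) - q r = (r + \<tau> - r) * q' z"
      by (intro MVT2 der) (use \<tau> r in auto)
    then obtain z where "r < z" "z < r + \<tau>" "q (r + \<tau>) - q r = (r + \<tau> - r) * q' z" by blast
    then show ?thesis by (intro exI[of _ z]) (auto simp: closed_segment_eq_real_ivl)
  next
    case False
    then have "\<exists>z. r + \<tau> < z \<and> z < r \<and> q r - q (r + \<tau>) = (r - (r + \<tau>)) * q' z"
      by (intro MVT2 der) (use \<tau> r in auto)
    then obtain z where "r + \<tau> < z" "z < r" "q r - q (r + \<tau>) = (r - (r + \<tau>)) * q' z" by blast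
    then show ?thesis by (intro exI[of _ z]) (auto simp: closed_segment_eq_real_ivl)
  qed
  then obtain \<xi> where \<xi>: "\<xi> \<in> closed_segment r (r + \<tau>)" "q (r + \<tau>) - q r = \<tau> * q' \<xi>" by blast
  have x: "\<bar>\<xi> - r\<bar> \<le> \<bar>\<tau>\<bar>" using segment_bound(1)[OF \<xi>(1)] by simp
  then have "\<bar>q' \<xi> - q' r\<bar> \<le> B * \<bar>\<xi> - r\<bar>"
    by (intro lip) (use \<tau> r in auto)
  also have "\<dots> \<le> B * \<bar>\<tau>\<bar>" using x B by simp
  finally have "\<bar>\<tau> * (q' \<xi> - q' r)\<bar> \<le> \<bar>\<tau>\<bar> * (B * \<bar>\<tau>\<bar>)"
    unfolding abs_mult by (intro mult_left_mono) auto
  then have "\<tau> * q' \<xi> \<le> \<tau> * q' r + B * \<tau>\<^sup>2"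
    by (simp add: algebra_simps power2_eq_square abs_le_iff)
  also have "\<dots> = - (q' r)\<^sup>2 / (4 * B)"
    using B by (simp add: \<tau>_def field_simps power2_eq_square)
  finally have "q (r + \<tau>) - q r \<le> - (q' r)\<^sup>2 / (4 * B)" using \<xi> by simp
  moreover have "r + \<tau> \<in> {-1..2}" using \<tau>(1) r by (simp add: abs_le_iff)
  then have "- \<kappa> \<le> q (r + \<tau>) - q r" using m(1)[of "r + \<tau>"] m(2) by linarith
  ultimately have "(q' r)\<^sup>2 / (4 * B) \<le> \<kappa>" by simp
  then show ?thesis using B by (simp add: field_simps)
qed

text \<open>At a nearest point of a curve the connecting vector is normal. At an almost nearest one
  the squared distance along the curve still has small slope, so the vector is almost normal,
  whether or not the nearest point is unique. The factor \<open>2 * A\<^sup>2 + 2 * R * A\<close>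
  bounds the second derivative of the squared distance.\<close>

lemma near_foot_orthogonal:
  fixes \<gamma> \<gamma>' \<gamma>'' :: "real \<Rightarrow> real^2"
  assumes d1: "\<And>s. (\<gamma> has_vector_derivative \<gamma>' s) (at s)"
    and d2: "\<And>s. (\<gamma>' has_vector_derivative \<gamma>'' s) (at s)"
    and A: "A > 0" "\<And>s. s \<in> {-1..2} \<Longrightarrow> norm (\<gamma>' s) \<le> A" "\<And>s. s \<in> {-1..2} \<Longrightarrow> norm (\<gamma>'' s) \<le> A"
    and R: "\<And>s. s \<in> {-1..2} \<Longrightarrow> norm (x - \<gamma> s) \<le> R" "R > 0"
    and d: "\<And>s. s \<in> {-1..2} \<Longrightarrow> d \<le> norm (x - \<gamma> s)" "d \<ge> 0"
    and r: "r \<in> {0..1}" "(norm (x - \<gamma> r))\<^sup>2 \<le> d\<^sup>2 + \<kappa>"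
  shows "((x - \<gamma> r) \<bullet> \<gamma>' r)\<^sup>2 \<le> (2 * A\<^sup>2 + 2 * R * A) * \<kappa>"
proof -
  define q where "q s = (x - \<gamma> s) \<bullet> (x - \<gamma> s)" for s
  define q' where "q' s = - 2 * ((x - \<gamma> s) \<bullet> \<gamma>' s)" for s
  define q'' where "q'' s = 2 * (\<gamma>' s \<bullet> \<gamma>' s) - 2 * ((x - \<gamma> s) \<bullet> \<gamma>'' s)" for s
  define B where "B = 2 * A\<^sup>2 + 2 * R * A"
  have Bp: "B > 0" using A R by (simp add: B_def add_pos_pos)
  have dg: "(\<gamma> has_derivative (\<lambda>h. h *\<^sub>R \<gamma>' s)) (at s)" "(\<gamma>' has_derivative (\<lambda>h. h *\<^sub>R \<gamma>'' s)) (at s)" for s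
    using d1 d2 by (auto simp: has_vector_derivative_def)
  have q1: "(q has_real_derivative q' s) (at s)" for s
    unfolding q_def q'_def has_field_derivative_def
    by (auto intro!: derivative_eq_intros dg simp: inner_commute algebra_simps fun_eq_iff)
  have q2: "(q' has_real_derivative q'' s) (at s)" for s
    unfolding q'_def q''_def has_field_derivative_def
    by (auto intro!: derivative_eq_intros dg simp: inner_commute algebra_simps fun_eq_iff)
  have q2b: "\<bar>q'' s\<bar> \<le> B" if s: "s \<in> {-1..2}" for s
  proof -
    have "\<bar>\<gamma>' s \<bullet> \<gamma>' s\<bar> \<le> A * A"
      by (rule order_trans[OF Cauchy_Schwarz_ineq2]) (use A s in \<open>auto intro!: mult_mono\<close>)
    moreover have "\<bar>(x - \<gamma> s) \<bullet> \<gamma>'' s\<bar> \<le> R * A"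
      by (rule order_trans[OF Cauchy_Schwarz_ineq2]) (use A R s in \<open>auto intro!: mult_mono\<close>)
    ultimately show ?thesis unfolding q''_def B_def power2_eq_square by linarith
  qed
  have "(q' r)\<^sup>2 \<le> 4 * B * \<kappa>"
  proof (rule near_minimum_derivative[where q=q and q'=q' and r=r and B=B and m="d\<^sup>2"])
    show "\<bar>q' s - q' t\<bar> \<le> B * \<bar>s - t\<bar>" if "s \<in> {-1..2}" "t \<in> {-1..2}" for s t
      by (rule real_quotient_bound[where J="{-1..2}" and f'=q'']) (use q2 q2b that in \<open>auto intro: has_field_derivative_at_within\<close>)
    have "\<bar>(x - \<gamma> r) \<bullet> \<gamma>' r\<bar> \<le> R * A"
      by (rule order_trans[OF Cauchy_Schwarz_ineq2]) (use A R r in \<open>auto intro!: mult_mono\<close>)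
    moreover have "A * A > 0" "R * A > 0" using A R by auto
    moreover have "B = 2 * (A * A) + 2 * (R * A)" by (simp add: B_def power2_eq_square)
    ultimately show "\<bar>q' r\<bar> \<le> 2 * B" unfolding q'_def by linarith
    show "d\<^sup>2 \<le> q s" if "s \<in> {-1..2}" for s
      unfolding q_def power2_norm_eq_inner[symmetric] using d that by (intro power_mono) auto
    show "q r \<le> d\<^sup>2 + \<kappa>" using r by (simp add: q_def power2_norm_eq_inner)
  qed (use q1 Bp r in auto)
  then have "4 * ((x - \<gamma> r) \<bullet> \<gamma>' r)\<^sup>2 \<le> 4 * (B * \<kappa>)"
    by (simp add: q'_def power_mult_distrib mult.assoc)
  then show ?thesis unfolding B_def by linarith
qed

context
  fixes P :: "'k set" and p :: "'k \<Rightarrow> real^2" and b :: real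
begin

text \<open>A smooth substitute for the squared distance to the points \<open>p k\<close>: as \<open>b\<close> grows, the weights
  concentrate on the nearest of these points.\<close>

definition soft_weight :: "real^2 \<Rightarrow> 'k \<Rightarrow> real" where
  "soft_weight x k = exp (- b * (norm (x - p k))\<^sup>2) / (\<Sum>j\<in>P. exp (- b * (norm (x - p j))\<^sup>2))"

definition soft_min :: "real^2 \<Rightarrow> real" where
  "soft_min x = - ln (\<Sum>k\<in>P. exp (- b * (norm (x - p k))\<^sup>2)) / b"

definition soft_grad :: "real^2 \<Rightarrow> real^2" where
  "soft_grad x = (\<Sum>k\<in>P. (2 * soft_weight x k) *\<^sub>R (x - p k))"

context
  assumes P: "finite P" "P \<noteq> {}" and l: "b > 0"
begin

lemma soft_sum_pos: "(\<Sum>k\<in>P. exp (- b * (norm (x - p k))\<^sup>2)) > 0"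
  using P by (intro sum_pos) auto

lemma soft_weight_nonneg: "soft_weight x k \<ge> 0"
  unfolding soft_weight_def using soft_sum_pos[of x] by auto

lemma soft_weight_sum: "(\<Sum>k\<in>P. soft_weight x k) = 1"
  unfolding soft_weight_def sum_divide_distrib[symmetric] using soft_sum_pos[of x] by auto

lemma soft_min_le: "k \<in> P \<Longrightarrow> soft_min x \<le> (norm (x - p k))\<^sup>2"
proof -
  assume k: "k \<in> P"
  have "exp (- b * (norm (x - p k))\<^sup>2) \<le> (\<Sum>k\<in>P. exp (- b * (norm (x - p k))\<^sup>2))"
    by (rule member_le_sum) (use k P in auto)
  then have "- b * (norm (x - p k))\<^sup>2 \<le> ln (\<Sum>k\<in>P. exp (- b * (norm (x - p k))\<^sup>2))"
    using soft_sum_pos[of x] by (subst ln_ge_iff) auto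
  then show ?thesis unfolding soft_min_def using l by (simp add: field_simps)
qed

text \<open>Each exponential is at most \<open>exp (- b * m)\<close>; the number of summands costs
  \<open>ln (card P) / b\<close>, which vanishes as \<open>b\<close> grows.\<close>

lemma soft_min_ge:
  assumes "\<And>k. k \<in> P \<Longrightarrow> m \<le> (norm (x - p k))\<^sup>2"
  shows "m - ln (card P) / b \<le> soft_min x"
proof -
  have "(\<Sum>k\<in>P. exp (- b * (norm (x - p k))\<^sup>2)) \<le> card P * exp (- b * m)"
    by (rule sum_bounded_above) (use assms l in auto)
  then have "ln (\<Sum>k\<in>P. exp (- b * (norm (x - p k))\<^sup>2)) \<le> ln (card P * exp (- b * m))"
    using soft_sum_pos[of x] by (intro ln_mono) auto
  also have "\<dots> = ln (card P) - b * m"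
    using P by (subst ln_mult) (auto simp: card_gt_0_iff)
  finally have "- (ln (card P) - b * m) / b \<le> soft_min x"
    unfolding soft_min_def using l by (intro divide_right_mono) auto
  then show ?thesis using l by (simp add: diff_divide_distrib)
qed

text \<open>Points that are not almost nearest get exponentially small weight. Up to a negligible
  part, \<open>soft_grad\<close> thus averages vectors joining almost nearest points to
  \<open>x\<close>, to which \<open>near_foot_orthogonal\<close> applies.\<close>

lemma soft_weight_far:
  assumes "j \<in> P" "(norm (x - p j))\<^sup>2 + \<kappa> \<le> (norm (x - p k))\<^sup>2"
  shows "soft_weight x k \<le> exp (- b * \<kappa>)"
proof -
  have "exp (- b * (norm (x - p j))\<^sup>2) \<le> (\<Sum>k\<in>P. exp (- b * (norm (x - p k))\<^sup>2))"
    by (rule member_le_sum) (use assms P in auto)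
  then have "soft_weight x k \<le> exp (- b * (norm (x - p k))\<^sup>2) / exp (- b * (norm (x - p j))\<^sup>2)"
    unfolding soft_weight_def by (intro divide_left_mono mult_pos_pos soft_sum_pos) simp_all
  also have "\<dots> = exp (- b * ((norm (x - p k))\<^sup>2 - (norm (x - p j))\<^sup>2))"
    by (simp add: exp_diff[symmetric] algebra_simps)
  also have "\<dots> \<le> exp (- b * \<kappa>)" using assms l by auto
  finally show ?thesis .
qed

lemma soft_min_has_pderiv: "has_pderiv soft_min i (soft_grad x $ i) x"
proof -
  define E where "E x = (\<Sum>k\<in>P. exp (- b * (norm (x - p k))\<^sup>2))" for x
  have "has_pderiv (\<lambda>x. exp (- b * (norm (x - p k))\<^sup>2)) i (exp (- b * (norm (x - p k))\<^sup>2) * (- b * (2 * (x - p k) $ i))) x" for k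
  proof (rule has_pderiv_chain[where G=exp], simp, rule has_pderiv_cmult)
    have "((\<lambda>x. (x - p k) \<bullet> (x - p k)) has_derivative (\<lambda>h. 2 * ((x - p k) \<bullet> h))) (at x)"
      by (auto intro!: derivative_eq_intros simp: inner_commute)
    from has_pderiv_of_derivative[OF this, of i]
    show "has_pderiv (\<lambda>x. (norm (x - p k))\<^sup>2) i (2 * (x - p k) $ i) x"
      by (simp add: power2_norm_eq_inner inner_axis)
  qed
  then have E: "has_pderiv E i (\<Sum>k\<in>P. exp (- b * (norm (x - p k))\<^sup>2) * (- b * (2 * (x - p k) $ i))) x"
    unfolding E_def by (intro has_pderiv_sum)
  have "has_pderiv (\<lambda>x. (- 1 / b) * ln (E x)) i ((- 1 / b) * ((1 / E x) * (\<Sum>k\<in>P. exp (- b * (norm (x - p k))\<^sup>2) * (- b * (2 * (x - p k) $ i))))) x"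
  proof (intro has_pderiv_cmult has_pderiv_chain[where G=ln, OF _ E])
    show "(ln has_real_derivative 1 / E x) (at (E x))"
      by (rule DERIV_ln_divide) (use soft_sum_pos in \<open>auto simp: E_def\<close>)
  qed
  moreover have "(\<lambda>x. (- 1 / b) * ln (E x)) = soft_min" by (auto simp: E_def soft_min_def fun_eq_iff)
  moreover have "(- 1 / b) * ((1 / E x) * (\<Sum>k\<in>P. exp (- b * (norm (x - p k))\<^sup>2) * (- b * (2 * (x - p k) $ i)))) = soft_grad x $ i"
    unfolding soft_grad_def soft_weight_def E_def[symmetric] sum_component sum_distrib_left
    using l by (intro sum.cong) auto
  ultimately show ?thesis by simp
qed

lemma continuous_on_soft_min: "continuous_on S soft_min"
  unfolding soft_min_def using soft_sum_pos l
  by (intro continuous_intros) (auto simp: less_imp_neq[symmetric])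

lemma continuous_on_soft_grad: "continuous_on S soft_grad"
  unfolding soft_grad_def soft_weight_def using soft_sum_pos l
  by (intro continuous_intros) (auto simp: less_imp_neq[symmetric])

end

end

text \<open>About \<open>1 / \<epsilon>\<close> equally spaced points on each curve are centres of
  discs of radius \<open>(2 + A) * \<epsilon>\<close> that cover the strip, with total area of order
  \<open>\<epsilon>\<close>. The compact superset is measurable by construction.\<close>

lemma strip_cover:
  fixes \<gamma> :: "nat \<Rightarrow> real \<Rightarrow> real^2"
  assumes A: "A > 0" and lip: "\<And>i s t. i \<le> n \<Longrightarrow> s \<in> {0..1} \<Longrightarrow> t \<in> {0..1} \<Longrightarrow> norm (\<gamma> i s - \<gamma> i t) \<le> A * \<bar>s - t\<bar>"
  obtains C where "C > 0" "\<And>\<epsilon>. 0 < \<epsilon> \<Longrightarrow> \<epsilon> \<le> 1 \<Longrightarrow>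
     \<exists>T. compact T \<and> {x. \<exists>i\<le>n. \<exists>s\<in>{0..1}. norm (x - \<gamma> i s) \<le> 2 * \<epsilon>} \<subseteq> T \<and> measure lborel T \<le> C * \<epsilon>"
proof
  define V where "V = unit_ball_vol (real DIM(real^2))"
  have V: "V > 0" by (simp add: V_def)
  \<comment> \<open>There are \<open>n + 1\<close> curves, each with
    \<open>N + 1 \<le> 3 / \<epsilon>\<close> discs of area
    \<open>V * ((2 + A) * \<epsilon>)\<^sup>2\<close>.\<close>
  define C where "C = (n + 1) * 3 * V * (2 + A)\<^sup>2"
  show "C > 0" using A V by (simp add: C_def add_pos_pos)
  fix \<epsilon> :: real assume e: "0 < \<epsilon>" "\<epsilon> \<le> 1"
  define N where "N = nat \<lceil>1 / \<epsilon>\<rceil>"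
  have N: "real N \<ge> 1 / \<epsilon>" "real N \<le> 1 / \<epsilon> + 1" "N > 0"
    using e by (auto simp: N_def)
  define I where "I = {..n} \<times> {..N}"
  define T where "T = (\<Union>(i,j)\<in>I. cball (\<gamma> i (j / N)) ((2 + A) * \<epsilon>))"
  have "compact T" unfolding T_def I_def by (intro compact_UN) auto
  moreover have "{x. \<exists>i\<le>n. \<exists>s\<in>{0..1}. norm (x - \<gamma> i s) \<le> 2 * \<epsilon>} \<subseteq> T"
  proof safe
    fix x i and s :: real assume i: "i \<le> n" and s: "s \<in> {0..1}" and x: "norm (x - \<gamma> i s) \<le> 2 * \<epsilon>"
    define j where "j = nat \<lfloor>s * N\<rfloor>"
    have j: "real j \<le> s * N" "s * N < real j + 1" using s by (auto simp: j_def)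
    have "s * N \<le> N" using s by (auto intro: mult_left_le_one_le)
    then have jN: "j \<le> N" using j by linarith
    have "s - j / N = (s * N - j) / N" using N by (simp add: field_simps)
    then have "\<bar>s - j / N\<bar> \<le> 1 / N" using j N by (simp add: divide_right_mono)
    also have "\<dots> \<le> \<epsilon>" using N e by (simp add: field_simps)
    finally have sj: "\<bar>s - j / N\<bar> \<le> \<epsilon>" .
    have "norm (\<gamma> i s - \<gamma> i (j / N)) \<le> A * \<bar>s - j / N\<bar>"
      by (rule lip) (use i s jN N in auto)
    also have "\<dots> \<le> A * \<epsilon>" using sj A by simp
    finally have "norm (x - \<gamma> i (j / N)) \<le> 2 * \<epsilon> + A * \<epsilon>"
      using norm_triangle_ineq[of "x - \<gamma> i s" "\<gamma> i s - \<gamma> i (j / N)"] x by auto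
    then show "x \<in> T" unfolding T_def I_def
      using i jN by (auto simp: dist_norm norm_minus_commute algebra_simps intro!: bexI[of _ "(i, j)"])
  qed
  moreover have "measure lborel T \<le> C * \<epsilon>"
  proof -
    have "measure lborel T \<le> (\<Sum>k\<in>I. measure lborel (case k of (i,j) \<Rightarrow> cball (\<gamma> i (j / N)) ((2 + A) * \<epsilon>)))"
      unfolding T_def by (intro measure_UNION_le) (auto simp: I_def)
    also have "\<dots> = (\<Sum>k\<in>I. V * ((2 + A) * \<epsilon>)\<^sup>2)"
      using A e by (intro sum.cong refl) (auto simp: content_cball V_def split: prod.split)
    also have "\<dots> = (n + 1) * (real N + 1) * (V * ((2 + A) * \<epsilon>)\<^sup>2)"
      by (simp add: I_def card_cartesian_product algebra_simps)
    also have "\<dots> \<le> (n + 1) * (3 / \<epsilon>) * (V * ((2 + A) * \<epsilon>)\<^sup>2)"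
    proof (intro mult_right_mono mult_left_mono)
      have "1 \<le> 1 / \<epsilon>" using e by simp
      then show "real N + 1 \<le> 3 / \<epsilon>" using N by simp
    qed (use V in auto)
    also have "\<dots> = C * \<epsilon>" using e by (simp add: C_def field_simps power2_eq_square)
    finally show ?thesis .
  qed
  ultimately show "\<exists>T. compact T \<and> {x. \<exists>i\<le>n. \<exists>s\<in>{0..1}. norm (x - \<gamma> i s) \<le> 2 * \<epsilon>} \<subseteq> T \<and> measure lborel T \<le> C * \<epsilon>"
    by blast
qed

section \<open>A step function of class C^1\<close>

definition smoothstep :: "real \<Rightarrow> real" where
  "smoothstep s = (if s \<le> 0 then 0 else if s \<ge> 1 then 1 else s\<^sup>2 * (3 - 2 * s))"

definition smoothstep' :: "real \<Rightarrow> real" where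
  "smoothstep' s = (if s \<le> 0 then 0 else if s \<ge> 1 then 0 else 6 * s * (1 - s))"

lemma smoothstep_range: "0 \<le> smoothstep s" "smoothstep s \<le> 1"
proof -
  have "1 - s\<^sup>2 * (3 - 2 * s) = (1 - s)\<^sup>2 * (1 + 2 * s)" by algebra
  moreover have "(1 - s)\<^sup>2 * (1 + 2 * s) \<ge> 0" if "s > 0" using that by auto
  ultimately have "s\<^sup>2 * (3 - 2 * s) \<le> 1" if "s > 0" using that by (metis diff_ge_0_iff_ge)
  then show "0 \<le> smoothstep s" "smoothstep s \<le> 1" by (auto simp: smoothstep_def)
qed

lemma smoothstep'_bound: "\<bar>smoothstep' s\<bar> \<le> 3 / 2"
proof -
  have "3 / 2 - 6 * s * (1 - s) = 6 * (s - 1/2)\<^sup>2" by (simp add: power2_eq_square algebra_simps)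
  then have "6 * s * (1 - s) \<le> 3 / 2" by (metis diff_ge_0_iff_ge zero_le_numeral zero_le_power2 zero_le_mult_iff)
  then show ?thesis by (auto simp: smoothstep'_def)
qed

lemma continuous_smoothstep': "continuous_on UNIV smoothstep'"
proof -
  have "continuous_on UNIV (\<lambda>s::real. max 0 (6 * s * (1 - s)))" by (intro continuous_intros)
  then show ?thesis
    by (rule continuous_on_eq) (auto simp: smoothstep'_def max_def mult_le_0_iff zero_le_mult_iff)
qed

text \<open>The truncated square is C^1 across the origin; it handles the two joints of
  \<open>smoothstep\<close> and the edge of the mollifier kernel.\<close>

lemma has_real_derivative_max0_power:
  "((\<lambda>s::real. max 0 s ^ Suc (Suc n)) has_real_derivative real (n + 2) * max 0 s ^ Suc n) (at s)"
proof -
  consider "s > 0" | "s < 0" | "s = 0" by linarith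
  then show ?thesis
  proof cases
    case 1
    have "((\<lambda>s. s ^ Suc (Suc n)) has_real_derivative real (n + 2) * max 0 s ^ Suc n) (at s)"
      using 1 DERIV_pow[of "Suc (Suc n)" s] by (simp add: algebra_simps)
    then show ?thesis
      by (rule has_field_derivative_transform_within_open[where S="{0<..}"]) (use 1 in auto)
  next
    case 2
    have "((\<lambda>s. 0) has_real_derivative real (n + 2) * max 0 s ^ Suc n) (at s)"
      using 2 by auto
    then show ?thesis
      by (rule has_field_derivative_transform_within_open[where S="{..<0}"]) (use 2 in auto)
  next
    case 3
    have "((\<lambda>s::real. max 0 s ^ Suc n * (if s \<ge> 0 then 1 else 0)) \<longlongrightarrow> 0) (at 0)"
    proof (rule Lim_null_comparison)
      show "\<forall>\<^sub>F s in at 0. norm (max 0 s ^ Suc n * (if s \<ge> 0 then 1 else 0)) \<le> (max 0 s ^ Suc n :: real)"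
        by auto
      show "((\<lambda>s::real. max 0 s ^ Suc n) \<longlongrightarrow> 0) (at 0)"
        by (auto intro!: tendsto_eq_intros)
    qed
    moreover have "max 0 s ^ Suc n * (if s \<ge> 0 then 1 else 0) = (max 0 s ^ Suc (Suc n) - max 0 0 ^ Suc (Suc n)) / (s - 0)"
      if "s \<noteq> 0" for s :: real using that by (auto simp: max_def)
    ultimately have "((\<lambda>s::real. (max 0 s ^ Suc (Suc n) - max 0 0 ^ Suc (Suc n)) / (s - 0)) \<longlongrightarrow> 0) (at 0)"
      by (elim Lim_transform_within[OF _ zero_less_one]) auto
    then show ?thesis using 3 by (simp add: has_field_derivative_iff)
  qed
qed

text \<open>The open half lines \<open>s < 1\<close> and \<open>s > 0\<close> cover the line. On
  each, a single formula with one truncated square is valid across the joint it contains, 0 or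
  1.\<close>

lemma has_real_derivative_smoothstep: "(smoothstep has_real_derivative smoothstep' s) (at s)"
proof -
  consider "s < 1" | "s > 0" by linarith
  then show ?thesis
  proof cases
    case 1
    have 2: "((\<lambda>s::real. max 0 s ^ 2) has_real_derivative 2 * max 0 s) (at s)" for s
      using has_real_derivative_max0_power[of 0 s] by (simp add: numeral_2_eq_2)
    have "((\<lambda>s. max 0 s ^ 2 * (3 - 2 * s)) has_real_derivative (2 * max 0 s * (3 - 2 * s) + (0 - 2) * max 0 s ^ 2)) (at s)"
      by (rule DERIV_mult[OF 2]) (auto intro!: derivative_eq_intros)
    moreover have "2 * max 0 s * (3 - 2 * s) + (0 - 2) * max 0 s ^ 2 = smoothstep' s"
      using 1 by (auto simp: smoothstep'_def max_def power2_eq_square algebra_simps)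
    ultimately have "((\<lambda>s. max 0 s ^ 2 * (3 - 2 * s)) has_real_derivative smoothstep' s) (at s)" by simp
    then show ?thesis
      by (rule has_field_derivative_transform_within_open[where S="{..<1}"])
        (use 1 in \<open>auto simp: smoothstep_def max_def\<close>)
  next
    case 2
    have 3: "((\<lambda>s::real. max 0 s ^ 2) has_real_derivative 2 * max 0 s) (at s)" for s
      using has_real_derivative_max0_power[of 0 s] by (simp add: numeral_2_eq_2)
    have 4: "((\<lambda>s::real. max 0 (1 - s) ^ 2) has_real_derivative 2 * max 0 (1 - s) * (-1)) (at s)" for s
      by (rule DERIV_chain2[OF 3]) (auto intro!: derivative_eq_intros)
    have "((\<lambda>s. 1 - max 0 (1 - s) ^ 2 * (1 + 2 * s)) has_real_derivative (0 - (2 * max 0 (1 - s) * (-1) * (1 + 2 * s) + 2 * max 0 (1 - s) ^ 2))) (at s)"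
      by (intro DERIV_diff DERIV_mult[OF 4]) (auto intro!: derivative_eq_intros)
    moreover have "0 - (2 * max 0 (1 - s) * (-1) * (1 + 2 * s) + 2 * max 0 (1 - s) ^ 2) = smoothstep' s"
      using 2 by (auto simp: smoothstep'_def max_def power2_eq_square algebra_simps)
    ultimately have "((\<lambda>s. 1 - max 0 (1 - s) ^ 2 * (1 + 2 * s)) has_real_derivative smoothstep' s) (at s)" by simp
    then show ?thesis
      by (rule has_field_derivative_transform_within_open[where S="{0<..}"])
        (use 2 in \<open>auto simp: smoothstep_def max_def power2_eq_square algebra_simps\<close>)
  qed
qed

section \<open>Bounds and moduli of continuity on compact sets of times and points\<close>

lemma compact_UN_image_bound:
  fixes f :: "nat \<Rightarrow> real \<Rightarrow> 'b::real_normed_vector"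
  assumes "\<And>i. i \<le> n \<Longrightarrow> continuous_on K (f i)" "compact K"
  obtains B where "B > 0" "\<And>i s. i \<le> n \<Longrightarrow> s \<in> K \<Longrightarrow> norm (f i s) \<le> B"
proof -
  have "compact (\<Union>i\<le>n. f i ` K)"
    using assms by (intro compact_UN compact_continuous_image) auto
  then obtain B where "B > 0" "\<forall>x\<in>(\<Union>i\<le>n. f i ` K). norm x \<le> B"
    using compact_imp_bounded bounded_pos by metis
  then show ?thesis by (intro that[of B]) auto
qed

lemma continuous_on_time_section:
  assumes "continuous_on (J \<times> S) (\<lambda>(t, x). f t x)" "t \<in> J" "T \<subseteq> S"
  shows "continuous_on T (f t)"
proof -
  have "continuous_on T (\<lambda>x. (t, x))" by (intro continuous_intros)
  from continuous_on_compose2[OF assms(1) this] show ?thesis using assms by auto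
qed

lemma compact_time_space_bound:
  fixes f :: "real \<Rightarrow> 'a::metric_space \<Rightarrow> 'b::real_normed_vector"
  assumes "continuous_on (J \<times> S) (\<lambda>(t, x). f t x)" "compact J" "compact S"
  obtains M where "M \<ge> 0" "\<And>t x. t \<in> J \<Longrightarrow> x \<in> S \<Longrightarrow> norm (f t x) \<le> M"
proof -
  have "compact ((\<lambda>(t, x). f t x) ` (J \<times> S))"
    using assms by (intro compact_continuous_image compact_Times)
  then obtain M where "M > 0" "\<forall>z\<in>(\<lambda>(t, x). f t x) ` (J \<times> S). norm z \<le> M"
    using compact_imp_bounded bounded_pos by blast
  then show ?thesis by (intro that[of M]) auto
qed

lemma compact_time_space_modulus:
  fixes f :: "real \<Rightarrow> 'a::metric_space \<Rightarrow> 'b::real_normed_vector"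
  assumes "continuous_on (J \<times> S) (\<lambda>(t, x). f t x)" "compact J" "compact S" "m > 0"
  obtains \<delta> where "\<delta> > 0" "\<And>t x y. t \<in> J \<Longrightarrow> x \<in> S \<Longrightarrow> y \<in> S \<Longrightarrow> dist x y < \<delta> \<Longrightarrow> norm (f t x - f t y) \<le> m"
proof -
  have "uniformly_continuous_on (J \<times> S) (\<lambda>(t, x). f t x)"
    using assms by (intro compact_uniformly_continuous compact_Times)
  then obtain \<delta> where \<delta>: "\<delta> > 0" "\<forall>x\<in>J \<times> S. \<forall>x'\<in>J \<times> S. dist x' x < \<delta> \<longrightarrow> dist (case x' of (t, x) \<Rightarrow> f t x) (case x of (t, x) \<Rightarrow> f t x) < m"
    using \<open>m > 0\<close> unfolding uniformly_continuous_on_def by blast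
  show ?thesis
  proof (rule that[OF \<delta>(1)])
    fix t x y assume "t \<in> J" "x \<in> S" "y \<in> S" "dist x y < \<delta>"
    then show "norm (f t x - f t y) \<le> m"
      using \<delta>(2)[THEN bspec, of "(t, y)", THEN bspec, of "(t, x)"] by (auto simp: dist_Pair_Pair dist_norm)
  qed
qed

text \<open>With \<open>\<rho>\<close> the soft squared distance to a fine net on the boundary, the
  cutoff is a step in \<open>\<rho> / \<epsilon>\<^sup>2\<close>. Its gradient is of order
  \<open>1 / \<epsilon>\<^sup>2\<close> times that of \<open>\<rho>\<close>, on an area of order
  \<open>\<epsilon>\<close>. The gradient of \<open>\<rho>\<close> is almost normal and of order
  \<open>\<epsilon>\<close>, while \<open>X\<close> is within \<open>\<mu>\<close> of its tangential
  boundary values; so their product is of order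
  \<open>\<mu> * \<epsilon> + \<epsilon>\<^sup>2\<close> and the integral of order
  \<open>\<mu> + \<epsilon>\<close>. The modulus of continuity is uniform over \<open>J\<close>,
  hence one cutoff for all times.\<close>

lemma cutoff:
  fixes X :: "real \<Rightarrow> real^2 \<Rightarrow> real^2" and \<gamma> \<gamma>' \<gamma>'' :: "nat \<Rightarrow> real \<Rightarrow> real^2"
  assumes D: "open D" "bounded D"
    and fr: "frontier D = (\<Union>i\<le>n. \<gamma> i ` {0..1})"
    and per: "\<And>i s. i \<le> n \<Longrightarrow> \<gamma> i (s + 1) = \<gamma> i s"
    and d1: "\<And>i s. i \<le> n \<Longrightarrow> (\<gamma> i has_vector_derivative \<gamma>' i s) (at s)"
    and d2: "\<And>i s. i \<le> n \<Longrightarrow> (\<gamma>' i has_vector_derivative \<gamma>'' i s) (at s)"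
    and c2: "\<And>i. i \<le> n \<Longrightarrow> continuous_on UNIV (\<gamma>'' i)"
    and nz: "\<And>i s. i \<le> n \<Longrightarrow> \<gamma>' i s \<noteq> 0"
    and J: "compact J" and X: "continuous_on (J \<times> closure D) (\<lambda>(t, x). X t x)"
    and tan: "\<And>t i s. t \<in> J \<Longrightarrow> i \<le> n \<Longrightarrow> \<exists>c. X t (\<gamma> i s) = c *\<^sub>R \<gamma>' i s"
    and e: "e > 0"
  shows "\<exists>\<eta> g. test_fun D \<eta> g \<and> (\<forall>x. 0 \<le> \<eta> x \<and> \<eta> x \<le> 1) \<and> (LINT x:D|lborel. 1 - \<eta> x) \<le> e \<and>
    (\<forall>t\<in>J. (LINT x:D|lborel. \<bar>X t x \<bullet> g x\<bar>) \<le> e)"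
proof -
  define S where "S = closure D"
  define \<Gamma> where "\<Gamma> = frontier D"
  have S: "compact S" "D \<subseteq> S" using D by (auto simp: S_def closure_subset[THEN subsetD])
  have \<Gamma>: "compact \<Gamma>" "\<Gamma> \<subseteq> S" "\<Gamma> \<noteq> {}" "S = D \<union> \<Gamma>"
  proof -
    show "compact \<Gamma>" using D by (simp add: \<Gamma>_def compact_frontier_bounded)
    show "\<Gamma> \<subseteq> S" by (simp add: \<Gamma>_def S_def frontier_def)
    show "\<Gamma> \<noteq> {}" using fr by (auto simp: \<Gamma>_def)
    show "S = D \<union> \<Gamma>" using closure_Un_frontier[of D] by (simp add: S_def \<Gamma>_def)
  qed
  have g1c: "continuous_on T (\<gamma>' i)" and g0c: "continuous_on T (\<gamma> i)" if "i \<le> n" for i T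
    using d1[OF that] d2[OF that]
    by (auto intro!: continuous_at_imp_continuous_on has_vector_derivative_continuous)
  \<comment> \<open>Periodicity lets the parameter run over \<open>{-1..2}\<close>, the range in
    which \<open>near_foot_orthogonal\<close> compares distances.\<close>
  have in\<Gamma>: "\<gamma> i s \<in> \<Gamma>" if i: "i \<le> n" and s: "s \<in> {-1..2}" for i s
  proof -
    have "\<gamma> i (s - 1) = \<gamma> i s" "\<gamma> i (s + 1) = \<gamma> i s"
      using per[OF i, of "s - 1"] per[OF i, of s] by auto
    moreover have "s \<in> {0..1} \<or> s - 1 \<in> {0..1} \<or> s + 1 \<in> {0..1}" using s by auto
    ultimately have "\<gamma> i s \<in> \<gamma> i ` {0..1}" by (metis image_eqI)
    then show ?thesis using i fr unfolding \<Gamma>_def by auto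
  qed
  obtain A1 where A1: "A1 > 0" "\<And>i s. i \<le> n \<Longrightarrow> s \<in> {-1..2} \<Longrightarrow> norm (\<gamma>' i s) \<le> A1"
    using compact_UN_image_bound[of n "{-1..2}" \<gamma>'] g1c by auto
  obtain A2 where A2: "A2 > 0" "\<And>i s. i \<le> n \<Longrightarrow> s \<in> {-1..2} \<Longrightarrow> norm (\<gamma>'' i s) \<le> A2"
    using compact_UN_image_bound[of n "{-1..2}" \<gamma>''] c2 continuous_on_subset[OF c2 subset_UNIV] by auto
  define A where "A = max A1 A2"
  have A: "A > 0" "\<And>i s. i \<le> n \<Longrightarrow> s \<in> {-1..2} \<Longrightarrow> norm (\<gamma>' i s) \<le> A"
    "\<And>i s. i \<le> n \<Longrightarrow> s \<in> {-1..2} \<Longrightarrow> norm (\<gamma>'' i s) \<le> A"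
    using A1 A2 unfolding A_def by (auto simp: le_max_iff_disj)
  have "continuous_on {0..1} (\<lambda>s. 1 / norm (\<gamma>' i s))" if "i \<le> n" for i
    using g1c[OF that] nz[OF that] by (auto intro!: continuous_intros)
  then obtain a where a: "a > 0" "\<And>i s. i \<le> n \<Longrightarrow> s \<in> {0..1} \<Longrightarrow> norm (1 / norm (\<gamma>' i s)) \<le> a"
    using compact_UN_image_bound[of n "{0..1}" "\<lambda>i s. 1 / norm (\<gamma>' i s)"] by blast
  define R where "R = diameter S + 1"
  have R: "R > 0" "\<And>x y. x \<in> S \<Longrightarrow> y \<in> S \<Longrightarrow> norm (x - y) \<le> R"
    using diameter_bounded_bound[OF compact_imp_bounded[OF S(1)]] diameter_ge_0[OF compact_imp_bounded[OF S(1)]]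
    by (fastforce simp: R_def dist_norm)+
  obtain M0 where M0: "M0 \<ge> 0" "\<And>t x. t \<in> J \<Longrightarrow> x \<in> S \<Longrightarrow> norm (X t x) \<le> M0"
    using compact_time_space_bound[OF X[folded S_def] J S(1)] by blast
  define M where "M = M0 + 1"
  have M: "M > 0" "norm (X t x) \<le> M0 \<Longrightarrow> norm (X t x) \<le> M" for t x
    using M0(1) by (simp_all add: M_def)
  note M = M(1) M(2)[OF M0(2)]
  have lip: "norm (\<gamma> i s - \<gamma> i t) \<le> A * \<bar>s - t\<bar>" if "i \<le> n" "s \<in> {0..1}" "t \<in> {0..1}" for i s t
  proof -
    have "norm (\<gamma> i s - \<gamma> i t) \<le> A * norm (s - t)"
    proof (rule differentiable_bound[where f'="\<lambda>s h. h *\<^sub>R \<gamma>' i s" and S="{0..1}"])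
      show "(\<gamma> i has_derivative (\<lambda>h. h *\<^sub>R \<gamma>' i r)) (at r within {0..1})" for r
        using d1[OF that(1)] by (auto simp: has_vector_derivative_def intro: has_derivative_at_withinI)
      show "onorm (\<lambda>h. h *\<^sub>R \<gamma>' i r) \<le> A" if r: "r \<in> {0..1}" for r
      proof (rule onorm_le)
        have "norm (\<gamma>' i r) \<le> A" using A(2)[OF \<open>i \<le> n\<close>, of r] r by auto
        then show "norm (h *\<^sub>R \<gamma>' i r) \<le> A * norm h" for h by (simp add: mult.commute[of A] mult_left_mono)
      qed
    qed (use that in auto)
    then show ?thesis by simp
  qed
  obtain C1 where C1: "C1 > 0" "\<And>\<epsilon>. 0 < \<epsilon> \<Longrightarrow> \<epsilon> \<le> 1 \<Longrightarrow>
     \<exists>T. compact T \<and> {x. \<exists>i\<le>n. \<exists>s\<in>{0..1}. norm (x - \<gamma> i s) \<le> 2 * \<epsilon>} \<subseteq> T \<and> measure lborel T \<le> C1 * \<epsilon>"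
    by (rule strip_cover[of A n \<gamma>]) (use A lip in auto)
  define B where "B = 2 * A\<^sup>2 + 2 * R * A"
  have B: "B > 0" using A R by (simp add: B_def add_pos_pos)
  \<comment> \<open>Up to a factor 2, the coefficient of \<open>\<epsilon>\<^sup>2\<close> in the
    bound for \<open>X t x \<bullet> g\<rho> x\<close>. The almost nearest points contribute
    \<open>M * a * sqrt B\<close>, where \<open>M * a\<close> bounds the coefficient of
    \<open>X\<close> along the tangent; the far points contribute \<open>M * R\<close>.\<close>
  define C2 where "C2 = M * a * sqrt B + M * R"
  have C2: "C2 > 0" using M a B R by (simp add: C2_def add_pos_pos)
  \<comment> \<open>Makes \<open>12 * \<mu> * C1\<close>, the part of the final bound that does not
    shrink with \<open>\<epsilon>\<close>, equal to \<open>e / 2\<close>.\<close>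
  define \<mu> where "\<mu> = e / (24 * C1)"
  have \<mu>: "\<mu> > 0" using e C1 by (simp add: \<mu>_def)
  obtain \<delta> where \<delta>p: "\<delta> > 0" and \<delta>: "\<And>t x y. t \<in> J \<Longrightarrow> x \<in> S \<Longrightarrow> y \<in> S \<Longrightarrow> dist x y < \<delta> \<Longrightarrow> norm (X t x - X t y) \<le> \<mu>"
    using compact_time_space_modulus[OF X[folded S_def] J S(1) \<mu>] by blast
  define \<epsilon> where "\<epsilon> = min (min 1 (\<delta> / 3)) (min (e / C1) (e / (12 * C1 * C2)))"
  have \<epsilon>: "\<epsilon> > 0" "\<epsilon> \<le> 1" "2 * \<epsilon> < \<delta>" "C1 * \<epsilon> \<le> e" "6 * C1 * C2 * \<epsilon> \<le> e / 2"
  proof -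
    have "\<epsilon> \<le> min 1 (\<delta> / 3)" "\<epsilon> \<le> min (e / C1) (e / (12 * C1 * C2))"
      unfolding \<epsilon>_def by (rule min.cobounded1, rule min.cobounded2)
    then have "\<epsilon> \<le> \<delta> / 3" "\<epsilon> \<le> e / C1" "\<epsilon> \<le> e / (12 * C1 * C2)" by auto
    then show "2 * \<epsilon> < \<delta>" "C1 * \<epsilon> \<le> e" "6 * C1 * C2 * \<epsilon> \<le> e / 2" using C1 C2 \<delta>p by (auto simp: field_simps)
    show "\<epsilon> > 0" "\<epsilon> \<le> 1" unfolding \<epsilon>_def using C1 C2 e \<delta>p by auto
  qed
  \<comment> \<open>Then \<open>B * (2 * \<kappa>)\<close> is the square of
    \<open>sqrt B * \<epsilon>\<^sup>2 / 2\<close>: orthogonality at almost nearest points fails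
    only by order \<open>\<epsilon>\<^sup>2\<close>.\<close>
  define \<kappa> where "\<kappa> = \<epsilon>^4 / 8"
  have \<kappa>: "\<kappa> > 0" "\<kappa> \<le> \<epsilon>\<^sup>2 / 8"
  proof -
    have "\<epsilon>^4 \<le> \<epsilon>^2" using \<epsilon> by (intro power_decreasing) auto
    then show "\<kappa> \<le> \<epsilon>\<^sup>2 / 8" "\<kappa> > 0" using \<epsilon> by (auto simp: \<kappa>_def)
  qed
  \<comment> \<open>Choice of the mesh: exchanging a nearest boundary point for a neighbouring net
    point raises the squared distance by at most this quantity.\<close>
  have "((\<lambda>N. 2 * R * (A / real N) + (A / real N)\<^sup>2) \<longlongrightarrow> 2 * R * 0 + 0\<^sup>2) sequentially"
    by (intro tendsto_intros lim_const_over_n)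
  then have "\<forall>\<^sub>F N in sequentially. 2 * R * (A / real N) + (A / real N)\<^sup>2 < \<kappa>"
    using \<kappa> by (intro order_tendstoD) auto
  then have "\<forall>\<^sub>F N in sequentially. 2 * R * (A / real N) + (A / real N)\<^sup>2 < \<kappa> \<and> N > 0"
    by (rule eventually_conj) (rule eventually_gt_at_top)
  then obtain N where N: "2 * R * (A / real N) + (A / real N)\<^sup>2 < \<kappa>" "N > 0"
    using eventually_happens trivial_limit_sequentially by blast
  define P where "P = {..n} \<times> {..N}"
  define p where "p k = \<gamma> (fst k) (real (snd k) / real N)" for k :: "nat \<times> nat"
  have P: "finite P" "P \<noteq> {}" by (auto simp: P_def)
  have cP: "card P > 0" using P by (simp add: card_gt_0_iff)
  have par: "real (snd k) / real N \<in> {0..1}" "fst k \<le> n" if "k \<in> P" for k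
    using that N by (auto simp: P_def)
  have pS: "p k \<in> \<Gamma>" if "k \<in> P" for k
  proof -
    have "real (snd k) / real N \<in> {-1..2}" using par(1)[OF that] unfolding atLeastAtMost_iff by linarith
    then show ?thesis unfolding p_def by (intro in\<Gamma> par that)
  qed
  have pkS: "p k \<in> S" if "k \<in> P" for k using pS[OF that] \<Gamma>(2) by blast
  \<comment> \<open>Choice of the sharpness \<open>b\<close>: all far points together get weight
    below \<open>\<epsilon>\<^sup>2\<close>, and the soft minimum lies less than
    \<open>\<epsilon>\<^sup>2 / 4\<close> below the true one.\<close>
  have "((\<lambda>b. real (card P) * exp (- b * \<kappa>)) \<longlongrightarrow> 0) at_top"
  proof -
    have "filterlim (\<lambda>b. - b * \<kappa>) at_bot at_top"
      using \<kappa> filterlim_tendsto_pos_mult_at_top[OF tendsto_const _ filterlim_ident, of \<kappa>]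
      by (simp add: filterlim_uminus_at_bot mult.commute)
    from filterlim_compose[OF exp_at_bot this] show ?thesis
      by (rule tendsto_mult_right_zero)
  qed
  then have "\<forall>\<^sub>F b in at_top. real (card P) * exp (- b * \<kappa>) < \<epsilon>\<^sup>2"
    using \<epsilon> by (intro order_tendstoD) auto
  moreover have "((\<lambda>b. ln (card P) / b) \<longlongrightarrow> 0) at_top"
    by (intro tendsto_divide_0[OF tendsto_const] filterlim_at_top_imp_at_infinity filterlim_ident)
  then have "\<forall>\<^sub>F b in at_top. ln (card P) / b < \<epsilon>\<^sup>2 / 4"
    using \<epsilon> by (intro order_tendstoD) auto
  ultimately have "\<forall>\<^sub>F b in at_top. real (card P) * exp (- b * \<kappa>) < \<epsilon>\<^sup>2 \<and> ln (card P) / b < \<epsilon>\<^sup>2 / 4 \<and> b > 0"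
    by (intro eventually_conj eventually_gt_at_top)
  then obtain b where b: "real (card P) * exp (- b * \<kappa>) < \<epsilon>\<^sup>2" "ln (card P) / b < \<epsilon>\<^sup>2 / 4" "b > 0"
    using eventually_happens trivial_limit_at_top_linorder by blast
  define \<rho> where "\<rho> = soft_min P p b"
  define g\<rho> where "g\<rho> = soft_grad P p b"
  define w where "w = soft_weight P p b"
  note soft = soft_min_le[OF P b(3), where p=p, folded \<rho>_def] soft_min_ge[OF P b(3), where p=p, folded \<rho>_def]
    soft_min_has_pderiv[OF P b(3), where p=p, folded \<rho>_def g\<rho>_def]
    continuous_on_soft_min[OF P b(3), where p=p, folded \<rho>_def] continuous_on_soft_grad[OF P b(3), where p=p, folded g\<rho>_def]
  note wt = soft_weight_nonneg[OF P b(3), where p=p, folded w_def] soft_weight_sum[OF P b(3), where p=p, folded w_def]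
    soft_weight_far[OF P b(3), where p=p, folded w_def]
  define d where "d x = infdist x \<Gamma>" for x
  have d: "d x \<ge> 0" "\<And>y. y \<in> \<Gamma> \<Longrightarrow> d x \<le> norm (x - y)" for x
    by (auto simp: d_def infdist_nonneg dist_norm[symmetric] intro: infdist_le)
  have foot: "\<exists>i\<le>n. \<exists>s\<in>{0..1}. norm (x - \<gamma> i s) = d x" for x
  proof -
    obtain y where "y \<in> \<Gamma>" "infdist x \<Gamma> = dist x y"
      using infdist_attains_inf[OF compact_imp_closed[OF \<Gamma>(1)] \<Gamma>(3)] by blast
    then show ?thesis unfolding \<Gamma>_def fr d_def by (auto simp: dist_norm)
  qed
  have net: "\<exists>k\<in>P. (norm (x - p k))\<^sup>2 \<le> (d x)\<^sup>2 + \<kappa>" if x: "x \<in> S" for x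
  proof -
    obtain i s where i: "i \<le> n" and s: "s \<in> {0..1}" and xs: "norm (x - \<gamma> i s) = d x" using foot by blast
    define j where "j = nat \<lfloor>s * N\<rfloor>"
    have j: "real j \<le> s * N" "s * N < real j + 1" using s by (auto simp: j_def)
    have "s * N \<le> N" using s by (auto intro: mult_left_le_one_le)
    then have jN: "j \<le> N" using j by linarith
    have "s - j / N = (s * N - j) / N" using N by (simp add: field_simps)
    then have sj: "\<bar>s - j / N\<bar> \<le> 1 / N" using j N by (simp add: divide_right_mono)
    have "norm (\<gamma> i s - \<gamma> i (j / N)) \<le> A * \<bar>s - j / N\<bar>"
      by (rule lip) (use i s jN N in auto)
    also have "\<dots> \<le> A * (1 / N)" using sj A by (intro mult_left_mono) auto
    finally have 1: "norm (x - \<gamma> i (j / N)) \<le> d x + A / N"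
      using norm_triangle_ineq[of "x - \<gamma> i s" "\<gamma> i s - \<gamma> i (j / N)"] xs by auto
    have dR: "d x \<le> R" unfolding xs[symmetric] by (rule R(2)) (use x i s in\<Gamma> \<Gamma> in auto)
    have "(norm (x - \<gamma> i (j / N)))\<^sup>2 \<le> (d x + A / N)\<^sup>2" by (rule power_mono[OF 1]) auto
    also have "\<dots> = (d x)\<^sup>2 + (2 * d x * (A / N) + (A / N)\<^sup>2)" by (simp add: power2_sum)
    also have "\<dots> \<le> (d x)\<^sup>2 + (2 * R * (A / N) + (A / N)\<^sup>2)"
      using dR A by (intro add_left_mono add_right_mono mult_right_mono) auto
    also have "\<dots> \<le> (d x)\<^sup>2 + \<kappa>" using N by simp
    finally show ?thesis using i jN by (intro bexI[of _ "(i, j)"]) (auto simp: p_def P_def)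
  qed
  have \<rho>: "\<rho> x \<le> (d x)\<^sup>2 + \<kappa>" "\<rho> x \<ge> (d x)\<^sup>2 - \<epsilon>\<^sup>2 / 4" if "x \<in> S" for x
  proof -
    show "\<rho> x \<le> (d x)\<^sup>2 + \<kappa>" using net[OF that] soft(1) by (meson order_trans)
    have "(d x)\<^sup>2 - ln (card P) / b \<le> \<rho> x"
      by (rule soft(2)) (use d pS in \<open>auto intro!: power_mono\<close>)
    then show "\<rho> x \<ge> (d x)\<^sup>2 - \<epsilon>\<^sup>2 / 4" using b by linarith
  qed
  have grad: "\<bar>X t x \<bullet> g\<rho> x\<bar> \<le> 4 * \<mu> * \<epsilon> + 2 * C2 * \<epsilon>\<^sup>2" if t: "t \<in> J" and x: "x \<in> S" and dx: "(d x)\<^sup>2 \<le> 9 / 4 * \<epsilon>\<^sup>2" for t x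
  proof -
    have each: "\<bar>w x k * (X t x \<bullet> (x - p k))\<bar> \<le> w x k * (2 * \<mu> * \<epsilon> + M * a * sqrt B * \<epsilon>\<^sup>2) + exp (- b * \<kappa>) * (M * R)"
      if k: "k \<in> P" for k
    \<comment> \<open>Some net point is within \<open>\<kappa>\<close> of the minimum, so a point
      beyond \<open>2 * \<kappa>\<close> is worse than it by at least \<open>\<kappa>\<close> and
      has weight at most \<open>exp (- b * \<kappa>)\<close>.\<close>
    proof (cases "(norm (x - p k))\<^sup>2 \<le> (d x)\<^sup>2 + 2 * \<kappa>")
      case True
      have "(norm (x - p k))\<^sup>2 \<le> (d x)\<^sup>2 + 2 * \<kappa>" by (rule True)
      also have "\<dots> \<le> 4 * \<epsilon>\<^sup>2" using dx \<kappa> by linarith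
      also have "\<dots> = (2 * \<epsilon>)\<^sup>2" by (simp add: power_mult_distrib)
      finally have near: "norm (x - p k) \<le> 2 * \<epsilon>"
        by (rule power2_le_imp_le) (use \<epsilon> in simp)
      have "dist x (p k) < \<delta>" using near \<epsilon>(3) by (simp add: dist_norm)
      from \<delta>[OF t x pkS[OF k] this] have "norm (X t x - X t (p k)) \<le> \<mu>" .
      \<comment> \<open>\<open>X t x\<close> is split as its difference to \<open>X t (p k)\<close>,
        small by uniform continuity, plus \<open>X t (p k)\<close>, which is tangential and hence
        almost orthogonal to \<open>x - p k\<close>.\<close>
      then have 1: "\<bar>(X t x - X t (p k)) \<bullet> (x - p k)\<bar> \<le> \<mu> * (2 * \<epsilon>)"
        using near \<mu> by (intro order_trans[OF Cauchy_Schwarz_ineq2] mult_mono) auto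
      obtain i s where pk: "i \<le> n" "s \<in> {0..1}" "p k = \<gamma> i s" by (rule that[OF par(2)[OF k] par(1)[OF k]]) (simp add: p_def)
      obtain c where c: "X t (p k) = c *\<^sub>R \<gamma>' i s" using tan[OF t pk(1), of s] pk by auto
      have "\<bar>c\<bar> = norm (X t (p k)) * (1 / norm (\<gamma>' i s))" using c nz[OF pk(1)] by auto
      also have "\<dots> \<le> M * a"
        using M(2)[OF t pkS[OF k]] a(2)[OF pk(1,2)] M(1) a(1) by (intro mult_mono) auto
      finally have cb: "\<bar>c\<bar> \<le> M * a" .
      have "((x - \<gamma> i s) \<bullet> \<gamma>' i s)\<^sup>2 \<le> B * (2 * \<kappa>)"
        unfolding B_def
      proof (rule near_foot_orthogonal[where d="d x" and \<gamma>="\<gamma> i" and \<gamma>'="\<gamma>' i" and \<gamma>''="\<gamma>'' i"])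
        show "norm (x - \<gamma> i s) \<le> R" if "s \<in> {-1..2}" for s
          by (rule R(2)[OF x]) (use in\<Gamma>[OF pk(1) that] \<Gamma>(2) in blast)
        show "d x \<le> norm (x - \<gamma> i s)" if "s \<in> {-1..2}" for s
          by (rule d(2)[OF in\<Gamma>[OF pk(1) that]])
      qed (use A R d1 d2 pk True d in auto)
      also have "\<dots> = (sqrt B * \<epsilon>\<^sup>2 / 2)\<^sup>2" using B by (simp add: \<kappa>_def power_mult_distrib power_divide)
      finally have "\<bar>(x - \<gamma> i s) \<bullet> \<gamma>' i s\<bar> \<le> \<bar>sqrt B * \<epsilon>\<^sup>2 / 2\<bar>" by (rule abs_le_square_iff[THEN iffD2])
      also have "\<dots> \<le> sqrt B * \<epsilon>\<^sup>2" using B by simp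
      finally have "\<bar>c * ((x - \<gamma> i s) \<bullet> \<gamma>' i s)\<bar> \<le> (M * a) * (sqrt B * \<epsilon>\<^sup>2)"
        unfolding abs_mult using cb by (intro mult_mono) auto
      then have 2: "\<bar>X t (p k) \<bullet> (x - p k)\<bar> \<le> M * a * sqrt B * \<epsilon>\<^sup>2"
        unfolding c unfolding pk(3) by (simp add: inner_commute mult.assoc)
      have "\<bar>X t x \<bullet> (x - p k)\<bar> \<le> 2 * \<mu> * \<epsilon> + M * a * sqrt B * \<epsilon>\<^sup>2"
        using 1 2 by (simp add: inner_diff_left)
      then have "\<bar>w x k * (X t x \<bullet> (x - p k))\<bar> \<le> w x k * (2 * \<mu> * \<epsilon> + M * a * sqrt B * \<epsilon>\<^sup>2)"
        unfolding abs_mult using wt(1)[of x k] by (simp add: mult_left_mono)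
      moreover have "exp (- b * \<kappa>) * (M * R) \<ge> 0" using M R by simp
      ultimately show ?thesis by linarith
    next
      case False
      obtain j where j: "j \<in> P" "(norm (x - p j))\<^sup>2 \<le> (d x)\<^sup>2 + \<kappa>" using net[OF x] by blast
      have "w x k \<le> exp (- b * \<kappa>)" by (rule wt(3)[OF j(1)]) (use False j in linarith)
      moreover have "\<bar>X t x \<bullet> (x - p k)\<bar> \<le> M * R"
        using M(2)[OF t x] R(2)[OF x pkS[OF k]] M(1)
        by (intro order_trans[OF Cauchy_Schwarz_ineq2] mult_mono) auto
      ultimately have "\<bar>w x k * (X t x \<bullet> (x - p k))\<bar> \<le> exp (- b * \<kappa>) * (M * R)"
        unfolding abs_mult using wt(1)[of x k] by (intro mult_mono) auto
      moreover have "w x k * (2 * \<mu> * \<epsilon> + M * a * sqrt B * \<epsilon>\<^sup>2) \<ge> 0"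
        using wt(1)[of x k] M a B \<mu> \<epsilon> by simp
      ultimately show ?thesis by linarith
    qed
    have "X t x \<bullet> g\<rho> x = 2 * (\<Sum>k\<in>P. w x k * (X t x \<bullet> (x - p k)))"
      unfolding g\<rho>_def soft_grad_def w_def by (simp add: inner_sum_right sum_distrib_left mult.assoc)
    then have "\<bar>X t x \<bullet> g\<rho> x\<bar> \<le> 2 * (\<Sum>k\<in>P. \<bar>w x k * (X t x \<bullet> (x - p k))\<bar>)"
      using sum_abs[of "\<lambda>k. w x k * (X t x \<bullet> (x - p k))" P] by (simp add: abs_mult)
    also have "\<dots> \<le> 2 * (\<Sum>k\<in>P. w x k * (2 * \<mu> * \<epsilon> + M * a * sqrt B * \<epsilon>\<^sup>2) + exp (- b * \<kappa>) * (M * R))"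
      using each by (intro mult_left_mono sum_mono) auto
    also have "\<dots> = 2 * ((2 * \<mu> * \<epsilon> + M * a * sqrt B * \<epsilon>\<^sup>2) + (real (card P) * exp (- b * \<kappa>)) * (M * R))"
      by (simp add: sum.distrib sum_distrib_right[symmetric] wt(2))
    also have "\<dots> \<le> 2 * ((2 * \<mu> * \<epsilon> + M * a * sqrt B * \<epsilon>\<^sup>2) + \<epsilon>\<^sup>2 * (M * R))"
      using b M R by (intro mult_left_mono add_left_mono mult_right_mono) auto
    also have "\<dots> = 4 * \<mu> * \<epsilon> + 2 * C2 * \<epsilon>\<^sup>2" by (simp add: C2_def algebra_simps)
    finally show ?thesis .
  qed
  \<comment> \<open>The step takes place while \<open>\<rho>\<close> runs from
    \<open>\<epsilon>\<^sup>2\<close> to \<open>2 * \<epsilon>\<^sup>2\<close>, which forces the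
    distance to the boundary to lie between \<open>\<epsilon> / 2\<close> and
    \<open>3 / 2 * \<epsilon>\<close>.\<close>
  define h where "h x = smoothstep (\<rho> x / \<epsilon>\<^sup>2 - 1)" for x
  define gh where "gh x = (smoothstep' (\<rho> x / \<epsilon>\<^sup>2 - 1) / \<epsilon>\<^sup>2) *\<^sub>R g\<rho> x" for x
  define \<eta> where "\<eta> x = (if x \<in> D then h x else 0)" for x
  define g where "g x = (if x \<in> D then gh x else 0)" for x
  define K where "K = S \<inter> {x. \<epsilon> / 2 \<le> d x}"
  have "closed {x. \<epsilon> / 2 \<le> d x}"
    unfolding d_def by (intro closed_Collect_le continuous_intros)
  then have K: "compact K" unfolding K_def using S by (intro compact_Int_closed)
  have KD: "K \<subseteq> D"
  proof
    fix x assume "x \<in> K"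
    moreover have "d x = 0" if "x \<in> \<Gamma>" using that by (simp add: d_def)
    ultimately show "x \<in> D" using \<Gamma> \<epsilon> by (force simp: K_def)
  qed
  have "test_fun D \<eta> g"
    unfolding \<eta>_def[abs_def] g_def[abs_def]
  proof (rule test_fun_extend[OF D(1) _ _ _ K KD])
    have "continuous_on UNIV smoothstep"
      using has_real_derivative_smoothstep by (meson DERIV_continuous_on has_field_derivative_at_within)
    then show "continuous_on D h" unfolding h_def
      by (rule continuous_on_compose2) (auto intro!: continuous_intros soft simp: \<epsilon>(1)[THEN less_imp_neq, symmetric])
    have "continuous_on D (\<lambda>x. smoothstep' (\<rho> x / \<epsilon>\<^sup>2 - 1))"
      by (rule continuous_on_compose2[OF continuous_smoothstep']) (use \<epsilon> in \<open>auto intro!: continuous_intros soft\<close>)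
    then show "continuous_on D gh" unfolding gh_def
      using \<epsilon> by (intro continuous_intros soft) auto
    show "has_pderiv h i (gh x $ i) x" for x i
    proof -
      have "has_pderiv (\<lambda>x. (1 / \<epsilon>\<^sup>2) * \<rho> x - 1) i ((1 / \<epsilon>\<^sup>2) * g\<rho> x $ i - 0) x"
        by (intro has_pderiv_diff has_pderiv_cmult has_pderiv_const soft)
      from has_pderiv_chain[OF has_real_derivative_smoothstep this]
      show ?thesis unfolding h_def[abs_def] gh_def by (simp add: divide_inverse mult_ac)
    qed
    show "h x = 0" if "x \<in> D" "x \<notin> K" for x
    proof -
      have x: "x \<in> S" using that S by auto
      then have "d x < \<epsilon> / 2" using that by (auto simp: K_def)
      then have "(d x)\<^sup>2 \<le> (\<epsilon> / 2)\<^sup>2" using d by (intro power_mono) auto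
      then have "\<rho> x \<le> \<epsilon>\<^sup>2" using \<rho>(1)[OF x] \<kappa> by (simp add: power_divide)
      then show ?thesis using \<epsilon> by (simp add: h_def smoothstep_def)
    qed
  qed
  moreover have "\<forall>x. 0 \<le> \<eta> x \<and> \<eta> x \<le> 1" by (simp add: \<eta>_def h_def smoothstep_range)
  moreover
  obtain T where T: "compact T" "{x. \<exists>i\<le>n. \<exists>s\<in>{0..1}. norm (x - \<gamma> i s) \<le> 2 * \<epsilon>} \<subseteq> T" "measure lborel T \<le> C1 * \<epsilon>"
    using C1(2)[OF \<epsilon>(1,2)] by blast
  have big: "\<rho> x / \<epsilon>\<^sup>2 - 1 > 1" if "\<rho> x > 2 * \<epsilon>\<^sup>2" for x
    using that \<epsilon>(1) by (simp add: field_simps)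
  have inT: "x \<in> T \<and> (d x)\<^sup>2 \<le> 9 / 4 * \<epsilon>\<^sup>2" if "x \<in> D" "\<rho> x \<le> 2 * \<epsilon>\<^sup>2" for x
  proof
    have "x \<in> S" using that S by blast
    from \<rho>(2)[OF this] that(2) show dx: "(d x)\<^sup>2 \<le> 9 / 4 * \<epsilon>\<^sup>2" by linarith
    have "(d x)\<^sup>2 \<le> 4 * \<epsilon>\<^sup>2" using dx zero_le_power2[of \<epsilon>] by linarith
    also have "\<dots> = (2 * \<epsilon>)\<^sup>2" by (simp add: power_mult_distrib)
    finally have "d x \<le> 2 * \<epsilon>" by (rule power2_le_imp_le) (use \<epsilon> in simp)
    moreover obtain i s where "i \<le> n" "s \<in> {0..1}" "norm (x - \<gamma> i s) = d x" using foot by blast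
    ultimately have "x \<in> {x. \<exists>i\<le>n. \<exists>s\<in>{0..1}. norm (x - \<gamma> i s) \<le> 2 * \<epsilon>}"
      unfolding mem_Collect_eq by (intro exI[of _ i] conjI bexI[of _ s]) simp_all
    then show "x \<in> T" using T(2) by blast
  qed
  have small: "(LINT x:D|lborel. f x) \<le> b * (C1 * \<epsilon>)"
    if f: "continuous_on D f" "\<And>x. x \<in> D \<Longrightarrow> 0 \<le> f x" "\<And>x. x \<in> D \<Longrightarrow> f x \<le> b"
      "\<And>x. x \<in> D \<Longrightarrow> x \<notin> T \<Longrightarrow> f x = 0" and b: "b \<ge> 0" for f b
  proof -
    have Tf: "emeasure lborel T < \<infinity>" using T compact_imp_bounded emeasure_bounded_lborel by blast
    have "(LINT x:D|lborel. f x) \<le> (LINT x|lborel. indicator T x * b)"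
      unfolding set_lebesgue_integral_def
    proof (rule integral_mono)
      show "integrable lborel (\<lambda>x. indicator D x *\<^sub>R f x)"
        using set_integrable_bounded_continuous[OF D f(1), of b] f by (auto simp: set_integrable_def)
      show "integrable lborel (\<lambda>x. indicator T x * b)"
        using T Tf by (auto simp: integrable_mult_left integrable_indicator_iff compact_imp_closed less_top[symmetric])
      show "indicator D x *\<^sub>R f x \<le> indicator T x * b" for x
        using f(3,4)[of x] b by (auto simp: indicator_def)
    qed
    also have "\<dots> = measure lborel T * b" by simp
    also have "\<dots> \<le> (C1 * \<epsilon>) * b" using T b by (intro mult_right_mono) auto
    finally show ?thesis by (simp add: mult.commute)
  qed
  have cont\<eta>: "continuous_on D \<eta>" "continuous_on D g"
    by (rule test_fun_continuous[OF \<open>test_fun D \<eta> g\<close>])+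
  have "(LINT x:D|lborel. 1 - \<eta> x) \<le> 1 * (C1 * \<epsilon>)"
  proof (rule small)
    show "1 - \<eta> x = 0" if "x \<in> D" "x \<notin> T" for x
    proof -
      have "\<rho> x > 2 * \<epsilon>\<^sup>2" using inT[of x] that by linarith
      from big[OF this] show ?thesis using that by (simp add: \<eta>_def h_def smoothstep_def)
    qed
  qed (use cont\<eta> \<open>\<forall>x. 0 \<le> \<eta> x \<and> \<eta> x \<le> 1\<close> in \<open>auto intro!: continuous_intros\<close>)
  then have "(LINT x:D|lborel. 1 - \<eta> x) \<le> e" using \<epsilon> by simp
  moreover have "(LINT x:D|lborel. \<bar>X t x \<bullet> g x\<bar>) \<le> e" if t: "t \<in> J" for t
  proof -
    \<comment> \<open>The bound \<open>3 / \<epsilon>\<^sup>2\<close> for the slope factor times the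
      bound \<open>4 * \<mu> * \<epsilon> + 2 * C2 * \<epsilon>\<^sup>2\<close> for the product with
      \<open>g\<rho>\<close>.\<close>
    define b where "b = 12 * \<mu> / \<epsilon> + 6 * C2"
    have "(LINT x:D|lborel. \<bar>X t x \<bullet> g x\<bar>) \<le> b * (C1 * \<epsilon>)"
    proof (rule small)
      have "continuous_on D (\<lambda>x. X t x)"
      proof -
        have "continuous_on D (\<lambda>x. (t, x))" by (intro continuous_intros)
        from continuous_on_compose2[OF X this] show ?thesis using t S by (auto simp: S_def)
      qed
      then show "continuous_on D (\<lambda>x. \<bar>X t x \<bullet> g x\<bar>)" using cont\<eta> by (intro continuous_intros)
      show "b \<ge> 0" using \<mu> \<epsilon> C2 by (simp add: b_def)
      show "\<bar>X t x \<bullet> g x\<bar> = 0" if "x \<in> D" "x \<notin> T" for x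
      proof -
        have "\<rho> x > 2 * \<epsilon>\<^sup>2" using inT[of x] that by linarith
        from big[OF this] show ?thesis using that by (simp add: g_def gh_def smoothstep'_def)
      qed
      show "\<bar>X t x \<bullet> g x\<bar> \<le> b" if x: "x \<in> D" for x
      proof (cases "\<rho> x \<le> 2 * \<epsilon>\<^sup>2")
        case True
        have "\<bar>X t x \<bullet> g\<rho> x\<bar> \<le> 4 * \<mu> * \<epsilon> + 2 * C2 * \<epsilon>\<^sup>2"
          using grad[OF t, of x] inT[OF x True] x S by auto
        moreover have "\<bar>smoothstep' (\<rho> x / \<epsilon>\<^sup>2 - 1) / \<epsilon>\<^sup>2\<bar> \<le> 3 / \<epsilon>\<^sup>2"
          using smoothstep'_bound[of "\<rho> x / \<epsilon>\<^sup>2 - 1"] by (simp add: divide_right_mono)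
        ultimately have "\<bar>smoothstep' (\<rho> x / \<epsilon>\<^sup>2 - 1) / \<epsilon>\<^sup>2\<bar> * \<bar>X t x \<bullet> g\<rho> x\<bar> \<le> 3 / \<epsilon>\<^sup>2 * (4 * \<mu> * \<epsilon> + 2 * C2 * \<epsilon>\<^sup>2)"
          by (intro mult_mono) auto
        also have "\<dots> = b" using \<epsilon> by (simp add: b_def field_simps power2_eq_square)
        finally show ?thesis using x by (simp add: g_def gh_def abs_mult[symmetric])
      next
        case False
        then have "g x = 0" using x big[of x] by (simp add: g_def gh_def smoothstep'_def)
        then show ?thesis using \<open>b \<ge> 0\<close> by simp
      qed
    qed auto
    also have "\<dots> = 12 * \<mu> * C1 + 6 * C1 * C2 * \<epsilon>" using \<epsilon> by (simp add: b_def field_simps)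
    also have "12 * \<mu> * C1 = e / 2" using C1 by (simp add: \<mu>_def)
    finally show ?thesis using \<epsilon> by linarith
  qed
  ultimately show ?thesis by blast
qed


section \<open>Mollification\<close>

text \<open>The mass of the kernel gradient is recorded because the commutator estimate pairs it
  with velocity increments of size \<open>L * \<delta>\<close>. The number 29 is 256/9 rounded up,
  the value for the kernel built in \<open>mollifier_exists\<close>.\<close>

locale mollifier =
  fixes \<delta> :: real and k :: "real^2 \<Rightarrow> real" and gk :: "real^2 \<Rightarrow> real^2"
  assumes delta_pos: "\<delta> > 0"
    and k_nonneg: "k z \<ge> 0" and k_sym: "k (- z) = k z" and gk_sym: "norm (gk (- z)) = norm (gk z)"
    and k_support: "norm z \<ge> \<delta> \<Longrightarrow> k z = 0" "norm z \<ge> \<delta> \<Longrightarrow> gk z = 0"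
    and k_cont: "continuous_on UNIV k" "continuous_on UNIV gk"
    and k_pderiv: "has_pderiv k i (gk z $ i) z"
    and k_int: "integrable lborel k" "(LINT z|lborel. k z) = 1"
    and gk_int: "integrable lborel (\<lambda>z. norm (gk z))" "(LINT z|lborel. norm (gk z)) \<le> 29 / \<delta>"

lemma integrable_compact_support:
  fixes f :: "real^2 \<Rightarrow> real"
  assumes "continuous_on UNIV f" "\<And>z. norm z \<ge> \<delta> \<Longrightarrow> f z = 0"
  shows "integrable lborel f"
proof -
  have "integrable lborel (\<lambda>x. indicator (cball 0 \<delta>) x *\<^sub>R f x)"
    by (rule borel_integrable_compact) (use assms in \<open>auto intro: continuous_on_subset\<close>)
  also have "(\<lambda>x. indicator (cball 0 \<delta>) x *\<^sub>R f x) = f"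
    using assms by (auto simp: fun_eq_iff indicator_def)
  finally show ?thesis .
qed

text \<open>The kernel is the truncated square of \<open>\<delta>\<^sup>2 - (norm z)\<^sup>2\<close>
  divided by its mass \<open>Z\<close>, which is only estimated: on the ball of radius
  \<open>\<delta> / 2\<close> the square is at least \<open>9 / 16 * \<delta>^4\<close>, so
  \<open>9 / 64 * V * \<delta>^6 \<le> Z\<close>. The gradient has mass at most
  \<open>4 * V * \<delta>^5 / Z\<close>, which gives the factor 256/9.\<close>

lemma mollifier_exists:
  assumes d: "\<delta> > 0"
  shows "\<exists>k gk. mollifier \<delta> k gk"
proof -
  define m where "m z = max 0 (\<delta>\<^sup>2 - (norm z)\<^sup>2)" for z :: "real^2"
  define Z where "Z = (LINT z|lborel. (m z)\<^sup>2)"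
  define V where "V = unit_ball_vol (real DIM(real^2))"
  have V: "V > 0" by (simp add: V_def)
  have mc: "continuous_on UNIV m" unfolding m_def by (intro continuous_intros)
  have m0: "m z = 0" if "norm z \<ge> \<delta>" for z
    using power_mono[OF that, of 2] d by (simp add: m_def)
  have m_le: "0 \<le> m z" "m z \<le> \<delta>\<^sup>2" for z by (auto simp: m_def)
  have m2: "integrable lborel (\<lambda>z. (m z)\<^sup>2)"
    by (rule integrable_compact_support[of _ \<delta>]) (use mc m0 in \<open>auto intro!: continuous_intros\<close>)
  have ball_fin: "emeasure lborel (cball (0::real^2) r) < \<infinity>" for r
    by (rule emeasure_bounded_lborel) simp
  have ind: "integrable lborel (\<lambda>z. indicator (cball (0::real^2) r) z * c)" for r and c :: real
    using ball_fin[of r] by (auto simp: integrable_mult_left integrable_indicator_iff less_top[symmetric])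
  have ball: "measure lborel (cball (0::real^2) r) = V * r\<^sup>2" if "r \<ge> 0" for r
    using that by (simp add: content_cball V_def)
  have "(LINT z|lborel. indicator (cball (0::real^2) (\<delta>/2)) z * (9 / 16 * \<delta>^4)) \<le> Z"
    unfolding Z_def
  proof (rule integral_mono[OF ind m2])
    fix z :: "real^2"
    show "indicator (cball 0 (\<delta>/2)) z * (9 / 16 * \<delta>^4) \<le> (m z)\<^sup>2"
    proof (cases "z \<in> cball 0 (\<delta>/2)")
      case True
      then have "(norm z)\<^sup>2 \<le> (\<delta>/2)\<^sup>2" by (intro power_mono) auto
      moreover have "\<delta>\<^sup>2 - (norm z)\<^sup>2 \<le> m z" by (simp add: m_def)
      ultimately have "3 / 4 * \<delta>\<^sup>2 \<le> m z" by (simp add: power_divide)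
      then have "(3 / 4 * \<delta>\<^sup>2)\<^sup>2 \<le> (m z)\<^sup>2" by (intro power_mono) auto
      then show ?thesis using True by (simp add: power_mult_distrib power_divide)
    qed auto
  qed
  then have Zge: "9 / 64 * V * \<delta>^6 \<le> Z"
    using d by (simp add: ball power_divide field_simps power_numeral_reduce)
  have Zpos: "Z > 0" using Zge V d by (smt (verit) mult_pos_pos zero_less_power divide_pos_pos)
  define k where "k z = (1 / Z) * (m z)\<^sup>2" for z
  define gk where "gk z = (- 4 / Z * m z) *\<^sub>R z" for z
  have gkc: "continuous_on UNIV gk" unfolding gk_def using Zpos by (intro continuous_intros mc) auto
  have gki: "integrable lborel (\<lambda>z. norm (gk z))"
    by (rule integrable_compact_support[of _ \<delta>], rule continuous_on_norm[OF gkc]) (simp add: gk_def m0)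
  have "(LINT z|lborel. norm (gk z)) \<le> (LINT z|lborel. indicator (cball (0::real^2) \<delta>) z * (4 / Z * \<delta>^3))"
  proof (rule integral_mono[OF gki ind])
    fix z :: "real^2"
    show "norm (gk z) \<le> indicator (cball 0 \<delta>) z * (4 / Z * \<delta>^3)"
    proof (cases "z \<in> cball 0 \<delta>")
      case True
      then have "m z * norm z \<le> \<delta>\<^sup>2 * \<delta>" using m_le[of z] by (intro mult_mono) auto
      then have "(4 / Z) * (m z * norm z) \<le> (4 / Z) * (\<delta>\<^sup>2 * \<delta>)" using Zpos by (intro mult_left_mono) auto
      then show ?thesis using True Zpos m_le[of z]
        by (simp add: gk_def abs_mult power3_eq_cube power2_eq_square mult.assoc)
    qed (use m0 in \<open>auto simp: gk_def\<close>)
  qed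
  also have "\<dots> = 4 * V * \<delta>^5 / Z" using d by (simp add: ball field_simps power_numeral_reduce)
  also have "\<dots> \<le> 4 * V * \<delta>^5 / (9 / 64 * V * \<delta>^6)"
    using Zge V d Zpos by (intro divide_left_mono) auto
  also have "\<dots> = (256 / 9) / \<delta>" using V d by (simp add: field_simps power_numeral_reduce)
  also have "\<dots> \<le> 29 / \<delta>" using d by (intro divide_right_mono) auto
  finally have gkb: "(LINT z|lborel. norm (gk z)) \<le> 29 / \<delta>" .
  have pd: "has_pderiv k i (gk z $ i) z" for i z
  proof -
    have "((\<lambda>x. x \<bullet> x) has_derivative (\<lambda>h. 2 * (z \<bullet> h))) (at z)"
      by (auto intro!: derivative_eq_intros simp: inner_commute)
    from has_pderiv_of_derivative[OF this, of i]
    have "has_pderiv (\<lambda>x. (norm x)\<^sup>2) i (2 * z $ i) z"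
      by (simp add: power2_norm_eq_inner inner_axis)
    from has_pderiv_diff[OF has_pderiv_const[of "\<delta>\<^sup>2" i z] this]
    have 1: "has_pderiv (\<lambda>x. \<delta>\<^sup>2 - (norm x)\<^sup>2) i (- (2 * z $ i)) z" by simp
    have "((\<lambda>s::real. (max 0 s)\<^sup>2) has_real_derivative 2 * max 0 s) (at s)" for s
      using has_real_derivative_max0_power[of 0 s] by (simp add: numeral_2_eq_2)
    from has_pderiv_cmult[OF has_pderiv_chain[OF this 1], of "1 / Z"]
    show ?thesis unfolding k_def[abs_def] gk_def m_def by (simp add: mult_ac)
  qed
  have "mollifier \<delta> k gk"
  proof
    show "integrable lborel k" unfolding k_def using m2 by simp
    show "(LINT z|lborel. k z) = 1" unfolding k_def using Zpos by (simp add: Z_def[symmetric])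
    show "continuous_on UNIV k" unfolding k_def using Zpos by (intro continuous_intros mc) auto
  qed (use d Zpos m0 gkc pd gki gkb in \<open>auto simp: k_def gk_def m_def\<close>)
  then show ?thesis by blast
qed

text \<open>Evenness rewrites \<open>f (x - y)\<close> as \<open>f (- x + y)\<close>, a translate of
  \<open>f\<close>.\<close>

lemma integral_reflect:
  fixes f :: "real^2 \<Rightarrow> real"
  assumes "integrable lborel f" "\<And>z. f (- z) = f z"
  shows "integrable lborel (\<lambda>y. f (x - y))" "(LINT y|lborel. f (x - y)) = (LINT z|lborel. f z)"
proof -
  have e: "f (x - y) = f (- x + y)" for y using assms(2)[of "x - y"] by simp
  show "integrable lborel (\<lambda>y. f (x - y))" unfolding e by (rule lborel_integrable_translate[OF assms(1)])
  show "(LINT y|lborel. f (x - y)) = (LINT z|lborel. f z)"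
    unfolding e by (rule lborel_integral_translate) (use assms in auto)
qed

lemma set_integral_le_integral:
  fixes f :: "real^2 \<Rightarrow> real"
  assumes "integrable lborel f" "\<And>z. f z \<ge> 0" "D \<in> sets borel"
  shows "(LINT y:D|lborel. f y) \<le> (LINT y|lborel. f y)"
  unfolding set_lebesgue_integral_def
  by (intro integral_mono integrable_mult_indicator) (use assms in \<open>auto simp: indicator_def\<close>)

context mollifier
begin

lemma k_shift_cont: "continuous_on S (\<lambda>y. k (x - y))" "continuous_on S (\<lambda>x. k (x - y))"
  by (rule continuous_on_compose2[OF k_cont(1)]; auto intro!: continuous_intros)+

lemma gk_shift_cont: "continuous_on S (\<lambda>y. gk (x - y))" "continuous_on S (\<lambda>x. gk (x - y))"
  by (rule continuous_on_compose2[OF k_cont(2)]; auto intro!: continuous_intros)+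

lemma kernel_bounded: obtains B where "B \<ge> 0" "\<And>z. k z \<le> B" "\<And>z. norm (gk z) \<le> B"
proof -
  have "bounded (k ` cball 0 \<delta>)" "bounded (gk ` cball 0 \<delta>)"
    by (intro compact_imp_bounded compact_continuous_image continuous_on_subset[OF k_cont(1)]
       continuous_on_subset[OF k_cont(2)]; simp)+
  then obtain a b where ab: "a > 0" "\<forall>z\<in>cball 0 \<delta>. norm (k z) \<le> a" "b > 0" "\<forall>z\<in>cball 0 \<delta>. norm (gk z) \<le> b"
    unfolding bounded_pos by auto
  show ?thesis
  proof (rule that[of "max a b"])
    show "k z \<le> max a b" for z
      using ab(1) ab(2)[THEN bspec, of z] k_support(1)[of z] by (cases "norm z \<le> \<delta>") auto
    show "norm (gk z) \<le> max a b" for z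
      using ab(3) ab(4)[THEN bspec, of z] k_support(2)[of z] by (cases "norm z \<le> \<delta>") auto
  qed (use ab in auto)
qed

text \<open>Testing the weak vorticity equation with the shifted kernel gives the time derivative of
  the mollified vorticity at the single point \<open>x\<close>.\<close>

lemma kernel_test_fun:
  assumes "cball x \<delta> \<subseteq> D"
  shows "test_fun D (\<lambda>y. k (x - y)) (\<lambda>y. - gk (x - y))"
  unfolding test_fun_def
proof (intro conjI allI exI[of _ "cball x \<delta>"] impI)
  show "has_pderiv (\<lambda>y. k (x - y)) i ((- gk (x - y)) $ i) y" for y i
    using has_pderiv_reflect[OF k_pderiv] by simp
  show "k (x - y) = 0" if "y \<notin> cball x \<delta>" for y
    by (rule k_support) (use that in \<open>auto simp: dist_norm\<close>)
  show "continuous_on UNIV (\<lambda>y. - gk (x - y))" by (intro continuous_intros gk_shift_cont)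
qed (use assms k_shift_cont in auto)

text \<open>The integral runs over \<open>D\<close>, without any extension of \<open>f\<close>. It
  is a true average only at points whose \<open>\<delta>\<close>-ball lies in \<open>D\<close>; a
  cutoff discards the others.\<close>

definition mol :: "(real^2) set \<Rightarrow> (real^2 \<Rightarrow> real) \<Rightarrow> real^2 \<Rightarrow> real" where
  "mol D f x = (LINT y:D|lborel. k (x - y) * f y)"

definition mol_grad :: "(real^2) set \<Rightarrow> (real^2 \<Rightarrow> real) \<Rightarrow> real^2 \<Rightarrow> real^2" where
  "mol_grad D f x = (\<chi> i. LINT y:D|lborel. gk (x - y) $ i * f y)"

context
  fixes D :: "(real^2) set" and f :: "real^2 \<Rightarrow> real" and M :: real
  assumes D: "open D" "bounded D" and f: "continuous_on D f" "\<And>y. y \<in> D \<Longrightarrow> \<bar>f y\<bar> \<le> M" and M: "M \<ge> 0"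
begin

lemma kernel_mult_integrable:
  "set_integrable lborel D (\<lambda>y. k (x - y) * f y)" "set_integrable lborel D (\<lambda>y. gk (x - y) $ i * f y)"
proof -
  obtain B where B: "B \<ge> 0" "\<And>z. k z \<le> B" "\<And>z. norm (gk z) \<le> B" using kernel_bounded by blast
  show "set_integrable lborel D (\<lambda>y. k (x - y) * f y)"
    by (rule set_integrable_test[OF D, where A=B and B=M]) (use B k_nonneg f k_shift_cont in auto)
  show "set_integrable lborel D (\<lambda>y. gk (x - y) $ i * f y)"
  proof (rule set_integrable_test[OF D, where A=B and B=M])
    show "\<bar>gk (x - y) $ i\<bar> \<le> B" for y using B(3)[of "x - y"] component_le_norm_cart[of "gk (x - y)" i] by linarith
  qed (use f gk_shift_cont in \<open>auto intro!: continuous_intros\<close>)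
qed

lemma mol_bound: "\<bar>mol D f x\<bar> \<le> M"
proof -
  note ik = integral_reflect[OF k_int(1) k_sym, of x]
  have "\<bar>mol D f x\<bar> \<le> (LINT y:D|lborel. k (x - y) * M)"
    unfolding mol_def
  proof (rule set_integral_abs_le_integral[OF kernel_mult_integrable(1)])
    show "set_integrable lborel D (\<lambda>y. k (x - y) * M)"
      unfolding set_integrable_def using ik(1) D by (intro integrable_mult_indicator) auto
    show "\<bar>k (x - y) * f y\<bar> \<le> k (x - y) * M" if "y \<in> D" for y
      unfolding abs_mult using k_nonneg[of "x - y"] f(2)[OF that] by (simp add: mult_left_mono)
  qed
  also have "\<dots> \<le> (LINT y|lborel. k (x - y) * M)"
    by (rule set_integral_le_integral) (use ik D k_nonneg M in auto)
  also have "\<dots> = M" using ik k_int by simp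
  finally show ?thesis .
qed

lemma continuous_on_mol: "continuous_on S (mol D f)"
proof -
  obtain B where B: "B \<ge> 0" "\<And>z. k z \<le> B" "\<And>z. norm (gk z) \<le> B" using kernel_bounded by blast
  show ?thesis unfolding mol_def
  proof (rule continuous_on_set_integral[OF _ D(2), where B="B * M"])
    show "set_borel_measurable lborel D (\<lambda>y. k (x - y) * f y)" for x
      using kernel_mult_integrable(1) by (simp add: set_integrable_def set_borel_measurable_def)
    show "\<bar>k (x - y) * f y\<bar> \<le> B * M" if "y \<in> D" for x y
      unfolding abs_mult using B f(2)[OF that] k_nonneg by (intro mult_mono) auto
    show "continuous_on S (\<lambda>x. k (x - y) * f y)" for y
      by (intro continuous_intros k_shift_cont)
  qed (use D in auto)
qed

lemma continuous_on_mol_grad: "continuous_on S (mol_grad D f)"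
proof -
  obtain B where B: "B \<ge> 0" "\<And>z. k z \<le> B" "\<And>z. norm (gk z) \<le> B" using kernel_bounded by blast
  have Bc: "\<bar>gk z $ i\<bar> \<le> B" for z i using B(3)[of z] component_le_norm_cart[of "gk z" i] by linarith
  have "continuous_on S (\<lambda>x. LINT y:D|lborel. gk (x - y) $ i * f y)" for i
  proof (rule continuous_on_set_integral[OF _ D(2), where B="B * M"])
    show "set_borel_measurable lborel D (\<lambda>y. gk (x - y) $ i * f y)" for x
      using kernel_mult_integrable(2) by (simp add: set_integrable_def set_borel_measurable_def)
    show "\<bar>gk (x - y) $ i * f y\<bar> \<le> B * M" if "y \<in> D" for x y
      unfolding abs_mult using B Bc f(2)[OF that] by (intro mult_mono) auto
    show "continuous_on S (\<lambda>x. gk (x - y) $ i * f y)" for y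
      by (intro continuous_intros gk_shift_cont)
  qed (use D in auto)
  then show ?thesis unfolding mol_grad_def[abs_def] by (intro continuous_on_vec_lambda)
qed

lemma mol_has_pderiv: "has_pderiv (mol D f) i (mol_grad D f x $ i) x"
proof -
  let ?e = "axis i 1 :: real^2"
  obtain B where B: "B \<ge> 0" "\<And>z. k z \<le> B" "\<And>z. norm (gk z) \<le> B" using kernel_bounded by blast
  have Bc: "\<bar>gk z $ i\<bar> \<le> B" for z using B(3)[of z] component_le_norm_cart[of "gk z" i] by linarith
  have "((\<lambda>s. LINT y:D|lborel. k (x + s *\<^sub>R ?e - y) * f y) has_real_derivative
      (LINT y:D|lborel. gk (x + 0 *\<^sub>R ?e - y) $ i * f y)) (at 0 within UNIV)"
  proof (rule has_real_derivative_set_integral[OF _ D(2), where B="B * M" and f'="\<lambda>s y. gk (x + s *\<^sub>R ?e - y) $ i * f y"])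
    show "((\<lambda>s. k (x + s *\<^sub>R ?e - y) * f y) has_real_derivative gk (x + s *\<^sub>R ?e - y) $ i * f y) (at s)" for s y
      using k_pderiv[of i "(x - y) + s *\<^sub>R ?e", unfolded has_pderiv_shift]
      by (intro DERIV_cmult_right) (simp add: algebra_simps)
    show "\<bar>gk (x + s *\<^sub>R ?e - y) $ i * f y\<bar> \<le> B * M" if "y \<in> D" for s y
      unfolding abs_mult using B Bc f(2)[OF that] by (intro mult_mono) auto
  qed (use D kernel_mult_integrable in auto)
  then show ?thesis unfolding has_pderiv_def mol_def mol_grad_def by simp
qed

text \<open>When the ball lies in \<open>D\<close> the kernel has mass 1 there, so the difference is
  an average of \<open>f y - f x\<close>.\<close>

lemma mol_close:
  assumes "cball x \<delta> \<subseteq> D" and m: "\<And>y. y \<in> D \<Longrightarrow> dist x y < \<delta> \<Longrightarrow> \<bar>f y - f x\<bar> \<le> m" "m \<ge> 0"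
  shows "\<bar>mol D f x - f x\<bar> \<le> m"
proof -
  note ik = integral_reflect[OF k_int(1) k_sym, of x]
  have ikD: "set_integrable lborel D (\<lambda>y. k (x - y) * c)" for c
    unfolding set_integrable_def using ik(1) D by (intro integrable_mult_indicator) auto
  have full: "(LINT y:D|lborel. k (x - y)) = 1"
  proof -
    have "k (x - y) = 0" if "y \<notin> D" for y
    proof (rule k_support(1), rule ccontr)
      assume "\<not> \<delta> \<le> norm (x - y)"
      then have "y \<in> cball x \<delta>" by (simp add: dist_norm)
      then show False using assms(1) that by blast
    qed
    then have "(LINT y:D|lborel. k (x - y)) = (LINT y|lborel. k (x - y))"
      unfolding set_lebesgue_integral_def
      by (intro Bochner_Integration.integral_cong) (auto simp: indicator_def)
    then show ?thesis using ik k_int by simp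
  qed
  have "mol D f x - f x = (LINT y:D|lborel. k (x - y) * f y) - (LINT y:D|lborel. k (x - y) * f x)"
    using full by (simp add: mol_def)
  also have "\<dots> = (LINT y:D|lborel. k (x - y) * f y - k (x - y) * f x)"
    by (rule set_integral_diff(2)[symmetric, OF kernel_mult_integrable(1) ikD])
  finally have "\<bar>mol D f x - f x\<bar> = \<bar>LINT y:D|lborel. k (x - y) * f y - k (x - y) * f x\<bar>" by simp
  also have "\<dots> \<le> (LINT y:D|lborel. k (x - y) * m)"
  proof (rule set_integral_abs_le_integral[OF set_integral_diff(1)[OF kernel_mult_integrable(1) ikD] ikD])
    fix y assume y: "y \<in> D"
    show "\<bar>k (x - y) * f y - k (x - y) * f x\<bar> \<le> k (x - y) * m"
    proof (cases "dist x y < \<delta>")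
      case True
      have "\<bar>k (x - y) * (f y - f x)\<bar> \<le> k (x - y) * m"
        unfolding abs_mult using k_nonneg[of "x - y"] m(1)[OF y True] by (simp add: mult_left_mono)
      then show ?thesis by (simp add: right_diff_distrib)
    qed (use k_support(1)[of "x - y"] in \<open>simp add: dist_norm\<close>)
  qed
  also have "\<dots> = m" using full by simp
  finally show ?thesis .
qed

end

text \<open>The DiPerna-Lions commutator: for a divergence free Lipschitz field \<open>w\<close>, transport by \<open>w\<close>
  and convolution commute up to an error controlled by the oscillation \<open>m\<close> of \<open>f\<close> at scale \<open>\<delta>\<close>.\<close>

lemma mol_commutator:
  fixes w :: "real^2 \<Rightarrow> real^2"
  assumes D: "open D" "bounded D" and f: "continuous_on D f" "\<And>y. y \<in> D \<Longrightarrow> \<bar>f y\<bar> \<le> M" and M: "M \<ge> 0"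
    and w: "continuous_on D w" "\<And>y. y \<in> D \<Longrightarrow> norm (w y) \<le> Mw"
    and div: "\<And>\<psi> g. test_fun D \<psi> g \<Longrightarrow> (LINT y:D|lborel. w y \<bullet> g y) = 0"
    and L: "L \<ge> 0" "\<And>y. dist x y < \<delta> \<Longrightarrow> norm (w x - w y) \<le> L * dist x y"
    and ball: "cball x \<delta> \<subseteq> D" and m: "\<And>y. y \<in> D \<Longrightarrow> dist x y < \<delta> \<Longrightarrow> \<bar>f y - f x\<bar> \<le> m" "m \<ge> 0"
  shows "\<bar>(LINT y:D|lborel. f y * (w y \<bullet> (- gk (x - y)))) + w x \<bullet> mol_grad D f x\<bar> \<le> 29 * m * L"
proof -
  have x: "x \<in> D" using ball delta_pos by auto
  have Mw: "Mw \<ge> 0" using w(2)[OF x] by (meson norm_ge_zero order_trans)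
  obtain B where B: "B \<ge> 0" "\<And>z. k z \<le> B" "\<And>z. norm (gk z) \<le> B" using kernel_bounded by blast
  have gb: "\<bar>u \<bullet> gk z\<bar> \<le> norm u * B" for u z
    by (rule order_trans[OF Cauchy_Schwarz_ineq2]) (use B in \<open>auto intro: mult_left_mono\<close>)
  have Db: "bounded D" "D \<in> sets borel" using D by auto
  have wi: "set_integrable lborel D (\<lambda>y. c y * (w y \<bullet> gk (x - y)))" if "continuous_on D c" "\<And>y. y \<in> D \<Longrightarrow> \<bar>c y\<bar> \<le> C" for c C
  proof (rule set_integrable_test[OF D that(1)])
    show "continuous_on D (\<lambda>y. w y \<bullet> gk (x - y))" by (intro continuous_intros w gk_shift_cont)
    show "\<bar>w y \<bullet> gk (x - y)\<bar> \<le> Mw * B" if "y \<in> D" for y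
      by (rule order_trans[OF gb]) (use w(2)[OF that] B in \<open>auto intro: mult_right_mono\<close>)
  qed (use that in auto)
  have ui: "set_integrable lborel D (\<lambda>y. c y * (u \<bullet> gk (x - y)))" if "continuous_on D c" "\<And>y. y \<in> D \<Longrightarrow> \<bar>c y\<bar> \<le> C" for c C u
  proof (rule set_integrable_test[OF D that(1)])
    show "continuous_on D (\<lambda>y. u \<bullet> gk (x - y))" by (intro continuous_intros gk_shift_cont)
    show "\<bar>u \<bullet> gk (x - y)\<bar> \<le> norm u * B" if "y \<in> D" for y by (rule gb)
  qed (use that in auto)
  \<comment> \<open>The kernel gradient paired with a constant vector, or with the divergence free
    \<open>w\<close>, integrates to zero. Both integrals therefore keep their values when
    \<open>f y\<close> is replaced by \<open>f y - f x\<close>.\<close>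
  have g0: "(LINT y:D|lborel. u \<bullet> gk (x - y)) = 0" for u
  proof -
    note t = kernel_test_fun[OF ball]
    have "(LINT y:D|lborel. (- gk (x - y)) $ i) = 0" for i
    proof (rule integral_pderiv_zero[OF D(1), where f="\<lambda>y. k (x - y)" and i=i and K="cball x \<delta>"])
      show "k (x - y) = 0" if "y \<notin> cball x \<delta>" for y
        by (rule k_support) (use that in \<open>auto simp: dist_norm\<close>)
    qed (use ball t k_shift_cont gk_shift_cont in \<open>auto simp: test_fun_def intro!: continuous_intros\<close>)
    then have z: "(LINT y:D|lborel. gk (x - y) $ i) = 0" for i
      unfolding set_lebesgue_integral_def by simp
    have si: "set_integrable lborel D (\<lambda>y. u $ i * gk (x - y) $ i)" for i
    proof (rule set_integrable_test[OF D continuous_on_const])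
      show "\<bar>gk (x - y) $ i\<bar> \<le> B" for y using B(3)[of "x - y"] component_le_norm_cart[of "gk (x - y)" i] by linarith
    qed (use gk_shift_cont in \<open>auto intro!: continuous_intros\<close>)
    show ?thesis
      using si z by (simp add: inner_vec_def sum_2 set_integral_add(2))
  qed
  have w0: "(LINT y:D|lborel. w y \<bullet> gk (x - y)) = 0"
    using div[OF kernel_test_fun[OF ball]] unfolding set_lebesgue_integral_def by simp
  have fx: "continuous_on D (\<lambda>y. f y - f x)" "\<And>y. y \<in> D \<Longrightarrow> \<bar>f y - f x\<bar> \<le> 2 * M"
  proof -
    show "continuous_on D (\<lambda>y. f y - f x)" by (intro continuous_intros f)
    fix y assume "y \<in> D" then show "\<bar>f y - f x\<bar> \<le> 2 * M" using f(2)[of y] f(2)[OF x] by linarith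
  qed
  have e1: "w x \<bullet> mol_grad D f x = (LINT y:D|lborel. f y * (w x \<bullet> gk (x - y)))"
  proof -
    have "w x \<bullet> mol_grad D f x = w x $ 1 * (LINT y:D|lborel. gk (x - y) $ 1 * f y) + w x $ 2 * (LINT y:D|lborel. gk (x - y) $ 2 * f y)"
      by (simp add: mol_grad_def inner_vec_def sum_2)
    also have "\<dots> = (LINT y:D|lborel. w x $ 1 * (gk (x - y) $ 1 * f y) + w x $ 2 * (gk (x - y) $ 2 * f y))"
      by (simp add: set_integral_add(2) kernel_mult_integrable(2)[OF D f M])
    also have "\<dots> = (LINT y:D|lborel. f y * (w x \<bullet> gk (x - y)))"
      by (rule arg_cong[where f="set_lebesgue_integral lborel D"]) (auto simp: inner_vec_def sum_2 algebra_simps)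
    finally show ?thesis .
  qed
  have "(LINT y:D|lborel. f y * (w y \<bullet> (- gk (x - y)))) = - (LINT y:D|lborel. f y * (w y \<bullet> gk (x - y)))"
    unfolding set_lebesgue_integral_def by simp
  then have "(LINT y:D|lborel. f y * (w y \<bullet> (- gk (x - y)))) + w x \<bullet> mol_grad D f x
      = ((LINT y:D|lborel. f y * (w x \<bullet> gk (x - y))) - (LINT y:D|lborel. f x * (w x \<bullet> gk (x - y))))
        - ((LINT y:D|lborel. f y * (w y \<bullet> gk (x - y))) - (LINT y:D|lborel. f x * (w y \<bullet> gk (x - y))))"
    using e1 by (simp add: g0 w0)
  also have "\<dots> = (LINT y:D|lborel. f y * (w x \<bullet> gk (x - y)) - f x * (w x \<bullet> gk (x - y)))
       - (LINT y:D|lborel. f y * (w y \<bullet> gk (x - y)) - f x * (w y \<bullet> gk (x - y)))"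
    by (simp only: set_integral_diff(2)[OF ui[OF f] ui[OF continuous_on_const order_refl]]
        set_integral_diff(2)[OF wi[OF f] wi[OF continuous_on_const order_refl]])
  also have "\<dots> = (LINT y:D|lborel. (f y - f x) * (w x \<bullet> gk (x - y))) - (LINT y:D|lborel. (f y - f x) * (w y \<bullet> gk (x - y)))"
    by (simp add: left_diff_distrib)
  also have "\<dots> = (LINT y:D|lborel. (f y - f x) * (w x \<bullet> gk (x - y)) - (f y - f x) * (w y \<bullet> gk (x - y)))"
    by (rule set_integral_diff(2)[symmetric, OF ui[OF fx] wi[OF fx]])
  finally have "\<bar>(LINT y:D|lborel. f y * (w y \<bullet> (- gk (x - y)))) + w x \<bullet> mol_grad D f x\<bar>
      = \<bar>LINT y:D|lborel. (f y - f x) * (w x \<bullet> gk (x - y)) - (f y - f x) * (w y \<bullet> gk (x - y))\<bar>" by simp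
  \<comment> \<open>The integrand is now a product of two increments, at most \<open>m\<close> and
    \<open>L * \<delta>\<close>, with the kernel gradient; the mass \<open>29 / \<delta>\<close> of
    the latter absorbs \<open>\<delta>\<close>.\<close>
  also have "\<dots> \<le> (LINT y:D|lborel. (m * (L * \<delta>)) * norm (gk (x - y)))"
  proof (rule set_integral_abs_le_integral[OF set_integral_diff(1)[OF ui[OF fx] wi[OF fx]]])
    show "set_integrable lborel D (\<lambda>y. m * (L * \<delta>) * norm (gk (x - y)))"
      unfolding set_integrable_def using integral_reflect(1)[OF gk_int(1) gk_sym, of x] Db
      by (intro integrable_mult_indicator) auto
    fix y assume y: "y \<in> D"
    show "\<bar>(f y - f x) * (w x \<bullet> gk (x - y)) - (f y - f x) * (w y \<bullet> gk (x - y))\<bar> \<le> m * (L * \<delta>) * norm (gk (x - y))"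
    proof (cases "dist x y < \<delta>")
      case True
      have "norm (w x - w y) \<le> L * \<delta>"
        using L(2)[OF True] True L(1) by (meson less_imp_le mult_left_mono order_trans)
      then have "\<bar>(w x - w y) \<bullet> gk (x - y)\<bar> \<le> L * \<delta> * norm (gk (x - y))"
        by (intro order_trans[OF Cauchy_Schwarz_ineq2] mult_right_mono) auto
      then have "\<bar>(f y - f x) * ((w x - w y) \<bullet> gk (x - y))\<bar> \<le> m * (L * \<delta> * norm (gk (x - y)))"
        unfolding abs_mult using m(1)[OF y True] m(2) by (intro mult_mono) auto
      then show ?thesis by (simp add: inner_diff_left right_diff_distrib mult.assoc)
    qed (use k_support(2)[of "x - y"] in \<open>simp add: dist_norm\<close>)
  qed
  also have "\<dots> = (m * (L * \<delta>)) * (LINT y:D|lborel. norm (gk (x - y)))" by simp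
  also have "\<dots> \<le> (m * (L * \<delta>)) * (29 / \<delta>)"
  proof (rule mult_left_mono)
    have "(LINT y:D|lborel. norm (gk (x - y))) \<le> (LINT y|lborel. norm (gk (x - y)))"
      by (rule set_integral_le_integral) (use integral_reflect(1)[OF gk_int(1) gk_sym, of x] Db in auto)
    also have "\<dots> \<le> 29 / \<delta>" using integral_reflect(2)[OF gk_int(1) gk_sym, of x] gk_int(2) by simp
    finally show "(LINT y:D|lborel. norm (gk (x - y))) \<le> 29 / \<delta>" .
  qed (use m L delta_pos in auto)
  also have "\<dots> = 29 * m * L" using delta_pos by simp
  finally show ?thesis .
qed

end


section \<open>Transport of a continuous scalar\<close>

lemma set_integrable_continuous_closure:
  fixes f :: "'a::euclidean_space \<Rightarrow> real"
  assumes D: "open D" "bounded D" and f: "continuous_on (closure D) f"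
  shows "set_integrable lborel D f"
proof -
  have "compact (f ` closure D)" using D f by (intro compact_continuous_image) auto
  then obtain B where "\<forall>y\<in>f ` closure D. norm y \<le> B" using compact_imp_bounded bounded_iff by metis
  then have "\<bar>f x\<bar> \<le> B" if "x \<in> D" for x using that closure_subset[of D] by auto
  then show ?thesis
    by (intro set_integrable_bounded_continuous[OF D, of f B] continuous_on_subset[OF f] closure_subset)
qed

text \<open>The integral of a cutoff times \<open>G\<close> of the mollified vorticity is
  differentiable in time. The transport term in its derivative is removed by testing the divergence
  condition with that very product, which leaves the commutator error and a flux through the cutoff.
  Both are of order \<open>\<epsilon>\<close> uniformly in time, as is the cost of regularising. The
  Lipschitz bound concerns segments inside \<open>D\<close> because \<open>D\<close> may fail to be
  convex.\<close>

lemma transport_conserves_integral: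
  fixes v :: "real \<Rightarrow> real^2 \<Rightarrow> real^2" and \<omega> :: "real \<Rightarrow> real^2 \<Rightarrow> real"
  assumes D: "open D" "bounded D" and ab: "a \<le> b"
    and vc: "continuous_on ({a..b} \<times> closure D) (\<lambda>(t, x). v t x)"
    and \<omega>c: "continuous_on ({a..b} \<times> closure D) (\<lambda>(t, x). \<omega> t x)"
    and L: "L \<ge> 0" "\<And>t x y. t \<in> {a..b} \<Longrightarrow> closed_segment x y \<subseteq> D \<Longrightarrow> norm (v t x - v t y) \<le> L * dist x y"
    and div: "\<And>t \<psi> g. t \<in> {a..b} \<Longrightarrow> test_fun D \<psi> g \<Longrightarrow> (LINT x:D|lborel. v t x \<bullet> g x) = 0"
    and weak: "\<And>t \<psi> g. t \<in> {a..b} \<Longrightarrow> test_fun D \<psi> g \<Longrightarrow>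
      ((\<lambda>s. LINT x:D|lborel. \<psi> x * \<omega> s x) has_real_derivative (LINT x:D|lborel. \<omega> t x * (v t x \<bullet> g x))) (at t within {a..b})"
    and cut: "\<And>e. e > 0 \<Longrightarrow> \<exists>\<eta> g. test_fun D \<eta> g \<and> (\<forall>x. 0 \<le> \<eta> x \<and> \<eta> x \<le> 1) \<and> (LINT x:D|lborel. 1 - \<eta> x) \<le> e \<and>
       (\<forall>t\<in>{a..b}. (LINT x:D|lborel. \<bar>v t x \<bullet> g x\<bar>) \<le> e)"
    and G: "\<And>w. (G has_real_derivative G' w) (at w)" "continuous_on UNIV G'"
  shows "(LINT x:D|lborel. G (\<omega> b x)) = (LINT x:D|lborel. G (\<omega> a x))"
proof -
  define S where "S = closure D"
  have S: "compact S" "D \<subseteq> S" using D by (auto simp: S_def closure_subset[THEN subsetD])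
  have Db: "D \<in> sets borel" using D by auto
  define J where "J = {a..b}"
  have J: "compact J" "convex J" "a \<in> J" "b \<in> J" using ab by (auto simp: J_def)
  note vc = vc[folded J_def S_def] and \<omega>c = \<omega>c[folded J_def S_def] and L = L[folded J_def] and div = div[folded J_def]
    and weak = weak[folded J_def] and cut = cut[folded J_def]
  obtain M where M: "M \<ge> 0" "\<And>t x. t \<in> J \<Longrightarrow> x \<in> S \<Longrightarrow> norm (\<omega> t x) \<le> M"
    using compact_time_space_bound[OF \<omega>c J(1) S(1)] by blast
  obtain Mv where Mv: "Mv \<ge> 0" "\<And>t x. t \<in> J \<Longrightarrow> x \<in> S \<Longrightarrow> norm (v t x) \<le> Mv"
    using compact_time_space_bound[OF vc J(1) S(1)] by blast
  have wD: "continuous_on D (\<omega> t)" and wS: "continuous_on S (\<omega> t)" and wM: "\<And>x. x \<in> S \<Longrightarrow> \<bar>\<omega> t x\<bar> \<le> M" if "t \<in> J" for t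
    using continuous_on_time_section[OF \<omega>c that S(2)] continuous_on_time_section[OF \<omega>c that order_refl] M(2)[OF that] by auto
  have vD: "continuous_on D (v t)" and vS: "continuous_on S (v t)" if "t \<in> J" for t
    using continuous_on_time_section[OF vc that S(2)] continuous_on_time_section[OF vc that order_refl] by auto
  have Gc: "continuous_on T G" for T
    by (rule continuous_on_subset[OF _ subset_UNIV]) (use G(1) DERIV_continuous_on has_field_derivative_at_within in blast)
  have G'c: "continuous_on T G'" for T by (rule continuous_on_subset[OF G(2) subset_UNIV])
  have "compact (G ` {-M..M})" "compact (G' ` {-M..M})"
    by (intro compact_continuous_image Gc G'c; simp)+
  then obtain m1 m2 where m12: "m1 > 0" "\<forall>y\<in>G ` {-M..M}. norm y \<le> m1" "m2 > 0" "\<forall>y\<in>G' ` {-M..M}. norm y \<le> m2"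
    using compact_imp_bounded bounded_pos by metis
  define MG where "MG = max m1 m2"
  have MG: "MG > 0" "\<And>w. \<bar>w\<bar> \<le> M \<Longrightarrow> \<bar>G w\<bar> \<le> MG" "\<And>w. \<bar>w\<bar> \<le> M \<Longrightarrow> \<bar>G' w\<bar> \<le> MG"
    using m12 by (auto simp: MG_def abs_le_iff le_max_iff_disj)
  have Glip: "\<bar>G u - G w\<bar> \<le> MG * \<bar>u - w\<bar>" if "\<bar>u\<bar> \<le> M" "\<bar>w\<bar> \<le> M" for u w
    by (rule real_quotient_bound[where J="{-M..M}" and f'=G'])
      (use G MG that in \<open>auto intro: has_field_derivative_at_within\<close>)
  define A where "A = measure lborel D"
  have A: "A \<ge> 0" by (simp add: A_def)
  have GwI: "set_integrable lborel D (\<lambda>x. G (\<omega> t x))" if "t \<in> J" for t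
    using continuous_on_compose2[OF Gc wS[OF that] subset_UNIV]
    by (intro set_integrable_continuous_closure[OF D]) (simp add: S_def)
  \<comment> \<open>The length of the time interval times the bound on the derivative of the
    regularised integral, plus the regularisation error at both end times.\<close>
  define C where "C = (b - a) * (29 * MG * L * A + MG) + 2 * MG * A + 2 * MG"
  have C: "C \<ge> 0" using ab MG L A by (simp add: C_def)
  have est: "\<bar>(LINT x:D|lborel. G (\<omega> b x)) - (LINT x:D|lborel. G (\<omega> a x))\<bar> \<le> C * \<epsilon>" if e: "\<epsilon> > 0" for \<epsilon>
  proof -
    obtain \<eta> g where \<eta>: "test_fun D \<eta> g" "\<And>x. 0 \<le> \<eta> x" "\<And>x. \<eta> x \<le> 1" "(LINT x:D|lborel. 1 - \<eta> x) \<le> \<epsilon>"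
        "\<And>t. t \<in> J \<Longrightarrow> (LINT x:D|lborel. \<bar>v t x \<bullet> g x\<bar>) \<le> \<epsilon>"
      using cut[OF e] by blast
    have \<eta>c: "continuous_on T \<eta>" and gc: "continuous_on T g" for T
      by (rule test_fun_continuous[OF \<eta>(1)])+
    obtain K where K: "compact K" "K \<subseteq> D" "\<And>x. x \<notin> K \<Longrightarrow> \<eta> x = 0" using \<eta>(1) by (auto simp: test_fun_def)
    obtain r where r: "r > 0" "(\<Union>x\<in>K. cball x r) \<subseteq> D"
      using compact_subset_open_imp_cball_epsilon_subset[OF K(1) D(1) K(2)] by blast
    obtain \<delta>1 where \<delta>1: "\<delta>1 > 0" "\<And>t x y. t \<in> J \<Longrightarrow> x \<in> S \<Longrightarrow> y \<in> S \<Longrightarrow> dist x y < \<delta>1 \<Longrightarrow> norm (\<omega> t x - \<omega> t y) \<le> \<epsilon>"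
      using compact_time_space_modulus[OF \<omega>c J(1) S(1) e] by blast
    \<comment> \<open>\<open>r\<close> keeps kernels centred in \<open>K\<close> inside
      \<open>D\<close>; \<open>\<delta>1\<close> makes the oscillation of the vorticity at scale
      \<open>\<delta>\<close> at most \<open>\<epsilon>\<close>.\<close>
    define \<delta> where "\<delta> = min r \<delta>1"
    have \<delta>: "\<delta> > 0" "\<delta> \<le> r" "\<delta> \<le> \<delta>1" using r \<delta>1 by (auto simp: \<delta>_def)
    obtain k gk where "mollifier \<delta> k gk" using mollifier_exists[OF \<delta>(1)] by blast
    then interpret mollifier \<delta> k gk .
    have ball: "cball x \<delta> \<subseteq> D" if "x \<in> K" for x
    proof -
      have "cball x \<delta> \<subseteq> cball x r" using \<delta> by auto
      then show ?thesis using r that by blast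
    qed
    have osc: "\<bar>\<omega> t y - \<omega> t x\<bar> \<le> \<epsilon>" if "t \<in> J" "x \<in> K" "y \<in> D" "dist x y < \<delta>" for t x y
      using \<delta>1(2)[of t y x] that S K \<delta> by (auto simp: dist_commute)
    obtain B where B: "B \<ge> 0" "\<And>z. k z \<le> B" "\<And>z. norm (gk z) \<le> B" using kernel_bounded by blast
    define W where "W t = mol D (\<omega> t)" for t
    define Wt where "Wt t x = (LINT y:D|lborel. \<omega> t y * (v t y \<bullet> (- gk (x - y))))" for t x
    define f where "f t = (LINT x:D|lborel. \<eta> x * G (W t x))" for t
    have wMD: "\<bar>\<omega> t y\<bar> \<le> M" if "t \<in> J" "y \<in> D" for t y using wM that S by auto
    have WM: "\<bar>W t x\<bar> \<le> M" if "t \<in> J" for t x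
      unfolding W_def by (rule mol_bound[OF D wD[OF that] wMD[OF that] M(1)])
    have Wc: "continuous_on T (W t)" if "t \<in> J" for t T
      unfolding W_def by (rule continuous_on_mol[OF D wD[OF that] wMD[OF that] M(1)])
    have Wgc: "continuous_on T (mol_grad D (\<omega> t))" if "t \<in> J" for t T
      by (rule continuous_on_mol_grad[OF D wD[OF that] wMD[OF that] M(1)])
    have Wp: "has_pderiv (W t) i (mol_grad D (\<omega> t) x $ i) x" if "t \<in> J" for t i x
      unfolding W_def by (rule mol_has_pderiv[OF D wD[OF that] wMD[OF that] M(1)])
    have Wt_int: "\<bar>\<omega> t y * (v t y \<bullet> (- gk (x - y)))\<bar> \<le> M * (Mv * B)" if "t \<in> J" "y \<in> D" for t x y
    proof -
      have "\<bar>v t y \<bullet> (- gk (x - y))\<bar> \<le> Mv * B"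
        by (rule order_trans[OF Cauchy_Schwarz_ineq2]) (use Mv(1) Mv(2)[OF that(1), of y] S that B in \<open>auto intro!: mult_mono\<close>)
      then show ?thesis unfolding abs_mult using wMD[OF that] M by (intro mult_mono) auto
    qed
    have Wt_bound: "\<bar>Wt t x\<bar> \<le> M * (Mv * B) * A" if "t \<in> J" for t x
      unfolding Wt_def A_def by (rule set_integral_abs_le[OF Db D(2)]) (use Wt_int[OF that] M Mv B in auto)
    have Wtc: "continuous_on T (Wt t)" if "t \<in> J" for t T
      unfolding Wt_def
    proof (rule continuous_on_set_integral[OF Db D(2), where B="M * (Mv * B)"])
      show "set_borel_measurable lborel D (\<lambda>y. \<omega> t y * (v t y \<bullet> (- gk (x - y))))" for x
        by (rule set_borel_measurable_open[OF D(1)]) (intro continuous_intros wD[OF that] vD[OF that] gk_shift_cont)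
      show "continuous_on T (\<lambda>x. \<omega> t y * (v t y \<bullet> (- gk (x - y))))" for y
        by (intro continuous_intros gk_shift_cont)
    qed (use Wt_int[OF that] in auto)
    have dW: "((\<lambda>s. W s x) has_real_derivative Wt t x) (at t within J)" if "t \<in> J" "x \<in> K" for t x
      unfolding W_def mol_def Wt_def by (rule weak[OF that(1) kernel_test_fun[OF ball[OF that(2)]]])
    have df: "(f has_real_derivative (LINT x:D|lborel. \<eta> x * (G' (W t x) * Wt t x))) (at t within J)" if t: "t \<in> J" for t
      unfolding f_def
    proof (rule has_real_derivative_set_integral[OF Db D(2) J(2) t, where f'="\<lambda>s x. \<eta> x * (G' (W s x) * Wt s x)" and B="1 * (MG * (M * (Mv * B) * A))"])
      fix s assume s: "s \<in> J"
      have "continuous_on (closure D) (\<lambda>x. \<eta> x * G (W s x))"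
        by (intro continuous_intros \<eta>c continuous_on_compose2[OF Gc Wc[OF s]]) auto
      then show "set_integrable lborel D (\<lambda>x. \<eta> x * G (W s x))"
        by (rule set_integrable_continuous_closure[OF D])
      fix x assume "x \<in> D"
      show "((\<lambda>s. \<eta> x * G (W s x)) has_real_derivative \<eta> x * (G' (W s x) * Wt s x)) (at s within J)"
      proof (cases "x \<in> K")
        case True
        show ?thesis by (intro DERIV_cmult DERIV_chain2[OF G(1) dW[OF s True]])
      qed (simp add: K)
      show "\<bar>\<eta> x * (G' (W s x) * Wt s x)\<bar> \<le> 1 * (MG * (M * (Mv * B) * A))"
        unfolding abs_mult using \<eta>(2,3)[of x] MG(3)[OF WM[OF s]] MG(1) Wt_bound[OF s, of x]
        by (intro mult_mono) auto
    qed
    have bd: "\<bar>LINT x:D|lborel. \<eta> x * (G' (W t x) * Wt t x)\<bar> \<le> (29 * MG * L * A + MG) * \<epsilon>" if t: "t \<in> J" for t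
    proof -
      \<comment> \<open>\<open>R\<close> carries the commutator error and \<open>Q\<close> the flux
        through the cutoff. Their sum exceeds the integrand of the derivative by
        \<open>v t x \<bullet> g\<psi> x\<close>, which integrates to zero since
        \<open>\<psi>\<close> is a test function.\<close>
      define R where "R x = \<eta> x * (G' (W t x) * (Wt t x + v t x \<bullet> mol_grad D (\<omega> t) x))" for x
      define Q where "Q x = G (W t x) * (v t x \<bullet> g x)" for x
      define \<psi> where "\<psi> x = \<eta> x * G (W t x)" for x
      define g\<psi> where "g\<psi> x = G (W t x) *\<^sub>R g x + (\<eta> x * G' (W t x)) *\<^sub>R mol_grad D (\<omega> t) x" for x
      have GW: "continuous_on T (\<lambda>x. G (W t x))" "continuous_on T (\<lambda>x. G' (W t x))" for T
        by (rule continuous_on_compose2[OF Gc Wc[OF t] subset_UNIV], rule continuous_on_compose2[OF G'c Wc[OF t] subset_UNIV])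
      have tf: "test_fun D \<psi> g\<psi>"
        unfolding test_fun_def
      proof (intro conjI allI exI[of _ K] impI)
        show "continuous_on UNIV \<psi>" "continuous_on UNIV g\<psi>"
          unfolding \<psi>_def g\<psi>_def by (intro continuous_intros \<eta>c gc GW Wgc[OF t])+
        fix x i
        have "has_pderiv \<eta> i (g x $ i) x" using \<eta>(1) by (simp add: test_fun_def)
        from has_pderiv_mult[OF this has_pderiv_chain[OF G(1) Wp[OF t]]]
        show "has_pderiv \<psi> i (g\<psi> x $ i) x" unfolding \<psi>_def[abs_def] g\<psi>_def by (simp add: mult_ac)
      qed (use K in \<open>auto simp: \<psi>_def\<close>)
      have Ri: "set_integrable lborel D R"
        unfolding R_def by (rule set_integrable_continuous_closure[OF D])
          (intro continuous_intros \<eta>c GW Wtc[OF t] vS[OF t, unfolded S_def] Wgc[OF t])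
      have Qi: "set_integrable lborel D Q"
        unfolding Q_def by (rule set_integrable_continuous_closure[OF D])
          (intro continuous_intros gc GW vS[OF t, unfolded S_def])
      have Pi: "set_integrable lborel D (\<lambda>x. v t x \<bullet> g\<psi> x)"
        unfolding g\<psi>_def by (rule set_integrable_continuous_closure[OF D])
          (intro continuous_intros \<eta>c gc GW vS[OF t, unfolded S_def] Wgc[OF t])
      have "(LINT x:D|lborel. \<eta> x * (G' (W t x) * Wt t x)) = (LINT x:D|lborel. R x + Q x - v t x \<bullet> g\<psi> x)"
        by (rule arg_cong[where f="set_lebesgue_integral lborel D"])
          (auto simp: R_def Q_def g\<psi>_def inner_add_right algebra_simps)
      also have "\<dots> = (LINT x:D|lborel. R x) + (LINT x:D|lborel. Q x)"
        using div[OF t tf] by (simp add: set_integral_diff(2)[OF set_integral_add(1)[OF Ri Qi] Pi] set_integral_add(2)[OF Ri Qi])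
      finally have "\<bar>LINT x:D|lborel. \<eta> x * (G' (W t x) * Wt t x)\<bar> \<le> \<bar>LINT x:D|lborel. R x\<bar> + \<bar>LINT x:D|lborel. Q x\<bar>"
        by simp
      moreover have "\<bar>LINT x:D|lborel. R x\<bar> \<le> 1 * (MG * (29 * \<epsilon> * L)) * A"
        unfolding A_def
      proof (rule set_integral_abs_le[OF Db D(2)])
        fix x assume x: "x \<in> D"
        show "\<bar>R x\<bar> \<le> 1 * (MG * (29 * \<epsilon> * L))"
        proof (cases "x \<in> K")
          case True
          have "\<bar>Wt t x + v t x \<bullet> mol_grad D (\<omega> t) x\<bar> \<le> 29 * \<epsilon> * L"
            unfolding Wt_def
          proof (rule mol_commutator[OF D wD[OF t] wMD[OF t] M(1) vD[OF t] _ div[OF t] L(1) _ ball[OF True]])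
            show "norm (v t y) \<le> Mv" if "y \<in> D" for y using Mv(2)[OF t] that S by auto
            show "norm (v t x - v t y) \<le> L * dist x y" if "dist x y < \<delta>" for y
            proof (rule L(2)[OF t])
              have "closed_segment x y \<subseteq> cball x \<delta>"
                using that \<delta> by (intro closed_segment_subset) auto
              then show "closed_segment x y \<subseteq> D" using ball[OF True] by blast
            qed
          qed (use osc[OF t True] e in auto)
          then show ?thesis unfolding R_def abs_mult using \<eta>(2,3)[of x] MG(3)[OF WM[OF t]] MG(1)
            by (intro mult_mono) auto
        next
          case False
          then show ?thesis using K MG e L by (simp add: R_def)
        qed
      qed (use MG e L in auto)
      moreover have "\<bar>LINT x:D|lborel. Q x\<bar> \<le> MG * \<epsilon>"
      proof -
        have i: "set_integrable lborel D (\<lambda>x. MG * \<bar>v t x \<bullet> g x\<bar>)"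
          by (rule set_integrable_continuous_closure[OF D])
            (intro continuous_intros gc vS[OF t, unfolded S_def])
        have "\<bar>LINT x:D|lborel. Q x\<bar> \<le> (LINT x:D|lborel. MG * \<bar>v t x \<bullet> g x\<bar>)"
          by (rule set_integral_abs_le_integral[OF Qi i])
            (use MG(2)[OF WM[OF t]] in \<open>auto simp: Q_def abs_mult intro!: mult_right_mono\<close>)
        also have "\<dots> \<le> MG * \<epsilon>" using \<eta>(5)[OF t] MG by simp
        finally show ?thesis .
      qed
      ultimately show ?thesis by (simp add: algebra_simps)
    qed
    have "\<bar>f b - f a\<bar> \<le> (29 * MG * L * A + MG) * \<epsilon> * \<bar>b - a\<bar>"
      by (rule real_quotient_bound[OF J(2) df bd J(4,3)])
    moreover have near: "\<bar>(LINT x:D|lborel. G (\<omega> t x)) - f t\<bar> \<le> MG * \<epsilon> + MG * \<epsilon> * A" if t: "t \<in> J" for t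
    proof -
      have "continuous_on (closure D) (\<lambda>x. (1 - \<eta> x) * G (\<omega> t x))"
        by (intro continuous_intros \<eta>c continuous_on_compose2[OF Gc wS[OF t, unfolded S_def]]) auto
      note i1 = set_integrable_continuous_closure[OF D this]
      have "continuous_on (closure D) (\<lambda>x. \<eta> x * (G (\<omega> t x) - G (W t x)))"
        by (intro continuous_intros \<eta>c continuous_on_compose2[OF Gc wS[OF t, unfolded S_def]] continuous_on_compose2[OF Gc Wc[OF t]]) auto
      note i2 = set_integrable_continuous_closure[OF D this]
      have "continuous_on (closure D) (\<lambda>x. \<eta> x * G (W t x))"
        by (intro continuous_intros \<eta>c continuous_on_compose2[OF Gc Wc[OF t]]) auto
      note i3 = set_integrable_continuous_closure[OF D this]
      have "continuous_on (closure D) (\<lambda>x. MG * (1 - \<eta> x))" by (intro continuous_intros \<eta>c)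
      note i4 = set_integrable_continuous_closure[OF D this]
      have "(LINT x:D|lborel. G (\<omega> t x)) - f t = (LINT x:D|lborel. G (\<omega> t x) - \<eta> x * G (W t x))"
        unfolding f_def by (rule set_integral_diff(2)[symmetric, OF GwI[OF t] i3])
      also have "\<dots> = (LINT x:D|lborel. (1 - \<eta> x) * G (\<omega> t x) + \<eta> x * (G (\<omega> t x) - G (W t x)))"
        by (rule arg_cong[where f="set_lebesgue_integral lborel D"]) (auto simp: algebra_simps)
      also have "\<dots> = (LINT x:D|lborel. (1 - \<eta> x) * G (\<omega> t x)) + (LINT x:D|lborel. \<eta> x * (G (\<omega> t x) - G (W t x)))"
        by (rule set_integral_add(2)[OF i1 i2])
      finally have "\<bar>(LINT x:D|lborel. G (\<omega> t x)) - f t\<bar> \<le> \<bar>LINT x:D|lborel. (1 - \<eta> x) * G (\<omega> t x)\<bar> + \<bar>LINT x:D|lborel. \<eta> x * (G (\<omega> t x) - G (W t x))\<bar>"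
        by simp
      moreover have "\<bar>LINT x:D|lborel. (1 - \<eta> x) * G (\<omega> t x)\<bar> \<le> MG * \<epsilon>"
      proof -
        have "\<bar>LINT x:D|lborel. (1 - \<eta> x) * G (\<omega> t x)\<bar> \<le> (LINT x:D|lborel. MG * (1 - \<eta> x))"
          by (rule set_integral_abs_le_integral[OF i1 i4])
            (use MG(2)[OF wMD[OF t]] \<eta> in \<open>auto simp: abs_mult mult.commute[of MG] intro!: mult_left_mono\<close>)
        also have "\<dots> = MG * (LINT x:D|lborel. 1 - \<eta> x)" by (rule set_integral_mult_right)
        also have "\<dots> \<le> MG * \<epsilon>" using \<eta>(4) MG by simp
        finally show ?thesis .
      qed
      moreover have "\<bar>LINT x:D|lborel. \<eta> x * (G (\<omega> t x) - G (W t x))\<bar> \<le> 1 * (MG * \<epsilon>) * A"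
        unfolding A_def
      proof (rule set_integral_abs_le[OF Db D(2)])
        fix x assume x: "x \<in> D"
        show "\<bar>\<eta> x * (G (\<omega> t x) - G (W t x))\<bar> \<le> 1 * (MG * \<epsilon>)"
        proof (cases "x \<in> K")
          case True
          have "\<bar>W t x - \<omega> t x\<bar> \<le> \<epsilon>"
            unfolding W_def by (rule mol_close[OF D wD[OF t] wMD[OF t] M(1) ball[OF True]]) (use osc[OF t True] e in auto)
          then have "\<bar>G (\<omega> t x) - G (W t x)\<bar> \<le> MG * \<epsilon>"
            using Glip[OF wMD[OF t x] WM[OF t, of x]] MG(1) by (smt (verit) abs_minus_commute mult_left_mono)
          then show ?thesis unfolding abs_mult using \<eta>(2,3)[of x] by (intro mult_mono) auto
        next
          case False
          then show ?thesis using K MG e by simp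
        qed
      qed (use MG e in auto)
      ultimately show ?thesis by linarith
    qed
    moreover have "C * \<epsilon> = (29 * MG * L * A + MG) * \<epsilon> * \<bar>b - a\<bar> + 2 * (MG * \<epsilon> + MG * \<epsilon> * A)"
      using ab by (simp add: C_def algebra_simps)
    moreover have "\<bar>y - x\<bar> \<le> c + 2 * d" if "\<bar>p - q\<bar> \<le> c" "\<bar>x - q\<bar> \<le> d" "\<bar>y - p\<bar> \<le> d" for p q x y c d :: real
      using that by linarith
    ultimately show ?thesis using near[OF J(3)] near[OF J(4)] by simp
  qed
  show ?thesis
    using abs_le_mult_eps_imp_zero[OF C est] by simp
qed


section \<open>Multi-connected domains\<close>

definition perp :: "real^2 \<Rightarrow> real^2" where
  "perp z = vector [z $ 2, - z $ 1]"

lemma perp_simps [simp]: "perp z $ 1 = z $ 2" "perp z $ 2 = - z $ 1"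
  by (simp_all add: perp_def)

lemma inner_vec2: "(x::real^2) \<bullet> y = x $ 1 * y $ 1 + x $ 2 * y $ 2"
  by (simp add: inner_vec_def sum_2)

lemma vec2_eq_iff: "(x::real^2) = y \<longleftrightarrow> x $ 1 = y $ 1 \<and> x $ 2 = y $ 2"
  by (simp add: vec_eq_iff forall_2)

lemma norm_perp: "norm (perp z) = norm z"
  by (simp add: norm_eq_sqrt_inner inner_vec2 add.commute)

lemma continuous_on_perp: "continuous_on A f \<Longrightarrow> continuous_on A (\<lambda>x. perp (f x))"
proof -
  assume f: "continuous_on A f"
  have e: "(\<lambda>x. perp (f x)) = (\<lambda>x. \<chi> i. if i = 1 then f x $ 2 else - f x $ 1)"
    by (auto simp: fun_eq_iff vec2_eq_iff)
  have "continuous_on A (\<lambda>x. if i = (1::2) then f x $ 2 else - f x $ 1)" for i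
    using f by (cases "i = 1") (auto intro!: continuous_intros)
  then show ?thesis unfolding e by (rule continuous_on_vec_lambda)
qed

lemma orthogonal_perp_imp_parallel:
  fixes x z :: "real^2"
  assumes "x \<bullet> perp z = 0" "z \<noteq> 0"
  shows "\<exists>c. x = c *\<^sub>R z"
proof (intro exI)
  have "z \<bullet> z \<noteq> 0" using assms by simp
  moreover have "x $ 1 * (z \<bullet> z) = (x \<bullet> z) * z $ 1 + (x \<bullet> perp z) * z $ 2" "x $ 2 * (z \<bullet> z) = (x \<bullet> z) * z $ 2 - (x \<bullet> perp z) * z $ 1"
    by (simp_all add: inner_vec2 algebra_simps)
  ultimately show "x = ((x \<bullet> z) / (z \<bullet> z)) *\<^sub>R z"
    using assms by (simp add: vec2_eq_iff field_simps)
qed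

locale domain =
  fixes D :: "(real^2) set" and n :: nat and \<gamma> :: "nat \<Rightarrow> real \<Rightarrow> real^2"
  assumes dom: "multiconnected_domain D n \<gamma>"
begin

definition S :: "(real^2) set" where "S = closure D"

definition tangent :: "nat \<Rightarrow> real \<Rightarrow> real^2" where "tangent i s = vector_derivative (\<gamma> i) (at s)"

lemma D: "open D" "bounded D" and fr: "frontier D = (\<Union>i\<le>n. \<gamma> i ` {0..1})"
  using dom by (auto simp: multiconnected_domain_def path_image_def)

lemma S: "compact S" "D \<subseteq> S" "S = D \<union> frontier D"
proof -
  show "compact S" using D by (simp add: S_def)
  show "D \<subseteq> S" "S = D \<union> frontier D" using closure_Un_frontier[of D] closure_subset[of D] by (auto simp: S_def)
qed

lemma curve:
  assumes "i \<le> n"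
  shows "simple_path (\<gamma> i)" "\<gamma> i (s + 1) = \<gamma> i s" "tangent i s \<noteq> 0"
    "(\<gamma> i has_vector_derivative tangent i s) (at s)"
    "(tangent i has_vector_derivative vector_derivative (tangent i) (at s)) (at s)"
    "continuous_on UNIV (\<lambda>s. vector_derivative (tangent i) (at s))"
proof -
  have sc: "smooth_closed_curve (\<gamma> i)" using dom assms by (auto simp: multiconnected_domain_def)
  then show "simple_path (\<gamma> i)" "\<gamma> i (s + 1) = \<gamma> i s" "tangent i s \<noteq> 0" by (auto simp: smooth_closed_curve_def tangent_def)
  have d: "((\<lambda>h s. vector_derivative h (at s)) ^^ k) (\<gamma> i) differentiable (at t)" for k t
    using sc by (auto simp: smooth_closed_curve_def)
  show "(\<gamma> i has_vector_derivative tangent i s) (at s)"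
    using d[of 0 s] unfolding tangent_def by (simp add: vector_derivative_works)
  have t: "tangent i = (\<lambda>s. vector_derivative (\<gamma> i) (at s))" by (auto simp: tangent_def)
  show "(tangent i has_vector_derivative vector_derivative (tangent i) (at s)) (at s)"
    using d[of 1 s] unfolding t by (simp add: vector_derivative_works)
  have "(\<lambda>s. vector_derivative (tangent i) (at s)) differentiable (at t)" for t
    using d[of 2 t] unfolding t by (simp add: numeral_2_eq_2)
  then show "continuous_on UNIV (\<lambda>s. vector_derivative (tangent i) (at s))"
    by (intro continuous_at_imp_continuous_on ballI differentiable_imp_continuous_within)
qed

lemma curve_of_int: "i \<le> n \<Longrightarrow> \<gamma> i (s + of_int m) = \<gamma> i s"
proof -
  assume i: "i \<le> n"
  interpret periodic_fun_simple' "\<gamma> i" by standard (rule curve(2)[OF i])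
  show ?thesis by (rule plus_of_int)
qed

lemma curve_in_frontier: "i \<le> n \<Longrightarrow> \<gamma> i s \<in> frontier D"
proof -
  assume i: "i \<le> n"
  have "\<gamma> i s = \<gamma> i (frac s)" using curve_of_int[OF i, of "frac s" "\<lfloor>s\<rfloor>"] by (simp add: frac_def)
  moreover have "frac s \<in> {0..1}" using frac_lt_1[of s] by simp
  ultimately show ?thesis using i unfolding fr by blast
qed

lemma curve_in_S: "i \<le> n \<Longrightarrow> \<gamma> i s \<in> S"
  using curve_in_frontier S by blast

text \<open>Loop-freeness speaks of \<open>{0..1}\<close> only. Fractional parts bring both
  parameters there; if these agree, \<open>s - r\<close> is an integer strictly between 0 and
  1.\<close>

lemma curve_injective:
  assumes i: "i \<le> n" and eq: "\<gamma> i s = \<gamma> i r" and "r < s" "s < r + 1"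
  shows False
proof -
  have e: "\<gamma> i t = \<gamma> i (frac t)" for t using curve_of_int[OF i, of "frac t" "\<lfloor>t\<rfloor>"] by (simp add: frac_def)
  have lf: "loop_free (\<gamma> i)" using curve(1)[OF i] by (simp add: simple_path_def)
  have "frac s \<in> {0..1}" "frac r \<in> {0..1}" "frac s < 1" "frac r < 1"
    using frac_lt_1[of s] frac_lt_1[of r] by auto
  moreover have "\<gamma> i (frac s) = \<gamma> i (frac r)" using eq e[of s] e[of r] by simp
  ultimately have "frac s = frac r \<or> frac s = 0 \<and> frac r = 1 \<or> frac s = 1 \<and> frac r = 0"
    using lf unfolding loop_free_def by blast
  then have "frac s = frac r" using frac_lt_1[of s] frac_lt_1[of r] by linarith
  then have *: "s - r = of_int (\<lfloor>s\<rfloor> - \<lfloor>r\<rfloor>)" by (simp add: frac_def)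
  then have "0 < \<lfloor>s\<rfloor> - \<lfloor>r\<rfloor>" "\<lfloor>s\<rfloor> - \<lfloor>r\<rfloor> < 1" using assms(3,4) by linarith+
  then show False by linarith
qed

text \<open>Starting at a point of the domain near the boundary point, one of the two half lines in normal
  direction avoids the boundary, since the curve is a graph over its tangent.\<close>

lemma nontangential_approach:
  fixes s0 :: real
  assumes i: "i \<le> n" and r: "r > 0"
  defines "N \<equiv> (1 / norm (tangent i s0)) *\<^sub>R perp (tangent i s0)"
  shows "\<exists>y\<in>D. dist y (\<gamma> i s0) < r \<and> \<bar>(y - \<gamma> i s0) \<bullet> N\<bar> > 1 / 4 * norm (y - \<gamma> i s0)"
proof -
  define x where "x = \<gamma> i s0"
  define T where "T = tangent i s0"
  have T: "T \<noteq> 0" using curve(3)[OF i] by (simp add: T_def)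
  have N: "norm N = 1" "N \<bullet> T = 0" using T by (auto simp: N_def T_def[symmetric] norm_perp inner_vec2)
  have "isCont (\<lambda>s. tangent i s \<bullet> T) s0"
    by (intro continuous_intros has_vector_derivative_continuous[OF curve(5)[OF i]])
  moreover have "tangent i s0 \<bullet> T > 0" using T by (simp add: T_def)
  ultimately have "\<forall>\<^sub>F s in at s0. tangent i s \<bullet> T > 0"
    by (simp add: isCont_def order_tendstoD(1))
  then obtain \<delta>0 where d0: "\<delta>0 > 0" "\<And>s. s \<noteq> s0 \<Longrightarrow> dist s s0 < \<delta>0 \<Longrightarrow> tangent i s \<bullet> T > 0"
    unfolding eventually_at by auto
  \<comment> \<open>Halving keeps the closed parameter interval where the tangent has positive
    product with \<open>T\<close>; the bound 1/4 keeps the complementary interval of one period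
    nonempty.\<close>
  define \<delta> where "\<delta> = min (\<delta>0 / 2) (1 / 4)"
  have d: "\<delta> > 0" "\<delta> \<le> 1 / 4" "\<And>s. s \<in> {s0 - \<delta>..s0 + \<delta>} \<Longrightarrow> tangent i s \<bullet> T > 0"
  proof -
    show "\<delta> > 0" "\<delta> \<le> 1 / 4" using d0 by (auto simp: \<delta>_def)
    fix s assume "s \<in> {s0 - \<delta>..s0 + \<delta>}"
    then have "dist s s0 < \<delta>0" using d0(1) by (auto simp: \<delta>_def dist_real_def)
    then show "tangent i s \<bullet> T > 0" using d0(2)[of s] T by (cases "s = s0") (auto simp: T_def)
  qed
  have mono: "\<gamma> i s \<bullet> T < \<gamma> i t \<bullet> T" if "s \<in> {s0 - \<delta>..s0 + \<delta>}" "t \<in> {s0 - \<delta>..s0 + \<delta>}" "s < t" for s t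
  proof (rule DERIV_pos_imp_increasing[OF that(3)])
    fix z assume z: "s \<le> z" "z \<le> t"
    have "((\<lambda>s. \<gamma> i s \<bullet> T) has_real_derivative tangent i z \<bullet> T) (at z)"
      using curve(4)[OF i, of z] unfolding has_vector_derivative_def has_field_derivative_def
      by (auto intro!: derivative_eq_intros simp: mult.commute)
    then show "\<exists>y. ((\<lambda>s. \<gamma> i s \<bullet> T) has_real_derivative y) (at z) \<and> 0 < y"
      using d(3)[of z] z that by auto
  qed
  \<comment> \<open>The boundary without the open arc around \<open>s0\<close>. It is compact and
    misses \<open>x\<close>, so near \<open>x\<close> the boundary consists of that arc.\<close>
  define F where "F = (\<Union>j\<in>{..n} - {i}. \<gamma> j ` {0..1}) \<union> \<gamma> i ` {s0 + \<delta>..s0 + 1 - \<delta>}"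
  have cont: "continuous_on A (\<gamma> j)" if "j \<le> n" for j A
    using curve(4)[OF that] by (auto intro!: continuous_at_imp_continuous_on has_vector_derivative_continuous)
  have "compact F" unfolding F_def by (intro compact_Un compact_UN compact_continuous_image cont) (use i in auto)
  have "x \<notin> F"
  proof
    assume "x \<in> F"
    then have "(\<exists>j\<in>{..n} - {i}. \<exists>s\<in>{0..1}. x = \<gamma> j s) \<or> (\<exists>s\<in>{s0 + \<delta>..s0 + 1 - \<delta>}. x = \<gamma> i s)"
      unfolding F_def by blast
    then show False
    proof (elim disjE bexE)
      fix j s assume j: "j \<in> {..n} - {i}" "s \<in> {0..1}" "x = \<gamma> j s"
      have "x = \<gamma> i (frac s0)" using curve_of_int[OF i, of "frac s0" "\<lfloor>s0\<rfloor>"] by (simp add: frac_def x_def)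
      moreover have "frac s0 \<in> {0..1}" using frac_lt_1[of s0] by simp
      ultimately have "x \<in> path_image (\<gamma> i)" unfolding path_image_def by blast
      moreover have "x \<in> path_image (\<gamma> j)" using j unfolding path_image_def by blast
      moreover have "path_image (\<gamma> i) \<inter> path_image (\<gamma> j) = {}"
        using dom j i unfolding multiconnected_domain_def by blast
      ultimately show False by blast
    next
      fix s assume s: "s \<in> {s0 + \<delta>..s0 + 1 - \<delta>}" "x = \<gamma> i s"
      show False by (rule curve_injective[OF i, of s s0]) (use s d in \<open>auto simp: x_def\<close>)
    qed
  qed
  moreover have "open (- F)" using \<open>compact F\<close> by (simp add: compact_imp_closed open_Compl)
  ultimately obtain r0 where "r0 > 0" "ball x r0 \<subseteq> - F" by (meson ComplI openE)
  then have r0: "r0 > 0" "ball x r0 \<inter> F = {}" by blast+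
  have frF: "\<exists>s\<in>{s0 - \<delta>..s0 + \<delta>}. z = \<gamma> i s" if z: "z \<in> frontier D" "dist x z < r0" for z
  proof -
    have "z \<notin> F" using r0 z by auto
    obtain j s where j: "j \<le> n" and s: "s \<in> {0..1}" "z = \<gamma> j s" using z(1) unfolding fr by auto
    have "j = i"
    proof (rule ccontr)
      assume "j \<noteq> i"
      then have "z \<in> F" using j s unfolding F_def by blast
      then show False using \<open>z \<notin> F\<close> by blast
    qed
    \<comment> \<open>Moves the parameter by an integer into the period that starts at
      \<open>s0 - \<delta>\<close>.\<close>
    define m where "m = \<lfloor>s - (s0 - \<delta>)\<rfloor>"
    define s' where "s' = s + of_int (- m)"
    have s': "z = \<gamma> i s'" using curve_of_int[OF i, of s "- m"] s \<open>j = i\<close> by (simp add: s'_def)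
    have "s0 - \<delta> \<le> s'" "s' < s0 - \<delta> + 1" unfolding s'_def m_def by linarith+
    moreover have "s' \<notin> {s0 + \<delta>..s0 + 1 - \<delta>}" using \<open>z \<notin> F\<close> s' unfolding F_def by blast
    ultimately show ?thesis using s' by (intro bexI[of _ s']) auto
  qed
  define \<rho> where "\<rho> = min r r0"
  have \<rho>: "\<rho> > 0" "\<rho> \<le> r" "\<rho> \<le> r0" using r r0 by (auto simp: \<rho>_def)
  have xfr: "x \<in> frontier D" unfolding x_def by (rule curve_in_frontier[OF i])
  then have "x \<in> closure D" by (simp add: frontier_def)
  then obtain y0 where y0: "y0 \<in> D" "dist y0 x < \<rho> / 4" using \<rho> closure_approachable[of x D]
    by (meson divide_pos_pos zero_less_numeral)
  have y0f: "y0 \<notin> frontier D" using y0 D by (auto simp: frontier_def interior_open)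
  have inb: "dist x (y0 + \<tau> *\<^sub>R N) < 3 / 4 * \<rho>" if "\<bar>\<tau>\<bar> \<le> \<rho> / 2" for \<tau>
  proof -
    have "norm ((y0 - x) + \<tau> *\<^sub>R N) \<le> norm (y0 - x) + norm (\<tau> *\<^sub>R N)" by (rule norm_triangle_ineq)
    then show ?thesis using y0 that N by (simp add: dist_norm norm_minus_commute[of x] algebra_simps)
  qed
  \<comment> \<open>Along a normal line the product with \<open>T\<close> is constant, whereas it
    strictly increases along the arc; the line meets the arc at most once.\<close>
  have uniq: "\<tau>1 = \<tau>2" if t: "y0 + \<tau>1 *\<^sub>R N \<in> frontier D" "y0 + \<tau>2 *\<^sub>R N \<in> frontier D" "\<bar>\<tau>1\<bar> \<le> \<rho> / 2" "\<bar>\<tau>2\<bar> \<le> \<rho> / 2" for \<tau>1 \<tau>2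
  proof -
    obtain s1 where s1: "s1 \<in> {s0 - \<delta>..s0 + \<delta>}" "y0 + \<tau>1 *\<^sub>R N = \<gamma> i s1"
      using frF[OF t(1)] inb[OF t(3)] \<rho> by auto
    obtain s2 where s2: "s2 \<in> {s0 - \<delta>..s0 + \<delta>}" "y0 + \<tau>2 *\<^sub>R N = \<gamma> i s2"
      using frF[OF t(2)] inb[OF t(4)] \<rho> by auto
    have "\<gamma> i s1 \<bullet> T = \<gamma> i s2 \<bullet> T"
      unfolding s1(2)[symmetric] s2(2)[symmetric] using N by (simp add: inner_add_left)
    then have "s1 = s2" using mono[OF s1(1) s2(1)] mono[OF s2(1) s1(1)] by (cases s1 s2 rule: linorder_cases) auto
    then have "y0 + \<tau>1 *\<^sub>R N = y0 + \<tau>2 *\<^sub>R N" using s1(2) s2(2) by metis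
    then have "\<tau>1 *\<^sub>R N = \<tau>2 *\<^sub>R N" by (rule add_left_imp_eq)
    then show ?thesis using N by auto
  qed
  have "\<exists>\<sigma>. \<bar>\<sigma>\<bar> = 1 \<and> (\<forall>\<tau>. 0 \<le> \<tau> \<and> \<tau> \<le> \<rho> / 2 \<longrightarrow> y0 + (\<sigma> * \<tau>) *\<^sub>R N \<notin> frontier D)"
  proof (rule ccontr)
    assume neg: "\<not> ?thesis"
    from neg obtain \<tau>1 where t1: "0 \<le> \<tau>1" "\<tau>1 \<le> \<rho> / 2" "y0 + (1 * \<tau>1) *\<^sub>R N \<in> frontier D"
      by (metis abs_one)
    from neg obtain \<tau>2 where t2: "0 \<le> \<tau>2" "\<tau>2 \<le> \<rho> / 2" "y0 + ((-1) * \<tau>2) *\<^sub>R N \<in> frontier D"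
      by (metis abs_minus_cancel abs_one)
    \<comment> \<open>If both half lines hit the boundary, uniqueness puts the two hits at the
      common starting point \<open>y0\<close>, which belongs to the open set
      \<open>D\<close>.\<close>
    have "1 * \<tau>1 = (-1) * \<tau>2" by (rule uniq[OF t1(3) t2(3)]) (use t1 t2 in auto)
    then have "\<tau>1 = 0" using t1 t2 by simp
    then show False using t1 y0f by simp
  qed
  then obtain \<sigma> where \<sigma>: "\<bar>\<sigma>\<bar> = 1" "\<And>\<tau>. 0 \<le> \<tau> \<Longrightarrow> \<tau> \<le> \<rho> / 2 \<Longrightarrow> y0 + (\<sigma> * \<tau>) *\<^sub>R N \<notin> frontier D" by blast
  define seg where "seg = (\<lambda>\<tau>. y0 + (\<sigma> * \<tau>) *\<^sub>R N) ` {0..\<rho> / 2}"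
  have "connected seg" unfolding seg_def by (intro connected_continuous_image continuous_intros) auto
  moreover have "y0 \<in> seg" unfolding seg_def using \<rho> by (intro image_eqI[of _ _ 0]) auto
  moreover have "seg \<inter> frontier D = {}" using \<sigma> by (auto simp: seg_def)
  ultimately have segD: "seg \<subseteq> D" using connected_Int_frontier[of seg D] y0 by blast
  \<comment> \<open>\<open>y0\<close> is closer than \<open>\<rho> / 4\<close> to \<open>x\<close>
    and the move has length \<open>\<rho> / 2\<close>: the normal offset of \<open>y\<close> exceeds
    \<open>\<rho> / 4\<close>, its distance stays below \<open>3 / 4 * \<rho>\<close>.\<close>
  define y where "y = y0 + (\<sigma> * (\<rho> / 2)) *\<^sub>R N"
  have "y \<in> seg" unfolding seg_def y_def using \<rho> by (intro imageI) auto
  then have "y \<in> D" using segD by blast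
  moreover have dy: "dist x y < 3 / 4 * \<rho>" unfolding y_def by (rule inb) (use \<sigma> \<rho> in \<open>auto simp: abs_mult\<close>)
  moreover have "\<bar>(y - x) \<bullet> N\<bar> > \<rho> / 4"
  proof -
    have "N \<bullet> N = 1" using N by (simp add: norm_eq_sqrt_inner)
    then have e: "(y - x) \<bullet> N = (y0 - x) \<bullet> N + \<sigma> * (\<rho> / 2)"
      by (simp add: y_def inner_diff_left inner_add_left)
    have "\<bar>(y0 - x) \<bullet> N\<bar> < \<rho> / 4"
      using Cauchy_Schwarz_ineq2[of "y0 - x" N] y0 N by (simp add: dist_norm)
    moreover have "\<bar>\<sigma> * (\<rho> / 2)\<bar> = \<rho> / 2" using \<sigma> \<rho> by (simp add: abs_mult)
    ultimately show ?thesis unfolding e by linarith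
  qed
  ultimately show ?thesis using \<rho> unfolding x_def[symmetric]
    by (intro bexI[of _ y]) (auto simp: dist_norm norm_minus_commute)
qed

section \<open>Uniqueness of derivatives up to the boundary\<close>

lemma at_within_S: "x \<in> D \<Longrightarrow> at x within S = at x"
  using D(1) S(2) by (intro at_within_interior) (meson interior_maximal subsetD)

text \<open>At a boundary point two derivatives agree on the tangent by differentiating along the
  boundary curve, and on the normal by approaching through points of \<open>D\<close> whose offset
  has a normal part comparable to its length. Uniqueness is what makes
  \<open>frechet_derivative\<close>, defined by choice, obey the rules of calculus on the
  boundary.\<close>

lemma derivative_unique_within_closure:
  fixes f :: "real^2 \<Rightarrow> 'b::real_normed_vector"
  assumes x: "x \<in> S" and A: "(f has_derivative A) (at x within S)" and B: "(f has_derivative B) (at x within S)"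
  shows "A = B"
proof (cases "x \<in> D")
  case True
  then show ?thesis using A B at_within_S has_derivative_unique by auto
next
  case False
  then obtain i s0 where i: "i \<le> n" and xs: "x = \<gamma> i s0" using x S(3) fr by auto
  interpret A: bounded_linear A using A by (rule has_derivative_bounded_linear)
  interpret B: bounded_linear B using B by (rule has_derivative_bounded_linear)
  define T where "T = tangent i s0"
  define N where "N = (1 / norm T) *\<^sub>R perp T"
  have T: "T \<noteq> 0" using curve(3)[OF i] by (simp add: T_def)
  have along: "(f \<circ> \<gamma> i has_vector_derivative C T) (at s0)" if C: "(f has_derivative C) (at x within S)" for C
  proof -
    interpret C: bounded_linear C using C by (rule has_derivative_bounded_linear)
    have "(f has_derivative C) (at (\<gamma> i s0) within range (\<gamma> i))"
      using has_derivative_subset[OF C, of "range (\<gamma> i)"] curve_in_S[OF i] xs by auto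
    from has_derivative_in_compose[OF curve(4)[OF i, of s0, unfolded has_vector_derivative_def] this]
    show ?thesis unfolding has_vector_derivative_def by (simp add: o_def C.scaleR T_def)
  qed
  have AT: "A T = B T" using along[OF A] along[OF B] vector_derivative_unique_at by blast
  define P where "P = perp T"
  have nT: "T \<bullet> T = norm T * norm T" "norm T > 0" "T \<bullet> T \<noteq> 0" using T by (auto simp: norm_eq_sqrt_inner)
  have dec: "(T \<bullet> T) *\<^sub>R z = (z \<bullet> T) *\<^sub>R T + (z \<bullet> P) *\<^sub>R P" for z
    by (simp add: vec2_eq_iff inner_vec2 P_def algebra_simps)
  have diff: "(T \<bullet> T) *\<^sub>R (A z - B z) = (z \<bullet> P) *\<^sub>R (A P - B P)" for z
  proof -
    have "(T \<bullet> T) *\<^sub>R (A z - B z) = A ((T \<bullet> T) *\<^sub>R z) - B ((T \<bullet> T) *\<^sub>R z)"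
      by (simp only: A.scaleR B.scaleR scaleR_diff_right)
    also have "\<dots> = (z \<bullet> P) *\<^sub>R (A P - B P)"
      unfolding dec by (simp only: A.add B.add A.scaleR B.scaleR AT) (simp add: algebra_simps)
    finally show ?thesis .
  qed
  have AP: "A P = B P"
  proof (rule ccontr)
    assume "A P \<noteq> B P"
    \<comment> \<open>Size of the disagreement in the unit normal direction. Two approximation
      errors of \<open>c / 16\<close> give \<open>c / 8\<close>, less than the \<open>c / 4\<close>
      that the nontangential approach forces.\<close>
    define c where "c = norm (A P - B P) / norm T"
    have c: "c > 0" using \<open>A P \<noteq> B P\<close> nT by (simp add: c_def)
    have ex: "\<exists>d>0. \<forall>y\<in>S. norm (y - x) < d \<longrightarrow> norm (f y - f x - C (y - x)) \<le> c / 16 * norm (y - x)"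
      if "(f has_derivative C) (at x within S)" for C
    proof -
      have "\<forall>e>0. \<exists>d>0. \<forall>y\<in>S. norm (y - x) < d \<longrightarrow> norm (f y - f x - C (y - x)) \<le> e * norm (y - x)"
        using that[unfolded has_derivative_within_alt] by (rule conjunct2)
      from this[THEN spec, THEN mp, of "c / 16"] c show ?thesis by simp
    qed
    obtain d1 where d1: "d1 > 0" "\<And>y. y \<in> S \<Longrightarrow> norm (y - x) < d1 \<Longrightarrow> norm (f y - f x - A (y - x)) \<le> c / 16 * norm (y - x)"
      using ex[OF A] by blast
    obtain d2 where d2: "d2 > 0" "\<And>y. y \<in> S \<Longrightarrow> norm (y - x) < d2 \<Longrightarrow> norm (f y - f x - B (y - x)) \<le> c / 16 * norm (y - x)"
      using ex[OF B] by blast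
    obtain y where y: "y \<in> D" "dist y x < min d1 d2" "\<bar>(y - x) \<bullet> N\<bar> > 1 / 4 * norm (y - x)"
      using nontangential_approach[OF i, of "min d1 d2" s0] d1(1) d2(1) unfolding xs N_def T_def by auto
    have "norm (A (y - x) - B (y - x)) \<le> norm (f y - f x - B (y - x)) + norm (f y - f x - A (y - x))"
      using norm_triangle_ineq4[of "f y - f x - B (y - x)" "f y - f x - A (y - x)"] by simp
    also have "\<dots> \<le> c / 16 * norm (y - x) + c / 16 * norm (y - x)"
      by (intro add_mono d1 d2) (use y S in \<open>auto simp: dist_norm\<close>)
    finally have le: "norm (A (y - x) - B (y - x)) \<le> c / 8 * norm (y - x)" by simp
    have "norm ((T \<bullet> T) *\<^sub>R (A (y - x) - B (y - x))) = norm (((y - x) \<bullet> P) *\<^sub>R (A P - B P))"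
      unfolding diff ..
    then have "norm T * norm T * norm (A (y - x) - B (y - x)) = \<bar>(y - x) \<bullet> P\<bar> * norm (A P - B P)"
      by (simp add: nT(1))
    also have "\<dots> = norm T * norm T * (\<bar>(y - x) \<bullet> N\<bar> * c)"
      using nT by (simp add: c_def N_def P_def abs_mult)
    finally have "norm (A (y - x) - B (y - x)) = \<bar>(y - x) \<bullet> N\<bar> * c" using nT by simp
    then have "\<bar>(y - x) \<bullet> N\<bar> * c \<le> (norm (y - x) / 8) * c" using le by (simp add: mult.commute)
    then have "\<bar>(y - x) \<bullet> N\<bar> \<le> norm (y - x) / 8" using c by simp
    then show False using y(3) norm_ge_zero[of "y - x"] by linarith
  qed
  show ?thesis
  proof
    fix z
    show "A z = B z" using diff[of z] AP nT by simp
  qed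
qed

lemma pd_eqI:
  assumes "x \<in> S" "(f has_derivative f') (at x within S)"
  shows "pd S i f x = f' (axis i 1)"
proof -
  have "(f has_derivative frechet_derivative f (at x within S)) (at x within S)"
    using assms(2) differentiableI frechet_derivative_works by blast
  from derivative_unique_within_closure[OF assms(1) this assms(2)] show ?thesis by (simp add: pd_def)
qed

lemma frechet_works:
  "f differentiable (at x within S) \<Longrightarrow> (f has_derivative frechet_derivative f (at x within S)) (at x within S)"
  using frechet_derivative_works by blast

lemma pd_diff:
  "x \<in> S \<Longrightarrow> f differentiable (at x within S) \<Longrightarrow> g differentiable (at x within S) \<Longrightarrow>
    pd S i (\<lambda>x. f x - g x) x = pd S i f x - pd S i g x"
  by (subst pd_eqI[OF _ has_derivative_diff[OF frechet_works frechet_works]]) (auto simp: pd_def)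

lemma pd_scaleR:
  "x \<in> S \<Longrightarrow> f differentiable (at x within S) \<Longrightarrow> pd S i (\<lambda>x. c *\<^sub>R f x) x = c *\<^sub>R pd S i f x"
  by (subst pd_eqI[OF _ has_derivative_scaleR_right[OF frechet_works]]) (auto simp: pd_def)

lemma has_pderiv_pd:
  fixes f :: "real^2 \<Rightarrow> real"
  assumes "x \<in> D" "f differentiable (at x within S)"
  shows "has_pderiv f i (pd S i f x) x"
  unfolding pd_def using has_pderiv_of_derivative frechet_works[OF assms(2)] at_within_S[OF assms(1)] by metis

lemma has_pderiv_pd_component:
  fixes f :: "real^2 \<Rightarrow> real^2"
  assumes "x \<in> D" "f differentiable (at x within S)"
  shows "has_pderiv (\<lambda>x. f x $ j) i (pd S i f x $ j) x"
proof -
  have "((\<lambda>x. f x $ j) has_derivative (\<lambda>h. frechet_derivative f (at x within S) h $ j)) (at x)"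
    using bounded_linear.has_derivative[OF bounded_linear_vec_nth frechet_works[OF assms(2)]] at_within_S[OF assms(1)] by simp
  from has_pderiv_of_derivative[OF this] show ?thesis unfolding pd_def .
qed

section \<open>Tangential fields and integration by parts\<close>

lemma tangential:
  assumes i: "i \<le> n" and "X \<bullet> outer_normal D (\<gamma> i) s = 0"
  shows "\<exists>c. X = c *\<^sub>R tangent i s"
proof (rule orthogonal_perp_imp_parallel)
  have "outer_normal D (\<gamma> i) s = (1 / norm (tangent i s)) *\<^sub>R perp (tangent i s) \<or>
      outer_normal D (\<gamma> i) s = - ((1 / norm (tangent i s)) *\<^sub>R perp (tangent i s))"
    by (auto simp: outer_normal_def tangent_def perp_def Let_def)
  then show "X \<bullet> perp (tangent i s) = 0" using assms curve(3)[OF i, of s] by auto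
qed (rule curve(3)[OF i])

lemma domain_cutoff:
  fixes X :: "real \<Rightarrow> real^2 \<Rightarrow> real^2"
  assumes "compact J" "continuous_on (J \<times> S) (\<lambda>(t, x). X t x)"
    and "\<And>t i s. t \<in> J \<Longrightarrow> i \<le> n \<Longrightarrow> X t (\<gamma> i s) \<bullet> outer_normal D (\<gamma> i) s = 0" and "e > 0"
  shows "\<exists>\<eta> g. test_fun D \<eta> g \<and> (\<forall>x. 0 \<le> \<eta> x \<and> \<eta> x \<le> 1) \<and> (LINT x:D|lborel. 1 - \<eta> x) \<le> e \<and>
    (\<forall>t\<in>J. (LINT x:D|lborel. \<bar>X t x \<bullet> g x\<bar>) \<le> e)"
  by (rule cutoff[where \<gamma>=\<gamma> and n=n and \<gamma>'=tangent and \<gamma>''="\<lambda>i s. vector_derivative (tangent i) (at s)"])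
    (use assms D fr curve tangential in \<open>auto simp: S_def\<close>)

lemma set_integrable_S: "continuous_on S f \<Longrightarrow> set_integrable lborel D f" for f :: "real^2 \<Rightarrow> real"
  unfolding S_def by (rule set_integrable_continuous_closure[OF D])

lemma continuous_S_bounded:
  fixes f :: "real^2 \<Rightarrow> 'b::real_normed_vector"
  assumes "continuous_on S f"
  obtains B where "B \<ge> 0" "\<And>x. x \<in> S \<Longrightarrow> norm (f x) \<le> B"
proof -
  have "compact (f ` S)" using assms S by (intro compact_continuous_image)
  then obtain B where "B > 0" "\<forall>y\<in>f ` S. norm y \<le> B" using compact_imp_bounded bounded_pos by metis
  then show ?thesis by (intro that[of B]) auto
qed

text \<open>The divergence theorem with vanishing boundary term. A cutoff splits the integral into
  the part weighted by \<open>1 - \<eta>\<close>, small in measure, and minus the integral of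
  \<open>X x \<bullet> g x\<close>, small because \<open>X\<close> is tangential.\<close>

lemma zero_flux:
  fixes X :: "real^2 \<Rightarrow> real^2"
  assumes X: "continuous_on S X" and h: "\<And>i. continuous_on S (h i)"
    and der: "\<And>x i. x \<in> D \<Longrightarrow> has_pderiv (\<lambda>x. X x $ i) i (h i x) x"
    and tangent: "\<And>i s. i \<le> n \<Longrightarrow> X (\<gamma> i s) \<bullet> outer_normal D (\<gamma> i) s = 0"
  shows "(LINT x:D|lborel. h 1 x + h 2 x) = 0"
proof -
  have hc: "continuous_on S (\<lambda>x. h 1 x + h 2 x)" by (intro continuous_intros h)
  obtain B where B: "B \<ge> 0" "\<And>x. x \<in> S \<Longrightarrow> norm (h 1 x + h 2 x) \<le> B" using continuous_S_bounded[OF hc] by blast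
  have est: "\<bar>LINT x:D|lborel. h 1 x + h 2 x\<bar> \<le> (1 + B) * e" if e: "e > 0" for e
  proof -
    have "continuous_on ({0::real} \<times> S) (\<lambda>(t, x). X x)"
      unfolding case_prod_beta by (rule continuous_on_compose2[OF X]) (auto intro!: continuous_intros)
    then obtain \<eta> g where \<eta>: "test_fun D \<eta> g" "\<And>x. 0 \<le> \<eta> x" "\<And>x. \<eta> x \<le> 1" "(LINT x:D|lborel. 1 - \<eta> x) \<le> e"
        "(LINT x:D|lborel. \<bar>X x \<bullet> g x\<bar>) \<le> e"
      using domain_cutoff[of "{0}" "\<lambda>t. X" e] tangent e by auto
    have \<eta>c: "continuous_on A \<eta>" and gc: "continuous_on A g" for A
      by (rule test_fun_continuous[OF \<eta>(1)])+
    have one: "(LINT x:D|lborel. g x $ i * X x $ i + \<eta> x * h i x) = 0" for i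
      by (rule test_fun_integral_pderiv[OF D(1) \<eta>(1)])
        (use X h der continuous_on_subset[OF _ S(2)] in \<open>auto intro!: continuous_intros\<close>)
    have i1: "set_integrable lborel D (\<lambda>x. g x $ i * X x $ i + \<eta> x * h i x)" for i
      by (intro set_integrable_S continuous_intros \<eta>c gc X h)
    have i2: "set_integrable lborel D (\<lambda>x. (1 - \<eta> x) * (h 1 x + h 2 x))"
      by (intro set_integrable_S continuous_intros \<eta>c gc X h)
    have i3: "set_integrable lborel D (\<lambda>x. X x \<bullet> g x)" "set_integrable lborel D (\<lambda>x. \<bar>X x \<bullet> g x\<bar>)"
      by (intro set_integrable_S continuous_intros \<eta>c gc X h)+
    have i4: "set_integrable lborel D (\<lambda>x. B * (1 - \<eta> x))"
      by (intro set_integrable_S continuous_intros \<eta>c gc X h)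
    have "(LINT x:D|lborel. h 1 x + h 2 x) = (LINT x:D|lborel. ((1 - \<eta> x) * (h 1 x + h 2 x) +
        ((g x $ 1 * X x $ 1 + \<eta> x * h 1 x) + (g x $ 2 * X x $ 2 + \<eta> x * h 2 x))) - X x \<bullet> g x)"
      by (rule arg_cong[where f="set_lebesgue_integral lborel D"]) (auto simp: inner_vec2 algebra_simps)
    also have "\<dots> = (LINT x:D|lborel. (1 - \<eta> x) * (h 1 x + h 2 x)) - (LINT x:D|lborel. X x \<bullet> g x)"
      using one by (simp add: set_integral_diff(2)[OF set_integral_add(1)[OF i2 set_integral_add(1)[OF i1 i1]] i3(1)]
          set_integral_add(2)[OF i2 set_integral_add(1)[OF i1 i1]] set_integral_add(2)[OF i1 i1])
    finally have "\<bar>LINT x:D|lborel. h 1 x + h 2 x\<bar> \<le> \<bar>LINT x:D|lborel. (1 - \<eta> x) * (h 1 x + h 2 x)\<bar> + \<bar>LINT x:D|lborel. X x \<bullet> g x\<bar>"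
      by simp
    moreover have "\<bar>LINT x:D|lborel. X x \<bullet> g x\<bar> \<le> e"
      using set_integral_abs_le_integral[OF i3(1) i3(2)] \<eta>(5) by force
    moreover have "\<bar>LINT x:D|lborel. (1 - \<eta> x) * (h 1 x + h 2 x)\<bar> \<le> B * e"
    proof -
      have "\<bar>LINT x:D|lborel. (1 - \<eta> x) * (h 1 x + h 2 x)\<bar> \<le> (LINT x:D|lborel. B * (1 - \<eta> x))"
      proof (rule set_integral_abs_le_integral[OF i2 i4])
        show "\<bar>(1 - \<eta> x) * (h 1 x + h 2 x)\<bar> \<le> B * (1 - \<eta> x)" if "x \<in> D" for x
          using B(2)[of x] that S(2) \<eta>(3)[of x] unfolding abs_mult mult.commute[of B]
          by (intro mult_mono) auto
      qed
      also have "\<dots> = B * (LINT x:D|lborel. 1 - \<eta> x)" by (rule set_integral_mult_right)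
      also have "\<dots> \<le> B * e" using \<eta>(4) B by (simp add: mult_left_mono)
      finally show ?thesis .
    qed
    ultimately show ?thesis by (simp add: algebra_simps)
  qed
  show ?thesis by (rule abs_le_mult_eps_imp_zero[OF _ est]) (use B in simp_all)
qed

end


section \<open>Green identity\<close>

lemma pd_cong_on:
  assumes "x \<in> S" "\<And>y. y \<in> S \<Longrightarrow> f y = g y"
  shows "pd S i f x = pd S i g x"
proof -
  have "(f has_derivative f') (at x within S) \<longleftrightarrow> (g has_derivative f') (at x within S)" for f'
    using has_derivative_transform[OF assms(1), of f g f'] has_derivative_transform[OF assms(1), of g f f'] assms(2) by auto
  then show ?thesis by (simp add: pd_def frechet_derivative_def)
qed

lemma C_space_cong:
  "(\<And>t x. t \<in> I \<Longrightarrow> x \<in> S \<Longrightarrow> f t x = g t x) \<Longrightarrow> C_space k I S f \<Longrightarrow> C_space k I S g"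
proof (induction k arbitrary: f g)
  case 0
  then show ?case by (auto intro: continuous_on_eq)
next
  case (Suc k)
  have "continuous_on (I \<times> S) (\<lambda>(t, x). g t x)"
    by (rule continuous_on_eq[of _ "\<lambda>(t, x). f t x"]) (use Suc.prems in auto)
  moreover have "g t differentiable_on S" if t: "t \<in> I" for t
  proof -
    have "f t differentiable_on S" using Suc.prems(2) t by auto
    then show ?thesis
      unfolding differentiable_on_def using Suc.prems(1)[OF t]
      by (meson differentiable_transform_within zero_less_one)
  qed
  moreover have "C_space k I S (\<lambda>t. pd S i (g t))" for i
  proof (rule Suc.IH[of "\<lambda>t. pd S i (f t)"])
    show "pd S i (f t) x = pd S i (g t) x" if "t \<in> I" "x \<in> S" for t x
      by (rule pd_cong_on[OF that(2)]) (rule Suc.prems(1)[OF that(1)])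
  qed (use Suc.prems in auto)
  ultimately show ?case by simp
qed

lemma C_space_cont: "C_space k I S f \<Longrightarrow> continuous_on (I \<times> S) (\<lambda>(t, x). f t x)"
  by (cases k) auto

lemma C_space_differentiable: "C_space (Suc k) I S f \<Longrightarrow> t \<in> I \<Longrightarrow> x \<in> S \<Longrightarrow> f t differentiable (at x within S)"
  by (auto simp: differentiable_on_def)

lemma C_space_pd: "C_space (Suc k) I S f \<Longrightarrow> C_space k I S (\<lambda>t. pd S i (f t))"
  by auto

lemma C_space_Suc_imp: "C_space (Suc k) I S f \<Longrightarrow> C_space k I S f"
proof (induction k arbitrary: f)
  case (Suc k)
  have "C_space k I S (\<lambda>t. pd S i (f t))" for i
    by (rule Suc.IH) (rule C_space_pd[OF Suc.prems])
  then show ?case using Suc.prems by auto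
qed auto

lemma C_space_static: "C_space k I S f \<Longrightarrow> t \<in> I \<Longrightarrow> C_space k UNIV S (\<lambda>_. f t)"
proof (induction k arbitrary: f)
  case 0
  have "continuous_on S (f t)" by (rule continuous_on_time_section) (use 0 in auto)
  from continuous_on_compose2[OF this continuous_on_snd[OF continuous_on_id], of "UNIV \<times> S"]
  show ?case by (auto simp: case_prod_beta)
next
  case (Suc k)
  have "continuous_on S (f t)" by (rule continuous_on_time_section) (use Suc in auto)
  from continuous_on_compose2[OF this continuous_on_snd[OF continuous_on_id], of "UNIV \<times> S"]
  have "continuous_on (UNIV \<times> S) (\<lambda>(s, x). f t x)" by (auto simp: case_prod_beta)
  moreover have "C_space k UNIV S (\<lambda>_. pd S i (f t))" for i
    by (rule Suc.IH[of "\<lambda>t. pd S i (f t)"]) (use Suc.prems in auto)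
  ultimately show ?case using Suc.prems by auto
qed

context domain
begin

lemma C_space_diff_scaleR:
  "C_space k I S f \<Longrightarrow> C_space k I S g \<Longrightarrow> C_space k I S (\<lambda>t x. f t x - c *\<^sub>R g t x)"
proof (induction k arbitrary: f g)
  case 0
  then show ?case by (auto simp: case_prod_beta intro!: continuous_intros)
next
  case (Suc k)
  have "continuous_on (I \<times> S) (\<lambda>(t, x). f t x - c *\<^sub>R g t x)"
    using Suc.prems by (auto simp: case_prod_beta intro!: continuous_intros)
  moreover have "(\<lambda>x. f t x - c *\<^sub>R g t x) differentiable_on S" if "t \<in> I" for t
    using Suc.prems that by (auto simp: differentiable_on_def intro!: differentiable_diff differentiable_scaleR differentiable_const)
  moreover have "C_space k I S (\<lambda>t. pd S i (\<lambda>x. f t x - c *\<^sub>R g t x))" for i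
  proof (rule C_space_cong)
    show "C_space k I S (\<lambda>t x. pd S i (f t) x - c *\<^sub>R pd S i (g t) x)"
      by (rule Suc.IH; rule C_space_pd; rule Suc.prems)
    fix t x assume tx: "t \<in> I" "x \<in> S"
    have df: "f t differentiable (at x within S)" "g t differentiable (at x within S)"
      using C_space_differentiable[OF Suc.prems(1) tx] C_space_differentiable[OF Suc.prems(2) tx] by auto
    show "pd S i (f t) x - c *\<^sub>R pd S i (g t) x = pd S i (\<lambda>x. f t x - c *\<^sub>R g t x) x"
      using df tx by (subst pd_diff) (auto simp: pd_scaleR intro!: differentiable_scaleR differentiable_const)
  qed
  ultimately show ?case by simp
qed

text \<open>The class of velocity fields at a fixed time for which the Green identity holds. The
  boundary conditions are linear, so it is closed under differences and contains the perturbation;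
  the dummy time allows \<open>C_space\<close> to be reused.\<close>

definition admissible :: "(real^2 \<Rightarrow> real^2) \<Rightarrow> bool" where
  "admissible a \<longleftrightarrow> C_space 2 UNIV S (\<lambda>_::real. a) \<and> alpha_euler_boundary D n \<gamma> a"

lemma admissible_props:
  assumes "admissible a"
  shows "continuous_on S a" "continuous_on S (pd S i a)" "continuous_on S (pd S j (pd S i a))"
    "x \<in> S \<Longrightarrow> a differentiable (at x within S)" "x \<in> S \<Longrightarrow> pd S i a differentiable (at x within S)"
proof -
  have 2: "C_space (Suc (Suc 0)) UNIV S (\<lambda>_::real. a)" using assms by (simp add: admissible_def numeral_2_eq_2)
  note 1 = C_space_pd[OF 2, of i] and 0 = C_space_pd[OF C_space_pd[OF 2, of i], of j]
  show "continuous_on S a" "continuous_on S (pd S i a)" "continuous_on S (pd S j (pd S i a))"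
    using continuous_on_time_section[OF C_space_cont[OF 2], of 0 S] continuous_on_time_section[OF C_space_cont[OF 1], of 0 S]
      continuous_on_time_section[OF C_space_cont[OF 0], of 0 S] by auto
  show "x \<in> S \<Longrightarrow> a differentiable (at x within S)" "x \<in> S \<Longrightarrow> pd S i a differentiable (at x within S)"
    using C_space_differentiable[OF 2, of 0 x] C_space_differentiable[OF 1, of 0 x] by auto
qed

lemma boundary_tangential: "alpha_euler_boundary D n \<gamma> a \<Longrightarrow> i \<le> n \<Longrightarrow> a (\<gamma> i s) \<bullet> outer_normal D (\<gamma> i) s = 0"
  by (auto simp: alpha_euler_boundary_def Let_def)

lemma jacobi_mult: "jacobi S v x *v z = z $ 1 *\<^sub>R pd S 1 v x + z $ 2 *\<^sub>R pd S 2 v x"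
  by (simp add: vec_eq_iff jacobi_def matrix_vector_mult_def sum_2 mult.commute)

lemma boundary_normal_derivative:
  assumes "alpha_euler_boundary D n \<gamma> a" "i \<le> n"
  obtains c where "outer_normal D (\<gamma> i) s $ 1 *\<^sub>R pd S 1 a (\<gamma> i s) + outer_normal D (\<gamma> i) s $ 2 *\<^sub>R pd S 2 a (\<gamma> i s)
    = c *\<^sub>R outer_normal D (\<gamma> i) s"
  using assms jacobi_mult[of a "\<gamma> i s" "outer_normal D (\<gamma> i) s"]
  unfolding alpha_euler_boundary_def Let_def S_def by metis

lemma admissible_diff:
  assumes a: "admissible a" and b: "admissible b"
  shows "admissible (\<lambda>x. a x - b x)"
  unfolding admissible_def
proof
  show "C_space 2 UNIV S (\<lambda>_::real. \<lambda>x. a x - b x)"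
    using C_space_diff_scaleR[of 2 UNIV "\<lambda>_. a" "\<lambda>_. b" 1] a b by (simp add: admissible_def)
  have ab: "alpha_euler_boundary D n \<gamma> a" "alpha_euler_boundary D n \<gamma> b" using a b by (auto simp: admissible_def)
  show "alpha_euler_boundary D n \<gamma> (\<lambda>x. a x - b x)"
    unfolding alpha_euler_boundary_def Let_def S_def[symmetric]
  proof (intro allI impI conjI)
    fix i s assume i: "i \<le> n"
    show "(a (\<gamma> i s) - b (\<gamma> i s)) \<bullet> outer_normal D (\<gamma> i) s = 0"
      using boundary_tangential[OF ab(1) i] boundary_tangential[OF ab(2) i] by (simp add: inner_diff_left)
    define \<nu> where "\<nu> = outer_normal D (\<gamma> i) s"
    obtain c where c: "\<nu> $ 1 *\<^sub>R pd S 1 a (\<gamma> i s) + \<nu> $ 2 *\<^sub>R pd S 2 a (\<gamma> i s) = c *\<^sub>R \<nu>"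
      unfolding \<nu>_def by (rule boundary_normal_derivative[OF ab(1) i])
    obtain d where d: "\<nu> $ 1 *\<^sub>R pd S 1 b (\<gamma> i s) + \<nu> $ 2 *\<^sub>R pd S 2 b (\<gamma> i s) = d *\<^sub>R \<nu>"
      unfolding \<nu>_def by (rule boundary_normal_derivative[OF ab(2) i])
    have pdd: "pd S k (\<lambda>x. a x - b x) (\<gamma> i s) = pd S k a (\<gamma> i s) - pd S k b (\<gamma> i s)" for k
      using curve_in_S[OF i] admissible_props(4)[OF a] admissible_props(4)[OF b] by (intro pd_diff) auto
    have "jacobi S (\<lambda>x. a x - b x) (\<gamma> i s) *v \<nu>
       = (\<nu> $ 1 *\<^sub>R pd S 1 a (\<gamma> i s) + \<nu> $ 2 *\<^sub>R pd S 2 a (\<gamma> i s)) - (\<nu> $ 1 *\<^sub>R pd S 1 b (\<gamma> i s) + \<nu> $ 2 *\<^sub>R pd S 2 b (\<gamma> i s))"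
      unfolding jacobi_mult pdd by (simp add: algebra_simps)
    also have "\<dots> = (c - d) *\<^sub>R \<nu>" unfolding c d by (simp add: scaleR_diff_left)
    finally show "\<exists>c. jacobi S (\<lambda>x. a x - b x) (\<gamma> i s) *v outer_normal D (\<gamma> i) s = c *\<^sub>R outer_normal D (\<gamma> i) s"
      unfolding \<nu>_def by blast
  qed
qed

lemma laplacian_eq: "laplacian S v x = pd S 1 (pd S 1 v) x + pd S 2 (pd S 2 v) x"
  by (simp add: laplacian_def sum_2)

definition energy_density :: "real \<Rightarrow> (real^2 \<Rightarrow> real^2) \<Rightarrow> (real^2 \<Rightarrow> real^2) \<Rightarrow> real^2 \<Rightarrow> real" where
  "energy_density \<alpha> a b x = a x \<bullet> b x + \<alpha>\<^sup>2 * (pd S 1 a x \<bullet> pd S 1 b x + pd S 2 a x \<bullet> pd S 2 b x)"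

text \<open>The boundary term belongs to the field with components
  \<open>a x \<bullet> pd S i b x\<close>. Its normal component is the product of \<open>a\<close>
  with the normal derivative of \<open>b\<close>; the latter is parallel to the normal and
  \<open>a\<close> is tangential, so \<open>zero_flux\<close> applies.\<close>

lemma Green_identity:
  assumes a: "admissible a" and b: "admissible b"
  shows "(LINT x:D|lborel. a x \<bullet> helmholtz \<alpha> S b x) = (LINT x:D|lborel. energy_density \<alpha> a b x)"
proof -
  note A = admissible_props[OF a] and B = admissible_props[OF b]
  define h where "h i x = pd S i a x \<bullet> pd S i b x + a x \<bullet> pd S i (pd S i b) x" for i x
  have hc: "continuous_on S (h i)" for i unfolding h_def by (intro continuous_intros A B)
  define X where "X x = (vector [a x \<bullet> pd S 1 b x, a x \<bullet> pd S 2 b x] :: real^2)" for x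
  have Xi: "X x $ i = a x \<bullet> pd S i b x" for x i
    using exhaust_2[of i] by (auto simp: X_def)
  have z: "(LINT x:D|lborel. h 1 x + h 2 x) = 0"
  proof (rule zero_flux[of X h, OF _ hc])
    have "X = (\<lambda>x. \<chi> i. a x \<bullet> pd S i b x)" by (simp add: fun_eq_iff vec_eq_iff Xi)
    then show "continuous_on S X" by (simp only:) (intro continuous_on_vec_lambda continuous_intros A B)
    fix x i assume x: "x \<in> D"
    then have xS: "x \<in> S" using S by auto
    have "has_pderiv (\<lambda>x. a x $ 1 * pd S i b x $ 1 + a x $ 2 * pd S i b x $ 2) i
       ((pd S i a x $ 1 * pd S i b x $ 1 + a x $ 1 * pd S i (pd S i b) x $ 1) + (pd S i a x $ 2 * pd S i b x $ 2 + a x $ 2 * pd S i (pd S i b) x $ 2)) x"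
      by (intro has_pderiv_add has_pderiv_mult has_pderiv_pd_component x A(4)[OF xS] B(5)[OF xS])
    then show "has_pderiv (\<lambda>x. X x $ i) i (h i x) x" unfolding Xi h_def inner_vec2 by (simp add: algebra_simps)
  next
    fix i s assume i: "i \<le> n"
    have bb: "alpha_euler_boundary D n \<gamma> b" "alpha_euler_boundary D n \<gamma> a" using a b by (auto simp: admissible_def)
    obtain c where c: "outer_normal D (\<gamma> i) s $ 1 *\<^sub>R pd S 1 b (\<gamma> i s) + outer_normal D (\<gamma> i) s $ 2 *\<^sub>R pd S 2 b (\<gamma> i s)
      = c *\<^sub>R outer_normal D (\<gamma> i) s" by (rule boundary_normal_derivative[OF bb(1) i])
    have "X (\<gamma> i s) \<bullet> outer_normal D (\<gamma> i) s
      = a (\<gamma> i s) \<bullet> (outer_normal D (\<gamma> i) s $ 1 *\<^sub>R pd S 1 b (\<gamma> i s) + outer_normal D (\<gamma> i) s $ 2 *\<^sub>R pd S 2 b (\<gamma> i s))"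
      unfolding inner_vec2[of "X _"] Xi by (simp add: inner_add_right)
    then show "X (\<gamma> i s) \<bullet> outer_normal D (\<gamma> i) s = 0"
      unfolding c using boundary_tangential[OF bb(2) i] by simp
  qed
  have i1: "set_integrable lborel D (energy_density \<alpha> a b)"
    unfolding energy_density_def[abs_def] by (intro set_integrable_S continuous_intros A B)
  have i2: "set_integrable lborel D (\<lambda>x. \<alpha>\<^sup>2 * (h 1 x + h 2 x))"
    by (intro set_integrable_S continuous_intros hc)
  have "(LINT x:D|lborel. a x \<bullet> helmholtz \<alpha> S b x) = (LINT x:D|lborel. energy_density \<alpha> a b x - \<alpha>\<^sup>2 * (h 1 x + h 2 x))"
    by (rule arg_cong[where f="set_lebesgue_integral lborel D"])
      (auto simp: fun_eq_iff helmholtz_def laplacian_eq energy_density_def h_def inner_diff_right inner_add_right algebra_simps)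
  also have "\<dots> = (LINT x:D|lborel. energy_density \<alpha> a b x)"
    using z by (simp add: set_integral_diff(2)[OF i1 i2])
  finally show ?thesis .
qed

lemma helmholtz_diff:
  assumes "C_space 2 UNIV S (\<lambda>_::real. a)" "C_space 2 UNIV S (\<lambda>_::real. b)" "x \<in> S"
  shows "helmholtz \<alpha> S (\<lambda>x. a x - b x) x = helmholtz \<alpha> S a x - helmholtz \<alpha> S b x"
proof -
  have d: "f differentiable (at y within S)" "pd S i f differentiable (at y within S)"
    if "C_space 2 UNIV S (\<lambda>_::real. f)" "y \<in> S" for f :: "real^2 \<Rightarrow> real^2" and i y
    using C_space_differentiable[of "Suc 0" UNIV S "\<lambda>_. f" 0 y]
      C_space_differentiable[of 0 UNIV S "\<lambda>_. pd S i f" 0 y] that by (auto simp: numeral_2_eq_2)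
  have 1: "pd S i (\<lambda>x. a x - b x) y = pd S i a y - pd S i b y" if "y \<in> S" for i y
    by (intro pd_diff d assms that)
  have 2: "pd S i (pd S i (\<lambda>x. a x - b x)) x = pd S i (pd S i a) x - pd S i (pd S i b) x" for i
    using pd_cong_on[OF assms(3) 1, where i=i] pd_diff[OF assms(3) d(2)[OF assms(1,3), where i=i] d(2)[OF assms(2,3), where i=i], where i=i]
    by simp
  show ?thesis unfolding helmholtz_def laplacian_eq 2 by (simp add: algebra_simps)
qed

lemma helmholtz_C_space:
  assumes "C_space 3 I S v"
  shows "C_space 1 I S (\<lambda>t. helmholtz \<alpha> S (v t))"
proof -
  have 3: "C_space (Suc (Suc (Suc 0))) I S v" using assms by (simp add: numeral_3_eq_3)
  have "C_space (Suc 0) I S (\<lambda>t x. (v t x - \<alpha>\<^sup>2 *\<^sub>R pd S 1 (pd S 1 (v t)) x) - \<alpha>\<^sup>2 *\<^sub>R pd S 2 (pd S 2 (v t)) x)"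
    by (intro C_space_diff_scaleR C_space_pd 3 C_space_Suc_imp[OF C_space_Suc_imp[OF 3]])
  then show ?thesis
    by (simp add: helmholtz_def[abs_def] laplacian_eq[abs_def] algebra_simps)
qed

lemma vorticity_continuous:
  assumes "C_space 3 I S v"
  shows "continuous_on (I \<times> S) (\<lambda>(t, x). vorticity \<alpha> S (v t) x)"
proof -
  have "C_space (Suc 0) I S (\<lambda>t. helmholtz \<alpha> S (v t))" using helmholtz_C_space[OF assms] by simp
  from C_space_cont[OF C_space_pd[OF this]]
  show ?thesis unfolding vorticity_def curl_def
    by (auto simp: case_prod_beta intro!: continuous_intros)
qed

lemma L2_norm_grad_square:
  assumes a: "admissible a"
  shows "(L2_norm_grad D a)\<^sup>2 = (LINT x:D|lborel. pd S 1 a x \<bullet> pd S 1 a x + pd S 2 a x \<bullet> pd S 2 a x)"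
proof -
  have e: "trace (jacobi S a x ** transpose (jacobi S a x)) = pd S 1 a x \<bullet> pd S 1 a x + pd S 2 a x \<bullet> pd S 2 a x" for x
    by (simp add: trace_def matrix_matrix_mult_def transpose_def jacobi_def sum_2 inner_vec2 algebra_simps)
  have "0 \<le> (LINT x:D|lborel. pd S 1 a x \<bullet> pd S 1 a x + pd S 2 a x \<bullet> pd S 2 a x)"
    unfolding set_lebesgue_integral_def by (intro integral_nonneg_AE AE_I2) (auto simp: indicator_def)
  then show ?thesis unfolding L2_norm_grad_def S_def[symmetric] e by simp
qed

lemma L2_norm_on_square: "(L2_norm_on D f)\<^sup>2 = (LINT x:D|lborel. (norm (f x))\<^sup>2)"
proof -
  have "0 \<le> (LINT x:D|lborel. (norm (f x))\<^sup>2)"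
    unfolding set_lebesgue_integral_def by (intro integral_nonneg_AE AE_I2) (auto simp: indicator_def)
  then show ?thesis by (simp add: L2_norm_on_def)
qed

end


section \<open>Weak form of the equations\<close>

context domain
begin

lemma C_space_3_imp_2: "C_space 3 I S f \<Longrightarrow> C_space 2 I S f"
  using C_space_Suc_imp[of 2] by simp

lemma solution_admissible:
  assumes "alpha_euler_solution \<alpha> D n \<gamma> I v" "t \<in> I"
  shows "admissible (v t)"
  using assms C_space_static[OF C_space_3_imp_2, of I v t]
  by (auto simp: admissible_def alpha_euler_solution_def Let_def S_def)

lemma solution_C_space: "alpha_euler_solution \<alpha> D n \<gamma> I v \<Longrightarrow> C_space 3 I S v"
  by (auto simp: alpha_euler_solution_def Let_def S_def)

lemma divergence_eq: "divergence S v x = pd S 1 v x $ 1 + pd S 2 v x $ 2"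
  by (simp add: divergence_def sum_2)

lemma solution_divergence_free:
  "alpha_euler_solution \<alpha> D n \<gamma> I v \<Longrightarrow> t \<in> I \<Longrightarrow> x \<in> S \<Longrightarrow> pd S 1 (v t) x $ 1 + pd S 2 (v t) x $ 2 = 0"
  unfolding divergence_eq[symmetric] by (auto simp: alpha_euler_solution_def Let_def S_def)

text \<open>Here \<open>p = \<pi> + v \<bullet> u\<close> and \<open>q = \<nabla>p\<close>. Note that \<open>perp\<close> is the rotation by \<open>- \<pi>/2\<close>,
  that is, \<open>perp v = - v\<^sup>\<perp>\<close>.\<close>

lemma solution_equation:
  assumes sol: "alpha_euler_solution \<alpha> D n \<gamma> I v"
  obtains ut p q where "continuous_on (I \<times> S) (\<lambda>(t, x). ut t x)"
    "\<And>t x. t \<in> I \<Longrightarrow> x \<in> S \<Longrightarrow> ((\<lambda>s. helmholtz \<alpha> S (v s) x) has_vector_derivative ut t x) (at t within I)"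
    "\<And>t. t \<in> I \<Longrightarrow> continuous_on S (p t)"
    "\<And>t. t \<in> I \<Longrightarrow> continuous_on S (q t)"
    "\<And>t x i. t \<in> I \<Longrightarrow> x \<in> D \<Longrightarrow> has_pderiv (p t) i (q t x $ i) x"
    "\<And>t x. ut t x = vorticity \<alpha> S (v t) x *\<^sub>R perp (v t x) - q t x"
proof -
  define u where "u t = helmholtz \<alpha> S (v t)" for t
  define \<omega> where "\<omega> t = vorticity \<alpha> S (v t)" for t
  have w: "\<omega> t x = pd S 1 (u t) x $ 2 - pd S 2 (u t) x $ 1" for t x
    by (simp add: \<omega>_def u_def vorticity_def curl_def)
  obtain ut \<pi> where ut: "continuous_on (I \<times> S) (\<lambda>(t, x). ut t x)"
     "\<And>t. t \<in> I \<Longrightarrow> \<pi> t differentiable_on S"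
     "\<And>t x. t \<in> I \<Longrightarrow> x \<in> S \<Longrightarrow> ((\<lambda>s. u s x) has_vector_derivative ut t x) (at t within I)"
     "\<And>t x. t \<in> I \<Longrightarrow> x \<in> S \<Longrightarrow> ut t x + jacobi S (u t) x *v v t x + transpose (jacobi S (v t) x) *v u t x + gradient S (\<pi> t) x = 0"
    using sol unfolding alpha_euler_solution_def Let_def S_def[symmetric] u_def by blast
  have C3: "C_space 3 I S v" using solution_C_space[OF sol] .
  have Cu: "C_space (Suc 0) I S u" using helmholtz_C_space[OF C3] by (simp add: u_def[abs_def])
  have Cv: "C_space (Suc (Suc 0)) I S v" using C_space_3_imp_2[OF C3] by (simp add: numeral_2_eq_2)
  have wc: "continuous_on (I \<times> S) (\<lambda>(t, x). \<omega> t x)" unfolding \<omega>_def by (rule vorticity_continuous[OF C3])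
  define p where "p t x = \<pi> t x + (u t x $ 1 * v t x $ 1 + u t x $ 2 * v t x $ 2)" for t x
  \<comment> \<open>Reading \<open>q\<close> off the equation makes it continuous at once; that it
    is the gradient of \<open>p\<close> is then a pointwise identity inside
    \<open>D\<close>.\<close>
  define q where "q t x = \<omega> t x *\<^sub>R perp (v t x) - ut t x" for t x
  have pc: "continuous_on S (p t)" if t: "t \<in> I" for t
    unfolding p_def
    by (intro continuous_intros differentiable_imp_continuous_on[OF ut(2)[OF t]]
        continuous_on_time_section[OF C_space_cont[OF Cu] t order_refl] continuous_on_time_section[OF C_space_cont[OF Cv] t order_refl])
  have qc: "continuous_on S (q t)" if t: "t \<in> I" for t
    unfolding q_def
    by (intro continuous_intros continuous_on_perp continuous_on_time_section[OF wc t order_refl]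
        continuous_on_time_section[OF ut(1) t order_refl] continuous_on_time_section[OF C_space_cont[OF Cv] t order_refl])
  have pq: "has_pderiv (p t) i (q t x $ i) x" if t: "t \<in> I" and x: "x \<in> D" for t x i
  proof -
    have xS: "x \<in> S" using x S by auto
    have d: "\<pi> t differentiable (at x within S)" "u t differentiable (at x within S)" "v t differentiable (at x within S)"
      using ut(2)[OF t] xS C_space_differentiable[OF Cu t xS] C_space_differentiable[OF Cv t xS] by (auto simp: differentiable_on_def)
    have "has_pderiv (p t) i (pd S i (\<pi> t) x + ((pd S i (u t) x $ 1 * v t x $ 1 + u t x $ 1 * pd S i (v t) x $ 1) +
        (pd S i (u t) x $ 2 * v t x $ 2 + u t x $ 2 * pd S i (v t) x $ 2))) x"
      unfolding p_def[abs_def]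
      by (intro has_pderiv_add has_pderiv_mult has_pderiv_pd_component[OF x] has_pderiv_pd[OF x] d)
    moreover have "q t x $ i = pd S i (\<pi> t) x + ((pd S i (u t) x $ 1 * v t x $ 1 + u t x $ 1 * pd S i (v t) x $ 1) +
        (pd S i (u t) x $ 2 * v t x $ 2 + u t x $ 2 * pd S i (v t) x $ 2))"
    proof -
      have "(ut t x + jacobi S (u t) x *v v t x + transpose (jacobi S (v t) x) *v u t x + gradient S (\<pi> t) x) $ i = 0"
        using ut(4)[OF t xS] by simp
      then have "ut t x $ i + (pd S 1 (u t) x $ i * v t x $ 1 + pd S 2 (u t) x $ i * v t x $ 2)
         + (pd S i (v t) x $ 1 * u t x $ 1 + pd S i (v t) x $ 2 * u t x $ 2) + pd S i (\<pi> t) x = 0"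
        by (simp add: jacobi_def matrix_vector_mult_def transpose_def gradient_def sum_2)
      moreover have "i = 1 \<or> i = 2" by (rule exhaust_2)
      ultimately show ?thesis by (auto simp: q_def w algebra_simps)
    qed
    ultimately show ?thesis by simp
  qed
  show ?thesis
    by (rule that[of ut p q]) (use ut pc qc pq in \<open>auto simp: u_def q_def \<omega>_def\<close>)
qed

lemma solution_weak_divergence:
  assumes sol: "alpha_euler_solution \<alpha> D n \<gamma> I v" and t: "t \<in> I" and \<psi>: "test_fun D \<psi> g"
  shows "(LINT x:D|lborel. v t x \<bullet> g x) = 0"
proof -
  note A = admissible_props[OF solution_admissible[OF sol t]]
  note c = test_fun_continuous[OF \<psi>, of S]
  have one: "(LINT x:D|lborel. g x $ i * v t x $ i + \<psi> x * pd S i (v t) x $ i) = 0" for i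
    by (rule test_fun_integral_pderiv[OF D(1) \<psi>])
      (use A(4) continuous_on_subset[OF A(1) S(2)] continuous_on_subset[OF A(2) S(2)] has_pderiv_pd_component S(2) in \<open>auto intro!: continuous_intros\<close>)
  have i: "set_integrable lborel D (\<lambda>x. g x $ i * v t x $ i + \<psi> x * pd S i (v t) x $ i)" for i
    by (intro set_integrable_S continuous_intros c A)
  have "(LINT x:D|lborel. v t x \<bullet> g x) = (LINT x:D|lborel. (g x $ 1 * v t x $ 1 + \<psi> x * pd S 1 (v t) x $ 1)
      + (g x $ 2 * v t x $ 2 + \<psi> x * pd S 2 (v t) x $ 2))"
  proof (rule set_lebesgue_integral_cong)
    show "\<forall>x. x \<in> D \<longrightarrow> v t x \<bullet> g x = (g x $ 1 * v t x $ 1 + \<psi> x * pd S 1 (v t) x $ 1) + (g x $ 2 * v t x $ 2 + \<psi> x * pd S 2 (v t) x $ 2)"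
    proof (intro allI impI)
      fix x assume "x \<in> D"
      then have "pd S 1 (v t) x $ 1 + pd S 2 (v t) x $ 2 = 0"
        using solution_divergence_free[OF sol t, of x] S by auto
      then have "\<psi> x * pd S 1 (v t) x $ 1 + \<psi> x * pd S 2 (v t) x $ 2 = 0"
        by (metis distrib_left mult_zero_right)
      then show "v t x \<bullet> g x = (g x $ 1 * v t x $ 1 + \<psi> x * pd S 1 (v t) x $ 1) + (g x $ 2 * v t x $ 2 + \<psi> x * pd S 2 (v t) x $ 2)"
        by (simp add: inner_vec2 mult.commute)
    qed
  qed (use D in auto)
  also have "\<dots> = 0" using one by (simp add: set_integral_add(2)[OF i i])
  finally show ?thesis .
qed

text \<open>The available time derivative is that of \<open>u\<close>, so the curl is first moved
  onto \<open>\<psi>\<close> and the result is differentiated under the integral. The gradient part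
  \<open>q\<close> drops out by \<open>test_fun_integral_swap\<close>, a curl-free condition that
  asks only one derivative of \<open>p\<close>; the rotated part
  \<open>\<omega> t x *\<^sub>R perp (v t x)\<close> gives the transport term.\<close>

lemma solution_weak_vorticity:
  assumes sol: "alpha_euler_solution \<alpha> D n \<gamma> I v" and ab: "{a..b} \<subseteq> I" and t: "t \<in> {a..b}" and \<psi>: "test_fun D \<psi> g"
  defines "\<omega> \<equiv> \<lambda>t. vorticity \<alpha> S (v t)"
  shows "((\<lambda>s. LINT x:D|lborel. \<psi> x * \<omega> s x) has_real_derivative (LINT x:D|lborel. \<omega> t x * (v t x \<bullet> g x))) (at t within {a..b})"
proof -
  obtain ut p q where eq: "continuous_on (I \<times> S) (\<lambda>(t, x). ut t x)"
    "\<And>t x. t \<in> I \<Longrightarrow> x \<in> S \<Longrightarrow> ((\<lambda>s. helmholtz \<alpha> S (v s) x) has_vector_derivative ut t x) (at t within I)"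
    "\<And>t. t \<in> I \<Longrightarrow> continuous_on S (p t)" "\<And>t. t \<in> I \<Longrightarrow> continuous_on S (q t)"
    "\<And>t x i. t \<in> I \<Longrightarrow> x \<in> D \<Longrightarrow> has_pderiv (p t) i (q t x $ i) x"
    "\<And>t x. ut t x = \<omega> t x *\<^sub>R perp (v t x) - q t x"
    using solution_equation[OF sol] unfolding \<omega>_def by blast
  define u where "u t = helmholtz \<alpha> S (v t)" for t
  define J where "J = {a..b}"
  have J: "compact J" "convex J" "J \<subseteq> I" "t \<in> J" using ab t by (auto simp: J_def)
  have C3: "C_space 3 I S v" using solution_C_space[OF sol] .
  have Cu: "C_space (Suc 0) I S u" using helmholtz_C_space[OF C3] by (simp add: u_def[abs_def])
  have w: "\<omega> s x = pd S 1 (u s) x $ 2 - pd S 2 (u s) x $ 1" for s x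
    by (simp add: \<omega>_def u_def vorticity_def curl_def)
  have uc: "continuous_on S (u s)" "continuous_on S (pd S i (u s))" if "s \<in> I" for s i
    using continuous_on_time_section[OF C_space_cont[OF Cu] that order_refl]
      continuous_on_time_section[OF C_space_cont[OF C_space_pd[OF Cu]] that order_refl] by auto
  note c = test_fun_continuous[OF \<psi>, of S]
  have ibp: "(LINT x:D|lborel. \<psi> x * \<omega> s x) = (LINT x:D|lborel. g x $ 2 * u s x $ 1 - g x $ 1 * u s x $ 2)" if s: "s \<in> I" for s
  proof -
    have one: "(LINT x:D|lborel. g x $ i * u s x $ j + \<psi> x * pd S i (u s) x $ j) = 0" for i j
      by (rule test_fun_integral_pderiv[OF D(1) \<psi>])
        (use continuous_on_subset[OF uc(1)[OF s] S(2)] continuous_on_subset[OF uc(2)[OF s] S(2)] has_pderiv_pd_component C_space_differentiable[OF Cu s] S(2) in \<open>auto intro!: continuous_intros\<close>)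
    have i: "set_integrable lborel D (\<lambda>x. g x $ i * u s x $ j + \<psi> x * pd S i (u s) x $ j)" for i j
      by (intro set_integrable_S continuous_intros c uc s)
    have i': "set_integrable lborel D (\<lambda>x. g x $ 2 * u s x $ 1 - g x $ 1 * u s x $ 2)"
      by (intro set_integrable_S continuous_intros c uc s)
    have "(LINT x:D|lborel. \<psi> x * \<omega> s x) = (LINT x:D|lborel. (g x $ 2 * u s x $ 1 - g x $ 1 * u s x $ 2) +
       ((g x $ 1 * u s x $ 2 + \<psi> x * pd S 1 (u s) x $ 2) - (g x $ 2 * u s x $ 1 + \<psi> x * pd S 2 (u s) x $ 1)))"
      by (rule arg_cong[where f="set_lebesgue_integral lborel D"]) (auto simp: fun_eq_iff w algebra_simps)
    also have "\<dots> = (LINT x:D|lborel. g x $ 2 * u s x $ 1 - g x $ 1 * u s x $ 2)"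
      unfolding set_integral_add(2)[OF i' set_integral_diff(1)[OF i i]] set_integral_diff(2)[OF i i] one by simp
    finally show ?thesis .
  qed
  have utJ: "continuous_on (J \<times> S) (\<lambda>(t, x). ut t x)"
    by (rule continuous_on_subset[OF eq(1)]) (use J in auto)
  obtain B where B: "B \<ge> 0" "\<And>t x. t \<in> J \<Longrightarrow> x \<in> S \<Longrightarrow> norm (ut t x) \<le> B"
    using compact_time_space_bound[OF utJ J(1) S(1)] by blast
  obtain G where G: "G \<ge> 0" "\<And>x. x \<in> S \<Longrightarrow> norm (g x) \<le> G" using continuous_S_bounded[OF c(2)] by blast
  have der: "((\<lambda>s. LINT x:D|lborel. g x $ 2 * u s x $ 1 - g x $ 1 * u s x $ 2) has_real_derivative
      (LINT x:D|lborel. g x $ 2 * ut t x $ 1 - g x $ 1 * ut t x $ 2)) (at t within J)"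
  proof (rule has_real_derivative_set_integral[OF _ D(2) J(2,4), where f'="\<lambda>s x. g x $ 2 * ut s x $ 1 - g x $ 1 * ut s x $ 2" and B="G * B + G * B"])
    show "D \<in> sets borel" using D by auto
    fix s assume s: "s \<in> J"
    then have sI: "s \<in> I" using J by auto
    show "set_integrable lborel D (\<lambda>x. g x $ 2 * u s x $ 1 - g x $ 1 * u s x $ 2)"
      by (intro set_integrable_S continuous_intros c uc sI)
    fix x assume "x \<in> D"
    then have x: "x \<in> S" using S by auto
    have "((\<lambda>s. u s x) has_vector_derivative ut s x) (at s within J)"
      using has_vector_derivative_within_subset[OF eq(2)[OF sI x] J(3)] by (simp add: u_def)
    then have comp: "((\<lambda>s. u s x $ i) has_real_derivative ut s x $ i) (at s within J)" for i
      using bounded_linear.has_vector_derivative[OF bounded_linear_vec_nth]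
      by (simp add: has_real_derivative_iff_has_vector_derivative)
    show "((\<lambda>s. g x $ 2 * u s x $ 1 - g x $ 1 * u s x $ 2) has_real_derivative g x $ 2 * ut s x $ 1 - g x $ 1 * ut s x $ 2) (at s within J)"
      by (intro DERIV_diff DERIV_cmult comp)
    have "\<bar>g x $ i * ut s x $ j\<bar> \<le> G * B" for i j
      unfolding abs_mult using component_le_norm_cart[of "g x" i] G(2)[OF x] component_le_norm_cart[of "ut s x" j] B(2)[OF s x] G(1)
      by (intro mult_mono) linarith+
    from this[of 2 1] this[of 1 2] show "\<bar>g x $ 2 * ut s x $ 1 - g x $ 1 * ut s x $ 2\<bar> \<le> G * B + G * B" by linarith
  qed
  have tI: "t \<in> I" using J by auto
  have wc: "continuous_on S (\<omega> t)" unfolding \<omega>_def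
    by (rule continuous_on_time_section[OF vorticity_continuous[OF C3] tI order_refl])
  have vc: "continuous_on S (v t)" by (rule admissible_props(1)[OF solution_admissible[OF sol tI]])
  obtain M1 where M1: "M1 \<ge> 0" "\<And>x. x \<in> S \<Longrightarrow> norm (p t x) \<le> M1" using continuous_S_bounded[OF eq(3)[OF tI]] by blast
  obtain M2 where M2: "M2 \<ge> 0" "\<And>x. x \<in> S \<Longrightarrow> norm (q t x) \<le> M2" using continuous_S_bounded[OF eq(4)[OF tI]] by blast
  have swap: "(LINT x:D|lborel. g x $ 1 * q t x $ 2) = (LINT x:D|lborel. g x $ 2 * q t x $ 1)"
  proof (rule test_fun_integral_swap[OF D \<psi> _ _ eq(5)[OF tI], where B="max M1 M2"])
    show "\<bar>p t x\<bar> \<le> max M1 M2" "norm (q t x) \<le> max M1 M2" if "x \<in> D" for x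
      using M1(2)[of x] M2(2)[of x] that S(2) by (auto simp: le_max_iff_disj)
  qed (use eq(3,4)[OF tI] continuous_on_subset[OF _ S(2)] in auto)
  have i1: "set_integrable lborel D (\<lambda>x. \<omega> t x * (v t x \<bullet> g x))"
    by (intro set_integrable_S continuous_intros c wc vc)
  have i2: "set_integrable lborel D (\<lambda>x. g x $ i * q t x $ j)" for i j
    by (intro set_integrable_S continuous_intros c eq(4)[OF tI])
  have "(LINT x:D|lborel. g x $ 2 * ut t x $ 1 - g x $ 1 * ut t x $ 2)
     = (LINT x:D|lborel. \<omega> t x * (v t x \<bullet> g x) + (g x $ 1 * q t x $ 2 - g x $ 2 * q t x $ 1))"
    by (rule arg_cong[where f="set_lebesgue_integral lborel D"]) (auto simp: fun_eq_iff eq(6) inner_vec2 algebra_simps)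
  also have "\<dots> = (LINT x:D|lborel. \<omega> t x * (v t x \<bullet> g x))"
    using swap by (simp add: set_integral_add(2)[OF i1 set_integral_diff(1)[OF i2 i2]] set_integral_diff(2)[OF i2 i2])
  finally have val: "(LINT x:D|lborel. g x $ 2 * ut t x $ 1 - g x $ 1 * ut t x $ 2) = (LINT x:D|lborel. \<omega> t x * (v t x \<bullet> g x))" .
  show ?thesis
    unfolding J_def[symmetric]
    by (rule has_field_derivative_transform_within[OF der[unfolded val] zero_less_one J(4)]) (use ibp J in auto)
qed

lemma solution_cutoff:
  assumes sol: "alpha_euler_solution \<alpha> D n \<gamma> I v" and ab: "{a..b} \<subseteq> I" and "e > 0"
  shows "\<exists>\<eta> g. test_fun D \<eta> g \<and> (\<forall>x. 0 \<le> \<eta> x \<and> \<eta> x \<le> 1) \<and> (LINT x:D|lborel. 1 - \<eta> x) \<le> e \<and>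
     (\<forall>t\<in>{a..b}. (LINT x:D|lborel. \<bar>v t x \<bullet> g x\<bar>) \<le> e)"
proof (rule domain_cutoff)
  show "continuous_on ({a..b} \<times> S) (\<lambda>(t, x). v t x)"
    by (rule continuous_on_subset[OF C_space_cont[OF solution_C_space[OF sol]]]) (use ab in auto)
  show "v t (\<gamma> i s) \<bullet> outer_normal D (\<gamma> i) s = 0" if "t \<in> {a..b}" "i \<le> n" for t i s
    using solution_admissible[OF sol, of t] boundary_tangential that ab by (auto simp: admissible_def)
qed (use assms in auto)

lemma solution_Lipschitz:
  assumes sol: "alpha_euler_solution \<alpha> D n \<gamma> I v" and ab: "{a..b} \<subseteq> I"
  obtains L where "L \<ge> 0" "\<And>t x y. t \<in> {a..b} \<Longrightarrow> closed_segment x y \<subseteq> D \<Longrightarrow> norm (v t x - v t y) \<le> L * dist x y"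
proof -
  have C2: "C_space (Suc (Suc 0)) I S v" using C_space_3_imp_2[OF solution_C_space[OF sol]] by (simp add: numeral_2_eq_2)
  have c: "continuous_on ({a..b} \<times> S) (\<lambda>(t, x). pd S i (v t) x)" for i
    by (rule continuous_on_subset[OF C_space_cont[OF C_space_pd[OF C2]]]) (use ab in auto)
  obtain B1 where B1: "B1 \<ge> 0" "\<And>t x. t \<in> {a..b} \<Longrightarrow> x \<in> S \<Longrightarrow> norm (pd S 1 (v t) x) \<le> B1"
    using compact_time_space_bound[OF c[of 1] _ S(1)] by auto
  obtain B2 where B2: "B2 \<ge> 0" "\<And>t x. t \<in> {a..b} \<Longrightarrow> x \<in> S \<Longrightarrow> norm (pd S 2 (v t) x) \<le> B2"
    using compact_time_space_bound[OF c[of 2] _ S(1)] by auto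
  show ?thesis
  proof (rule that[of "B1 + B2"])
    fix t x y assume t: "t \<in> {a..b}" and seg: "closed_segment x y \<subseteq> D"
    have "norm (v t x - v t y) \<le> (B1 + B2) * norm (x - y)"
    proof (rule differentiable_bound[where S="closed_segment x y" and f'="\<lambda>z. frechet_derivative (v t) (at z within S)"])
      fix z assume z: "z \<in> closed_segment x y"
      then have zS: "z \<in> S" using seg S by auto
      have d: "(v t has_derivative frechet_derivative (v t) (at z within S)) (at z within S)"
        using C_space_differentiable[OF C2 _ zS, of t] t ab by (intro frechet_works) auto
      then show "(v t has_derivative frechet_derivative (v t) (at z within S)) (at z within closed_segment x y)"
        by (rule has_derivative_subset) (use seg S in auto)
      interpret f: bounded_linear "frechet_derivative (v t) (at z within S)" using d by (rule has_derivative_bounded_linear)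
      show "onorm (frechet_derivative (v t) (at z within S)) \<le> B1 + B2"
      proof (rule onorm_le)
        fix h :: "real^2"
        have "h = h $ 1 *\<^sub>R axis 1 1 + h $ 2 *\<^sub>R axis 2 1" by (simp add: vec2_eq_iff axis_def)
        then have "frechet_derivative (v t) (at z within S) h = h $ 1 *\<^sub>R pd S 1 (v t) z + h $ 2 *\<^sub>R pd S 2 (v t) z"
          unfolding pd_def by (metis f.add f.scaleR)
        also have "norm \<dots> \<le> \<bar>h $ 1\<bar> * norm (pd S 1 (v t) z) + \<bar>h $ 2\<bar> * norm (pd S 2 (v t) z)"
          using norm_triangle_ineq[of "h $ 1 *\<^sub>R pd S 1 (v t) z" "h $ 2 *\<^sub>R pd S 2 (v t) z"] by simp
        also have "\<dots> \<le> norm h * B1 + norm h * B2"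
          using component_le_norm_cart[of h] B1(2)[OF t zS] B2(2)[OF t zS]
          by (intro add_mono mult_mono) auto
        finally show "norm (frechet_derivative (v t) (at z within S) h) \<le> (B1 + B2) * norm h" by (simp add: algebra_simps)
      qed
    qed auto
    then show "norm (v t x - v t y) \<le> (B1 + B2) * dist x y" by (simp add: dist_norm)
  qed (use B1 B2 in auto)
qed

lemma Casimir_conserved:
  assumes sol: "alpha_euler_solution \<alpha> D n \<gamma> I v" and ab: "{a..b} \<subseteq> I" "a \<le> b"
    and G: "\<And>w. (G has_real_derivative G' w) (at w)" "continuous_on UNIV G'"
  shows "(LINT x:D|lborel. G (vorticity \<alpha> S (v b) x)) = (LINT x:D|lborel. G (vorticity \<alpha> S (v a) x))"
proof -
  obtain L where L: "L \<ge> 0" "\<And>t x y. t \<in> {a..b} \<Longrightarrow> closed_segment x y \<subseteq> D \<Longrightarrow> norm (v t x - v t y) \<le> L * dist x y"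
    using solution_Lipschitz[OF sol ab(1)] by blast
  show ?thesis
  proof (rule transport_conserves_integral[where v=v and \<omega>="\<lambda>t. vorticity \<alpha> S (v t)", OF D ab(2) _ _ L _ solution_weak_vorticity[OF sol ab(1)] solution_cutoff[OF sol ab(1)] G])
    show "continuous_on ({a..b} \<times> closure D) (\<lambda>(t, x). v t x)"
      unfolding S_def[symmetric] by (rule continuous_on_subset[OF C_space_cont[OF solution_C_space[OF sol]]]) (use ab in auto)
    show "continuous_on ({a..b} \<times> closure D) (\<lambda>(t, x). vorticity \<alpha> S (v t) x)"
      unfolding S_def[symmetric] by (rule continuous_on_subset[OF vorticity_continuous[OF solution_C_space[OF sol]]]) (use ab in auto)
    show "(LINT x:D|lborel. v t x \<bullet> g x) = 0" if "t \<in> {a..b}" "test_fun D \<psi> g" for t \<psi> g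
      by (rule solution_weak_divergence[OF sol _ that(2)]) (use that ab in auto)
  qed
qed

end

section \<open>Evolution of the energy of the perturbation\<close>

lemma inner_perp_self [simp]: "v \<bullet> perp v = 0"
  by (simp add: inner_vec2)

lemma inner_perp_swap: "w \<bullet> perp v = - (v \<bullet> perp w)"
  by (simp add: inner_vec2)

context domain
begin

text \<open>By the Green identity and symmetry, the increment of the energy between two times is
  half the integral of the sum of the perturbations against the increment of \<open>u\<close>, whose
  quotient converges. In the limit the gradient part is the divergence of \<open>p\<close> times the
  perturbation, with zero flux. Of the rest only the product with \<open>perp (v0 x)\<close>
  survives, since \<open>v \<bullet> perp v = 0\<close>.\<close>

lemma energy_derivative:
  assumes sol: "alpha_euler_solution \<alpha> D n \<gamma> I v" and ab: "{a..b} \<subseteq> I" and t: "t \<in> {a..b}"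
    and v0: "admissible v0" "\<And>x. x \<in> S \<Longrightarrow> pd S 1 v0 x $ 1 + pd S 2 v0 x $ 2 = 0"
  shows "((\<lambda>s. (LINT x:D|lborel. energy_density \<alpha> (\<lambda>x. v s x - v0 x) (\<lambda>x. v s x - v0 x) x) / 2) has_real_derivative
    (LINT x:D|lborel. vorticity \<alpha> S (v t) x * (v t x \<bullet> perp (v0 x)))) (at t within {a..b})"
proof -
  define \<omega> where "\<omega> t = vorticity \<alpha> S (v t)" for t
  obtain ut p q where eq: "continuous_on (I \<times> S) (\<lambda>(t, x). ut t x)"
    "\<And>t x. t \<in> I \<Longrightarrow> x \<in> S \<Longrightarrow> ((\<lambda>s. helmholtz \<alpha> S (v s) x) has_vector_derivative ut t x) (at t within I)"
    "\<And>t. t \<in> I \<Longrightarrow> continuous_on S (p t)" "\<And>t. t \<in> I \<Longrightarrow> continuous_on S (q t)"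
    "\<And>t x i. t \<in> I \<Longrightarrow> x \<in> D \<Longrightarrow> has_pderiv (p t) i (q t x $ i) x"
    "\<And>t x. ut t x = \<omega> t x *\<^sub>R perp (v t x) - q t x"
    using solution_equation[OF sol] unfolding \<omega>_def by blast
  define J where "J = {a..b}"
  have J: "compact J" "convex J" "J \<subseteq> I" "t \<in> J" using ab t by (auto simp: J_def)
  then have tI: "t \<in> I" by auto
  define u where "u t = helmholtz \<alpha> S (v t)" for t
  define A where "A t x = v t x - v0 x" for t x
  have adv: "admissible (v s)" if "s \<in> I" for s by (rule solution_admissible[OF sol that])
  have adA: "admissible (A s)" if "s \<in> I" for s
    unfolding A_def by (rule admissible_diff[OF adv[OF that] v0(1)])
  note AP = admissible_props[OF adA]
  have C3: "C_space 3 I S v" using solution_C_space[OF sol] .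
  have Cu: "C_space (Suc 0) I S u" using helmholtz_C_space[OF C3] by (simp add: u_def[abs_def])
  have uc: "continuous_on S (u s)" if "s \<in> I" for s
    by (rule continuous_on_time_section[OF C_space_cont[OF Cu] that order_refl])
  have HA: "helmholtz \<alpha> S (A s) x = u s x - helmholtz \<alpha> S v0 x" if "s \<in> I" "x \<in> S" for s x
    unfolding A_def u_def by (rule helmholtz_diff) (use adv that v0 in \<open>auto simp: admissible_def\<close>)
  define E where "E s r = (LINT x:D|lborel. energy_density \<alpha> (A s) (A r) x)" for s r
  have Esym: "E s r = E r s" for s r
    unfolding E_def energy_density_def by (simp add: inner_commute)
  have Ediff: "E s r - E s r' = (LINT x:D|lborel. A s x \<bullet> (u r x - u r' x))" if "s \<in> I" "r \<in> I" "r' \<in> I" for s r r'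
  proof -
    have G: "E s r = (LINT x:D|lborel. A s x \<bullet> helmholtz \<alpha> S (A r) x)" "E s r' = (LINT x:D|lborel. A s x \<bullet> helmholtz \<alpha> S (A r') x)"
      unfolding E_def by (rule Green_identity[OF adA[OF that(1)] adA[OF that(2)], symmetric], rule Green_identity[OF adA[OF that(1)] adA[OF that(3)], symmetric])
    have hc: "continuous_on S (helmholtz \<alpha> S (A r))" if "r \<in> I" for r
      unfolding helmholtz_def[abs_def] laplacian_eq by (intro continuous_intros AP[OF that])
    have i: "set_integrable lborel D (\<lambda>x. A s x \<bullet> helmholtz \<alpha> S (A r) x)" if "r \<in> I" for r
      by (intro set_integrable_S continuous_intros AP[OF \<open>s \<in> I\<close>] hc that)
    have "E s r - E s r' = (LINT x:D|lborel. A s x \<bullet> helmholtz \<alpha> S (A r) x - A s x \<bullet> helmholtz \<alpha> S (A r') x)"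
      unfolding G by (rule set_integral_diff(2)[symmetric, OF i[OF that(2)] i[OF that(3)]])
    also have "\<dots> = (LINT x:D|lborel. A s x \<bullet> (u r x - u r' x))"
      by (rule set_lebesgue_integral_cong) (use D S(2) that in \<open>auto simp: HA inner_diff_right subset_iff\<close>)
    finally show ?thesis .
  qed
  \<comment> \<open>Written in components so that the difference quotient of each component of
    \<open>u\<close> stands alone and converges by \<open>du\<close>.\<close>
  define Q where "Q s x = ((A s x $ 1 + A t x $ 1) * ((u s x $ 1 - u t x $ 1) / (s - t)) + (A s x $ 2 + A t x $ 2) * ((u s x $ 2 - u t x $ 2) / (s - t))) / 2" for s x
  have quot: "(E s s / 2 - E t t / 2) / (s - t) = (LINT x:D|lborel. Q s x)" if s: "s \<in> I" "s \<noteq> t" for s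
  proof -
    have d: "s - t \<noteq> 0" using s by simp
    have aux1: "(x / 2 - y / 2) / (s - t) = (x - y) / (2 * (s - t))" for x y :: real
      by (simp add: diff_divide_distrib[symmetric])
    have aux2: "(a1 * p1 + a2 * p2 + (b1 * p1 + b2 * p2)) / (2 * d) = ((a1 + b1) * (p1 / d) + (a2 + b2) * (p2 / d)) / 2"
      if "d \<noteq> 0" for a1 a2 b1 b2 p1 p2 d :: real
      using that by (simp add: field_simps)
    have i: "set_integrable lborel D (\<lambda>x. A r x \<bullet> (u s x - u t x))" if "r \<in> I" for r
      by (intro set_integrable_S continuous_intros AP[OF that] uc s tI)
    \<comment> \<open>The increment is \<open>E s s - E s t\<close> plus
      \<open>E t s - E t t\<close>; the middle terms cancel by symmetry.\<close>
    have "E s s - E t t = (LINT x:D|lborel. A s x \<bullet> (u s x - u t x)) + (LINT x:D|lborel. A t x \<bullet> (u s x - u t x))"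
      unfolding Ediff[OF s(1) s(1) tI, symmetric] Ediff[OF tI s(1) tI, symmetric] using Esym[of s t] by simp
    also have "\<dots> = (LINT x:D|lborel. A s x \<bullet> (u s x - u t x) + A t x \<bullet> (u s x - u t x))"
      by (rule set_integral_add(2)[symmetric, OF i[OF s(1)] i[OF tI]])
    finally have "(E s s / 2 - E t t / 2) / (s - t) = (LINT x:D|lborel. A s x \<bullet> (u s x - u t x) + A t x \<bullet> (u s x - u t x)) / (2 * (s - t))"
      using aux1 s by simp
    also have "\<dots> = (LINT x:D|lborel. (A s x \<bullet> (u s x - u t x) + A t x \<bullet> (u s x - u t x)) / (2 * (s - t)))"
      by (rule set_integral_divide_zero[symmetric])
    also have "\<dots> = (LINT x:D|lborel. Q s x)"
      by (rule arg_cong[where f="set_lebesgue_integral lborel D"])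
        (simp only: Q_def inner_vec2 vector_minus_component aux2[OF d])
    finally show ?thesis .
  qed
  have vJ: "continuous_on (J \<times> S) (\<lambda>(t, x). v t x)" "continuous_on (J \<times> S) (\<lambda>(t, x). ut t x)"
    by (rule continuous_on_subset[OF C_space_cont[OF C3]], use J in auto) (rule continuous_on_subset[OF eq(1)], use J in auto)
  obtain Mv where Mv: "Mv \<ge> 0" "\<And>t x. t \<in> J \<Longrightarrow> x \<in> S \<Longrightarrow> norm (v t x) \<le> Mv"
    using compact_time_space_bound[OF vJ(1) J(1) S(1)] by blast
  obtain B where B: "B \<ge> 0" "\<And>t x. t \<in> J \<Longrightarrow> x \<in> S \<Longrightarrow> norm (ut t x) \<le> B"
    using compact_time_space_bound[OF vJ(2) J(1) S(1)] by blast
  obtain M0 where M0: "M0 \<ge> 0" "\<And>x. x \<in> S \<Longrightarrow> norm (v0 x) \<le> M0"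
    using continuous_S_bounded[OF admissible_props(1)[OF v0(1)]] by blast
  have Ab: "\<bar>A s x $ i\<bar> \<le> Mv + M0" if "s \<in> J" "x \<in> S" for s x i
    using component_le_norm_cart[of "A s x" i] norm_triangle_ineq4[of "v s x" "v0 x"] Mv(2)[OF that] M0(2)[OF that(2)]
    by (simp add: A_def)
  have du: "((\<lambda>s. u s x $ i) has_real_derivative ut s x $ i) (at s within J)" if "s \<in> J" "x \<in> S" for s x i
  proof -
    have "((\<lambda>s. u s x) has_vector_derivative ut s x) (at s within J)"
      using has_vector_derivative_within_subset[OF eq(2) J(3)] that J(3) by (auto simp: u_def)
    then show ?thesis
      using bounded_linear.has_vector_derivative[OF bounded_linear_vec_nth]
      by (simp add: has_real_derivative_iff_has_vector_derivative)
  qed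
  have ub: "\<bar>(u s x $ i - u t x $ i) / (s - t)\<bar> \<le> B" if "s \<in> J - {t}" "x \<in> S" for s x i
  proof -
    have "\<bar>u s x $ i - u t x $ i\<bar> \<le> B * \<bar>s - t\<bar>"
    proof (rule real_quotient_bound[OF J(2), where f'="\<lambda>s. ut s x $ i"])
      show "\<bar>ut r x $ i\<bar> \<le> B" if "r \<in> J" for r
        using component_le_norm_cart[of "ut r x" i] B(2)[OF that \<open>x \<in> S\<close>] by linarith
    qed (use du that J in auto)
    then show ?thesis using that by (simp add: field_simps)
  qed
  have lim: "((\<lambda>s. LINT x:D|lborel. Q s x) \<longlongrightarrow> (LINT x:D|lborel. A t x \<bullet> ut t x)) (at t within J)"
  proof (rule set_bounded_convergence_at[where B="((2 * (Mv + M0)) * B + (2 * (Mv + M0)) * B) / 2"])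
    fix s assume s: "s \<in> J - {t}"
    then have sI: "s \<in> I" using J by auto
    have "set_integrable lborel D (Q s)"
      unfolding Q_def using s by (intro set_integrable_S continuous_intros AP uc sI tI) auto
    then show "set_borel_measurable lborel D (Q s)" by (simp add: set_integrable_def set_borel_measurable_def)
    fix x assume "x \<in> D"
    then have x: "x \<in> S" using S by auto
    have "\<bar>(A s x $ i + A t x $ i) * ((u s x $ i - u t x $ i) / (s - t))\<bar> \<le> (2 * (Mv + M0)) * B" for i
    proof -
      have "\<bar>A s x $ i + A t x $ i\<bar> \<le> 2 * (Mv + M0)" using Ab[of s x i] Ab[of t x i] s x J(4) by auto
      then show ?thesis unfolding abs_mult using ub[OF s x, of i] by (intro mult_mono) auto
    qed
    moreover have "\<bar>(y + z) / 2\<bar> \<le> (c + c) / 2" if "\<bar>y\<bar> \<le> c" "\<bar>z\<bar> \<le> c" for y z c :: real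
      using that by (auto simp: abs_le_iff)
    ultimately show "\<bar>Q s x\<bar> \<le> ((2 * (Mv + M0)) * B + (2 * (Mv + M0)) * B) / 2"
      unfolding Q_def by blast
  next
    fix x assume "x \<in> D"
    then have x: "x \<in> S" using S by auto
    have "continuous_on J (\<lambda>s. (s, x))" by (intro continuous_intros)
    from continuous_on_compose2[OF vJ(1) this] x have "continuous_on J (\<lambda>s. v s x)" by auto
    then have "((\<lambda>s. v s x) \<longlongrightarrow> v t x) (at t within J)" using J(4) by (auto simp: continuous_on_def)
    then have At: "((\<lambda>s. A s x $ i) \<longlongrightarrow> A t x $ i) (at t within J)" for i
      unfolding A_def by (intro tendsto_intros)
    have ut': "((\<lambda>s. (u s x $ i - u t x $ i) / (s - t)) \<longlongrightarrow> ut t x $ i) (at t within J)" for i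
      using du[OF J(4) x, of i] by (simp add: has_field_derivative_iff)
    have "((\<lambda>s. Q s x) \<longlongrightarrow> ((A t x $ 1 + A t x $ 1) * ut t x $ 1 + (A t x $ 2 + A t x $ 2) * ut t x $ 2) / 2) (at t within J)"
      unfolding Q_def by (intro tendsto_intros At ut') auto
    moreover have "((A t x $ 1 + A t x $ 1) * ut t x $ 1 + (A t x $ 2 + A t x $ 2) * ut t x $ 2) / 2 = A t x \<bullet> ut t x"
      by (simp add: inner_vec2 field_simps)
    ultimately show "((\<lambda>s. Q s x) \<longlongrightarrow> A t x \<bullet> ut t x) (at t within J)" by simp
  qed (use D emeasure_bounded_lborel in auto)
  have wc: "continuous_on S (\<omega> t)" unfolding \<omega>_def
    by (rule continuous_on_time_section[OF vorticity_continuous[OF C3] tI order_refl])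
  have vc: "continuous_on S (v t)" "continuous_on S v0"
    by (rule admissible_props(1)[OF adv[OF tI]], rule admissible_props(1)[OF v0(1)])
  define h where "h i x = q t x $ i * A t x $ i + p t x * pd S i (A t) x $ i" for i x
  have hc: "continuous_on S (h i)" for i
    unfolding h_def by (intro continuous_intros eq(3,4)[OF tI] AP[OF tI])
  have zero: "(LINT x:D|lborel. h 1 x + h 2 x) = 0"
  proof (rule zero_flux[of "\<lambda>x. p t x *\<^sub>R A t x" h, OF _ hc])
    show "continuous_on S (\<lambda>x. p t x *\<^sub>R A t x)" by (intro continuous_intros eq(3)[OF tI] AP[OF tI])
    show "has_pderiv (\<lambda>x. (p t x *\<^sub>R A t x) $ i) i (h i x) x" if x: "x \<in> D" for x i
      using has_pderiv_mult[OF eq(5)[OF tI x, of i] has_pderiv_pd_component[OF x AP(4)[OF tI subsetD[OF S(2) x]], where i=i and j=i]]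
      by (simp add: h_def)
    show "(p t (\<gamma> i s) *\<^sub>R A t (\<gamma> i s)) \<bullet> outer_normal D (\<gamma> i) s = 0" if "i \<le> n" for i s
      using boundary_tangential[OF _ that, where a="A t" and s=s] adA[OF tI] by (simp add: admissible_def)
  qed
  have divA: "pd S 1 (A t) x $ 1 + pd S 2 (A t) x $ 2 = 0" if x: "x \<in> S" for x
  proof -
    have "pd S i (A t) x = pd S i (v t) x - pd S i v0 x" for i
      unfolding A_def using admissible_props(4)[OF adv[OF tI] x] admissible_props(4)[OF v0(1) x] by (intro pd_diff x)
    then show ?thesis using solution_divergence_free[OF sol tI x] v0(2)[OF x] by simp
  qed
  have i1: "set_integrable lborel D (\<lambda>x. \<omega> t x * (v t x \<bullet> perp (v0 x)))"
    by (intro set_integrable_S continuous_intros continuous_on_perp wc vc)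
  have i2: "set_integrable lborel D (\<lambda>x. h 1 x + h 2 x)" by (intro set_integrable_S continuous_intros hc)
  have "(LINT x:D|lborel. A t x \<bullet> ut t x) = (LINT x:D|lborel. \<omega> t x * (v t x \<bullet> perp (v0 x)) - (h 1 x + h 2 x))"
  proof (rule set_lebesgue_integral_cong)
    show "\<forall>x. x \<in> D \<longrightarrow> A t x \<bullet> ut t x = \<omega> t x * (v t x \<bullet> perp (v0 x)) - (h 1 x + h 2 x)"
    proof (intro allI impI)
      fix x assume "x \<in> D"
      then have "p t x * (pd S 1 (A t) x $ 1 + pd S 2 (A t) x $ 2) = 0" using divA[of x] S by auto
      then have "h 1 x + h 2 x = A t x \<bullet> q t x" by (simp add: h_def inner_vec2 algebra_simps)
      moreover have "A t x \<bullet> perp (v t x) = v t x \<bullet> perp (v0 x)"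
        using inner_perp_swap[of "v0 x" "v t x"] by (simp add: A_def inner_diff_left)
      ultimately show "A t x \<bullet> ut t x = \<omega> t x * (v t x \<bullet> perp (v0 x)) - (h 1 x + h 2 x)"
        by (simp add: eq(6) inner_diff_right)
    qed
  qed (use D in auto)
  also have "\<dots> = (LINT x:D|lborel. \<omega> t x * (v t x \<bullet> perp (v0 x)))"
    unfolding set_integral_diff(2)[OF i1 i2] zero by simp
  finally have val: "(LINT x:D|lborel. A t x \<bullet> ut t x) = (LINT x:D|lborel. \<omega> t x * (v t x \<bullet> perp (v0 x)))" .
  have "((\<lambda>s. (E s s / 2 - E t t / 2) / (s - t)) \<longlongrightarrow> (LINT x:D|lborel. A t x \<bullet> ut t x)) (at t within J)"
    by (rule Lim_transform_within[OF lim zero_less_one]) (use quot J in auto)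
  then have "((\<lambda>s. E s s / 2) has_real_derivative (LINT x:D|lborel. \<omega> t x * (v t x \<bullet> perp (v0 x)))) (at t within J)"
    unfolding val by (simp add: has_field_derivative_iff)
  then show ?thesis unfolding E_def A_def[abs_def] J_def \<omega>_def .
qed

text \<open>As the gradient of \<open>\<phi>\<close> is \<open>- perp v0\<close>, the weak vorticity
  equation tested with \<open>\<phi>\<close> would produce exactly the opposite of the energy
  derivative. \<open>\<phi>\<close> need not vanish near the boundary, so it is multiplied by
  cutoffs adapted to \<open>v\<close>, whose total error tends to zero.\<close>

lemma energy_stream_conserved:
  assumes sol: "alpha_euler_solution \<alpha> D n \<gamma> I v" and ab: "{a..b} \<subseteq> I" "a \<le> b"
    and v0: "admissible v0" "\<And>x. x \<in> S \<Longrightarrow> pd S 1 v0 x $ 1 + pd S 2 v0 x $ 2 = 0"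
    and \<phi>: "continuous_on D \<phi>" "\<And>x i. x \<in> D \<Longrightarrow> has_pderiv \<phi> i ((- perp (v0 x)) $ i) x" "\<And>x. x \<in> D \<Longrightarrow> \<bar>\<phi> x\<bar> \<le> M\<phi>"
  defines "e \<equiv> \<lambda>s. (LINT x:D|lborel. energy_density \<alpha> (\<lambda>x. v s x - v0 x) (\<lambda>x. v s x - v0 x) x) / 2"
    and "\<omega> \<equiv> \<lambda>s. vorticity \<alpha> S (v s)"
  shows "e b + (LINT x:D|lborel. \<phi> x * \<omega> b x) = e a + (LINT x:D|lborel. \<phi> x * \<omega> a x)"
proof -
  define J where "J = {a..b}"
  have J: "compact J" "convex J" "J \<subseteq> I" "a \<in> J" "b \<in> J" using ab by (auto simp: J_def)
  have C3: "C_space 3 I S v" using solution_C_space[OF sol] .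
  have vJ: "continuous_on (J \<times> S) (\<lambda>(t, x). v t x)"
    by (rule continuous_on_subset[OF C_space_cont[OF C3]]) (use J in auto)
  have wJ: "continuous_on (J \<times> S) (\<lambda>(t, x). \<omega> t x)"
    unfolding \<omega>_def by (rule continuous_on_subset[OF vorticity_continuous[OF C3]]) (use J in auto)
  obtain Mv where Mv: "Mv \<ge> 0" "\<And>t x. t \<in> J \<Longrightarrow> x \<in> S \<Longrightarrow> norm (v t x) \<le> Mv"
    using compact_time_space_bound[OF vJ J(1) S(1)] by blast
  obtain Mw where Mw: "Mw \<ge> 0" "\<And>t x. t \<in> J \<Longrightarrow> x \<in> S \<Longrightarrow> norm (\<omega> t x) \<le> Mw"
    using compact_time_space_bound[OF wJ J(1) S(1)] by blast
  have v0c: "continuous_on S v0" by (rule admissible_props(1)[OF v0(1)])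
  obtain M0 where M0: "M0 \<ge> 0" "\<And>x. x \<in> S \<Longrightarrow> norm (v0 x) \<le> M0"
    using continuous_S_bounded[OF v0c] by blast
  define Mp where "Mp = \<bar>M\<phi>\<bar>"
  have Mp: "Mp \<ge> 0" "\<And>x. x \<in> D \<Longrightarrow> \<bar>\<phi> x\<bar> \<le> Mp" using \<phi>(3) by (force simp: Mp_def)+
  have wS: "continuous_on S (\<omega> t)" and vS: "continuous_on S (v t)" if "t \<in> J" for t
    using continuous_on_time_section[OF wJ that order_refl] continuous_on_time_section[OF vJ that order_refl] by auto
  have wD: "continuous_on D (\<omega> t)" and vD: "continuous_on D (v t)" if "t \<in> J" for t
    using continuous_on_time_section[OF wJ that S(2)] continuous_on_time_section[OF vJ that S(2)] by auto
  have v0D: "continuous_on D v0" by (rule continuous_on_subset[OF v0c S(2)])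
  define C where "C = (Mw * (Mv * M0) + Mw * Mp) * (b - a) + 2 * (Mp * Mw)"
  have C: "C \<ge> 0" using Mw Mv M0 Mp ab by (simp add: C_def)
  define T where "T t = e t + (LINT x:D|lborel. \<phi> x * \<omega> t x)" for t
  have est: "\<bar>T b - T a\<bar> \<le> C * \<epsilon>" if \<epsilon>: "\<epsilon> > 0" for \<epsilon>
  proof -
    obtain \<eta> g where \<eta>: "test_fun D \<eta> g" "\<And>x. 0 \<le> \<eta> x" "\<And>x. \<eta> x \<le> 1" "(LINT x:D|lborel. 1 - \<eta> x) \<le> \<epsilon>"
        "\<And>t. t \<in> J \<Longrightarrow> (LINT x:D|lborel. \<bar>v t x \<bullet> g x\<bar>) \<le> \<epsilon>"
      using solution_cutoff[OF sol ab(1) \<epsilon>] unfolding J_def by blast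
    have \<eta>c: "continuous_on A \<eta>" and gc: "continuous_on A g" for A
      by (rule test_fun_continuous[OF \<eta>(1)])+
    obtain K where K: "compact K" "K \<subseteq> D" "\<And>x. x \<notin> K \<Longrightarrow> \<eta> x = 0" using \<eta>(1) by (auto simp: test_fun_def)
    define \<psi> where "\<psi> x = (if x \<in> D then \<phi> x * \<eta> x else 0)" for x
    define g\<psi> where "g\<psi> x = (if x \<in> D then \<phi> x *\<^sub>R g x - \<eta> x *\<^sub>R perp (v0 x) else 0)" for x
    have tf: "test_fun D \<psi> g\<psi>"
      unfolding \<psi>_def[abs_def] g\<psi>_def[abs_def]
    proof (rule test_fun_extend[OF D(1) _ _ _ K(1,2)])
      show "continuous_on D (\<lambda>x. \<phi> x * \<eta> x)" by (intro continuous_intros \<phi> \<eta>c)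
      show "continuous_on D (\<lambda>x. \<phi> x *\<^sub>R g x - \<eta> x *\<^sub>R perp (v0 x))"
        by (intro continuous_intros \<phi> \<eta>c gc continuous_on_perp v0D)
      fix x i assume x: "x \<in> D"
      have "has_pderiv \<eta> i (g x $ i) x" using \<eta>(1) by (simp add: test_fun_def)
      from has_pderiv_mult[OF \<phi>(2)[OF x] this]
      show "has_pderiv (\<lambda>x. \<phi> x * \<eta> x) i ((\<phi> x *\<^sub>R g x - \<eta> x *\<^sub>R perp (v0 x)) $ i) x" by (simp add: mult_ac)
    qed (use K in auto)
    define F where "F t = e t + (LINT x:D|lborel. \<psi> x * \<omega> t x)" for t
    \<comment> \<open>What the cancellation leaves over: \<open>R\<close> is the energy production
      where the cutoff is below 1, \<open>P\<close> the flux of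
      \<open>\<phi> x * \<omega> t x\<close> through the cutoff.\<close>
    define R where "R t x = (1 - \<eta> x) * (\<omega> t x * (v t x \<bullet> perp (v0 x)))" for t x
    define P where "P t x = (\<omega> t x * \<phi> x) * (v t x \<bullet> g x)" for t x
    have i1: "set_integrable lborel D (\<lambda>x. \<omega> t x * (v t x \<bullet> perp (v0 x)))" if "t \<in> J" for t
      by (intro set_integrable_S continuous_intros continuous_on_perp wS vS v0c that)
    have i2: "set_integrable lborel D (\<lambda>x. \<omega> t x * (v t x \<bullet> g\<psi> x))" if "t \<in> J" for t
      by (intro set_integrable_S continuous_intros wS vS that test_fun_continuous(2)[OF tf])
    have iR: "set_integrable lborel D (R t)" if "t \<in> J" for t
      unfolding R_def by (intro set_integrable_S continuous_intros continuous_on_perp wS vS v0c \<eta>c that)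
    have iv: "set_integrable lborel D (\<lambda>x. (Mw * Mp) * \<bar>v t x \<bullet> g x\<bar>)" if "t \<in> J" for t
      by (intro set_integrable_S continuous_intros vS gc that)
    have i\<eta>: "set_integrable lborel D (\<lambda>x. c * (1 - \<eta> x))" for c
      by (intro set_integrable_S continuous_intros \<eta>c)
    have wP: "\<bar>\<omega> t x * \<phi> x\<bar> \<le> Mw * Mp" if "t \<in> J" "x \<in> D" for t x
      unfolding abs_mult using Mw(2)[OF that(1), of x] Mp(2)[OF that(2)] that S Mw(1)
      by (intro mult_mono) auto
    have gS: "continuous_on S g" by (rule gc)
    obtain Bg where Bg: "Bg \<ge> 0" "\<And>x. x \<in> S \<Longrightarrow> norm (g x) \<le> Bg" using continuous_S_bounded[OF gS] by blast
    have iP: "set_integrable lborel D (P t)" if t: "t \<in> J" for t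
      unfolding P_def
    proof (rule set_integrable_test[OF D, where A="Mw * Mp" and B="Mv * Bg"])
      show "\<bar>v t x \<bullet> g x\<bar> \<le> Mv * Bg" if "x \<in> D" for x
        by (rule order_trans[OF Cauchy_Schwarz_ineq2]) (use Mv(1) Mv(2)[OF t, of x] Bg that S in \<open>auto intro!: mult_mono\<close>)
      show "continuous_on D (\<lambda>x. \<omega> t x * \<phi> x)" "continuous_on D (\<lambda>x. v t x \<bullet> g x)"
        by (intro continuous_intros wD vD \<phi> gc t)+
    qed (use wP[OF t] in auto)
    have dF: "(F has_real_derivative (LINT x:D|lborel. R t x) + (LINT x:D|lborel. P t x)) (at t within J)" if t: "t \<in> J" for t
    proof -
      have "(F has_real_derivative (LINT x:D|lborel. \<omega> t x * (v t x \<bullet> perp (v0 x))) + (LINT x:D|lborel. \<omega> t x * (v t x \<bullet> g\<psi> x))) (at t within J)"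
        unfolding F_def[abs_def] e_def \<omega>_def J_def using t unfolding J_def
        by (intro DERIV_add energy_derivative[OF sol ab(1) _ v0] solution_weak_vorticity[OF sol ab(1) _ tf])
      also have "(LINT x:D|lborel. \<omega> t x * (v t x \<bullet> perp (v0 x))) + (LINT x:D|lborel. \<omega> t x * (v t x \<bullet> g\<psi> x))
         = (LINT x:D|lborel. \<omega> t x * (v t x \<bullet> perp (v0 x)) + \<omega> t x * (v t x \<bullet> g\<psi> x))"
        by (rule set_integral_add(2)[symmetric, OF i1[OF t] i2[OF t]])
      also have "\<dots> = (LINT x:D|lborel. R t x + P t x)"
        by (rule set_lebesgue_integral_cong) (use D in \<open>auto simp: R_def P_def g\<psi>_def inner_diff_right algebra_simps\<close>)
      also have "\<dots> = (LINT x:D|lborel. R t x) + (LINT x:D|lborel. P t x)"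
        by (rule set_integral_add(2)[OF iR[OF t] iP[OF t]])
      finally show ?thesis .
    qed
    have bF: "\<bar>(LINT x:D|lborel. R t x) + (LINT x:D|lborel. P t x)\<bar> \<le> (Mw * (Mv * M0) + Mw * Mp) * \<epsilon>" if t: "t \<in> J" for t
    proof -
      have "\<bar>LINT x:D|lborel. R t x\<bar> \<le> (LINT x:D|lborel. (Mw * (Mv * M0)) * (1 - \<eta> x))"
      proof (rule set_integral_abs_le_integral[OF iR[OF t] i\<eta>])
        fix x assume "x \<in> D"
        then have x: "x \<in> S" using S by auto
        have "\<bar>v t x \<bullet> perp (v0 x)\<bar> \<le> Mv * M0"
          by (rule order_trans[OF Cauchy_Schwarz_ineq2]) (use Mv(1) Mv(2)[OF t x] M0(2)[OF x] in \<open>auto simp: norm_perp intro!: mult_mono\<close>)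
        then have "\<bar>\<omega> t x * (v t x \<bullet> perp (v0 x))\<bar> \<le> Mw * (Mv * M0)"
          unfolding abs_mult using Mw(1) Mw(2)[OF t x] by (intro mult_mono) auto
        then show "\<bar>R t x\<bar> \<le> Mw * (Mv * M0) * (1 - \<eta> x)"
          unfolding R_def abs_mult[of "1 - \<eta> x"] mult.commute[of "Mw * (Mv * M0)"] using \<eta>(3)[of x] by (intro mult_mono) auto
      qed
      also have "\<dots> = (Mw * (Mv * M0)) * (LINT x:D|lborel. 1 - \<eta> x)" by (rule set_integral_mult_right)
      also have "\<dots> \<le> (Mw * (Mv * M0)) * \<epsilon>" using \<eta>(4) Mw Mv M0 by (intro mult_left_mono) auto
      finally have 1: "\<bar>LINT x:D|lborel. R t x\<bar> \<le> (Mw * (Mv * M0)) * \<epsilon>" .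
      have "\<bar>LINT x:D|lborel. P t x\<bar> \<le> (LINT x:D|lborel. (Mw * Mp) * \<bar>v t x \<bullet> g x\<bar>)"
      proof (rule set_integral_abs_le_integral[OF iP[OF t] iv[OF t]])
        show "\<bar>P t x\<bar> \<le> Mw * Mp * \<bar>v t x \<bullet> g x\<bar>" if "x \<in> D" for x
          unfolding P_def abs_mult[of "\<omega> t x * \<phi> x"] using wP[OF t that] by (intro mult_right_mono) auto
      qed
      also have "\<dots> = (Mw * Mp) * (LINT x:D|lborel. \<bar>v t x \<bullet> g x\<bar>)" by (rule set_integral_mult_right)
      also have "\<dots> \<le> (Mw * Mp) * \<epsilon>" using \<eta>(5)[OF t] Mw Mp by (intro mult_left_mono) auto
      finally have 2: "\<bar>LINT x:D|lborel. P t x\<bar> \<le> (Mw * Mp) * \<epsilon>" .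
      show ?thesis using 1 2 by (simp add: distrib_right)
    qed
    have FF: "\<bar>F b - F a\<bar> \<le> (Mw * (Mv * M0) + Mw * Mp) * \<epsilon> * \<bar>b - a\<bar>"
      by (rule real_quotient_bound[OF J(2) dF bF J(5,4)])
    have near: "\<bar>T t - F t\<bar> \<le> (Mp * Mw) * \<epsilon>" if t: "t \<in> J" for t
    proof -
      have wb: "\<bar>\<omega> t x\<bar> \<le> Mw" if "x \<in> D" for x using Mw(2)[OF t, of x] that S by auto
      have j1: "set_integrable lborel D (\<lambda>x. \<phi> x * \<omega> t x)"
        by (rule set_integrable_test[OF D \<phi>(1) wD[OF t], of Mp Mw]) (use Mp wb in auto)
      have j2: "set_integrable lborel D (\<lambda>x. \<psi> x * \<omega> t x)"
        by (intro set_integrable_S continuous_intros wS t test_fun_continuous(1)[OF tf])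
      have "\<bar>T t - F t\<bar> = \<bar>LINT x:D|lborel. \<phi> x * \<omega> t x - \<psi> x * \<omega> t x\<bar>"
        by (simp add: T_def F_def set_integral_diff(2)[OF j1 j2])
      also have "\<dots> \<le> (LINT x:D|lborel. (Mp * Mw) * (1 - \<eta> x))"
      proof (rule set_integral_abs_le_integral[OF set_integral_diff(1)[OF j1 j2] i\<eta>])
        fix x assume x: "x \<in> D"
        have "\<bar>\<phi> x * \<omega> t x\<bar> \<le> Mp * Mw"
          unfolding abs_mult using Mp(2)[OF x] wb[OF x] Mp(1) by (intro mult_mono) auto
        moreover have "\<phi> x * \<omega> t x - \<psi> x * \<omega> t x = (\<phi> x * \<omega> t x) * (1 - \<eta> x)"
          using x by (simp add: \<psi>_def algebra_simps)
        ultimately show "\<bar>\<phi> x * \<omega> t x - \<psi> x * \<omega> t x\<bar> \<le> Mp * Mw * (1 - \<eta> x)"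
          using \<eta>(3)[of x] by (simp add: abs_mult[of _ "1 - \<eta> x"] mult_right_mono)
      qed
      also have "\<dots> = (Mp * Mw) * (LINT x:D|lborel. 1 - \<eta> x)" by (rule set_integral_mult_right)
      also have "\<dots> \<le> (Mp * Mw) * \<epsilon>" using \<eta>(4) Mw Mp by (intro mult_left_mono) auto
      finally show ?thesis .
    qed
    have "\<bar>y - x\<bar> \<le> c + 2 * d" if "\<bar>p - q\<bar> \<le> c" "\<bar>x - q\<bar> \<le> d" "\<bar>y - p\<bar> \<le> d" for p q x y c d :: real
      using that by linarith
    from this[OF FF near[OF J(4)] near[OF J(5)]]
    show ?thesis using ab by (simp add: C_def algebra_simps)
  qed
  have "T b - T a = 0" by (rule abs_le_mult_eps_imp_zero[OF C est])
  then show ?thesis by (simp add: T_def)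
qed

end


section \<open>Convexity of the Casimir functional and stability\<close>

lemma nonneg_sign_imp_le:
  fixes g g' :: "real \<Rightarrow> real"
  assumes "\<And>z. (g has_real_derivative g' z) (at z)" "\<And>z. (z - r) * g' z \<ge> 0"
  shows "g r \<le> g s"
proof -
  consider "s = r" | "r < s" | "s < r" by linarith
  then show ?thesis
  proof cases
    case 2
    then obtain z where z: "r < z" "z < s" "g s - g r = (s - r) * g' z" using MVT2[of r s g g'] assms(1) by blast
    then have "g' z \<ge> 0" using assms(2)[of z] by (simp add: zero_le_mult_iff)
    then show ?thesis using z 2 by (smt (verit) mult_nonneg_nonneg)
  next
    case 3
    then obtain z where z: "s < z" "z < r" "g r - g s = (r - s) * g' z" using MVT2[of s r g g'] assms(1) by blast
    then have "g' z \<le> 0" using assms(2)[of z] by (simp add: zero_le_mult_iff)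
    then show ?thesis using z 3 by (smt (verit) mult_nonneg_nonpos)
  qed simp
qed

text \<open>A second order Taylor estimate for a \<open>G\<close> whose derivative \<open>H\<close>
  has difference quotients between \<open>c1\<close> and \<open>c2\<close>. In the lower bound the
  tangent line and the parabola with second derivative \<open>c1\<close> are subtracted from
  \<open>G\<close>; the derivative of the difference has the sign of \<open>z - r\<close>, so its
  minimum is at \<open>r\<close>. The upper bound is symmetric.\<close>

lemma convexity_bounds:
  fixes G H :: "real \<Rightarrow> real"
  assumes G: "\<And>w. (G has_real_derivative H w) (at w)"
    and H: "\<And>s t. s \<le> t \<Longrightarrow> c1 * (t - s) \<le> H t - H s" "\<And>s t. s \<le> t \<Longrightarrow> H t - H s \<le> c2 * (t - s)"
  shows "c1 / 2 * (s - r)\<^sup>2 \<le> G s - G r - H r * (s - r)" "G s - G r - H r * (s - r) \<le> c2 / 2 * (s - r)\<^sup>2"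
proof -
  have d: "((\<lambda>z. G z - H r * (z - r) - c / 2 * (z - r)\<^sup>2) has_real_derivative H z - H r - c * (z - r)) (at z)" for c z
    by (auto intro!: derivative_eq_intros G)
  have "(\<lambda>z. G z - H r * (z - r) - c1 / 2 * (z - r)\<^sup>2) r \<le> (\<lambda>z. G z - H r * (z - r) - c1 / 2 * (z - r)\<^sup>2) s"
  proof (rule nonneg_sign_imp_le[OF d])
    show "0 \<le> (z - r) * (H z - H r - c1 * (z - r))" for z
    proof (cases "r \<le> z")
      case True
      then show ?thesis using H(1)[OF True] by (intro mult_nonneg_nonneg) auto
    next
      case False
      then have "H z - H r - c1 * (z - r) \<le> 0" using H(1)[of z r] by (simp add: algebra_simps)
      then show ?thesis using False by (intro mult_nonpos_nonpos) auto
    qed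
  qed
  then show "c1 / 2 * (s - r)\<^sup>2 \<le> G s - G r - H r * (s - r)" by simp
  have d': "((\<lambda>z. c2 / 2 * (z - r)\<^sup>2 - (G z - H r * (z - r))) has_real_derivative c2 * (z - r) - (H z - H r)) (at z)" for z
    by (auto intro!: derivative_eq_intros G)
  have "(\<lambda>z. c2 / 2 * (z - r)\<^sup>2 - (G z - H r * (z - r))) r \<le> (\<lambda>z. c2 / 2 * (z - r)\<^sup>2 - (G z - H r * (z - r))) s"
  proof (rule nonneg_sign_imp_le[OF d'])
    show "0 \<le> (z - r) * (c2 * (z - r) - (H z - H r))" for z
    proof (cases "r \<le> z")
      case True
      then show ?thesis using H(2)[OF True] by (intro mult_nonneg_nonneg) auto
    next
      case False
      then have "c2 * (z - r) - (H z - H r) \<le> 0" using H(2)[of z r] by (simp add: algebra_simps)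
      then show ?thesis using False by (intro mult_nonpos_nonpos) auto
    qed
  qed
  then show "G s - G r - H r * (s - r) \<le> c2 / 2 * (s - r)\<^sup>2" by simp
qed

text \<open>The perturbed vorticity may leave the range of the steady one, so \<open>- F\<close> is
  continued linearly with slope \<open>c1\<close>. Slope bounds on the open interval are enough
  because the mean value theorem evaluates \<open>F'\<close> at interior points.\<close>

lemma clamped_extension:
  fixes F F' :: "real \<Rightarrow> real"
  assumes mM: "m \<le> M" and F: "\<And>w. w \<in> {m..M} \<Longrightarrow> (F has_real_derivative F' w) (at w within {m..M})"
    and c: "c1 \<le> c2" "\<And>w. w \<in> {m<..<M} \<Longrightarrow> c1 \<le> - F' w" "\<And>w. w \<in> {m<..<M} \<Longrightarrow> - F' w \<le> c2"
  obtains H where "continuous_on UNIV H" "\<And>w. w \<in> {m..M} \<Longrightarrow> H w = - F w"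
    "\<And>s t. s \<le> t \<Longrightarrow> c1 * (t - s) \<le> H t - H s" "\<And>s t. s \<le> t \<Longrightarrow> H t - H s \<le> c2 * (t - s)"
proof -
  define k where "k w = max m (min M w)" for w
  have k: "k w \<in> {m..M}" "w \<in> {m..M} \<Longrightarrow> k w = w" for w using mM by (auto simp: k_def)
  \<comment> \<open>The clamp \<open>k\<close> and the excess \<open>w - k w\<close> are both
    nondecreasing, so the slope bounds inside and outside the interval add up.\<close>
  have km: "k s \<le> k t" "s - k s \<le> t - k t" if "s \<le> t" for s t
    using that mM by (auto simp: k_def max_def min_def)
  define H where "H w = - F (k w) + c1 * (w - k w)" for w
  have Fc: "continuous_on {m..M} F"
    by (rule DERIV_continuous_on[OF F])
  have base: "c1 * (t - s) \<le> F s - F t \<and> F s - F t \<le> c2 * (t - s)" if st: "s \<in> {m..M}" "t \<in> {m..M}" "s \<le> t" for s t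
  proof (cases "s = t")
    case False
    then have "s < t" using st by simp
    moreover have "(F has_derivative (\<lambda>h. F' x * h)) (at x within {s..t})" if "x \<in> {s..t}" for x
      using has_field_derivative_subset[OF F, of x "{s..t}"] that st by (auto simp: has_field_derivative_def)
    ultimately have "\<exists>z\<in>{s<..<t}. F t - F s = F' z * (t - s)"
      by (intro mvt_simple) auto
    then obtain z where z: "z \<in> {s<..<t}" "F t - F s = F' z * (t - s)" by blast
    have "c1 \<le> - F' z" "- F' z \<le> c2" using c z st by auto
    then have "c1 * (t - s) \<le> - F' z * (t - s)" "- F' z * (t - s) \<le> c2 * (t - s)"
      using \<open>s < t\<close> mult_right_mono[of c1 "- F' z" "t - s"] mult_right_mono[of "- F' z" c2 "t - s"] by simp_all
    then show ?thesis using z(2) by simp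
  qed simp
  show ?thesis
  proof (rule that[of H])
    have "continuous_on UNIV k" unfolding k_def by (intro continuous_intros)
    moreover from this have "continuous_on UNIV (\<lambda>w. F (k w))"
      by (rule continuous_on_compose2[OF Fc]) (use k in auto)
    ultimately show "continuous_on UNIV H" unfolding H_def by (intro continuous_intros)
    show "H w = - F w" if "w \<in> {m..M}" for w using k(2)[OF that] by (simp add: H_def)
    fix s t :: real assume st: "s \<le> t"
    have b: "c1 * (k t - k s) \<le> F (k s) - F (k t)" "F (k s) - F (k t) \<le> c2 * (k t - k s)"
      using base[OF k(1) k(1) km(1)[OF st]] by auto
    have e: "H t - H s = (F (k s) - F (k t)) + c1 * ((t - k t) - (s - k s))" by (simp add: H_def algebra_simps)
    have "c1 * ((t - k t) - (s - k s)) \<le> c2 * ((t - k t) - (s - k s))"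
      using c(1) km(2)[OF st] by (intro mult_right_mono) auto
    then show "c1 * (t - s) \<le> H t - H s" "H t - H s \<le> c2 * (t - s)" unfolding e using b by (simp_all add: algebra_simps)
  qed
qed

lemma continuous_antiderivative:
  fixes H :: "real \<Rightarrow> real"
  assumes "continuous_on UNIV H"
  obtains G where "\<And>w. (G has_real_derivative H w) (at w)"
proof -
  have "\<exists>G. \<forall>x::real. (- \<infinity>::ereal) < x \<longrightarrow> x < \<infinity> \<longrightarrow> (G has_vector_derivative H x) (at x)"
    by (rule einterval_antiderivative) (use assms in \<open>auto simp: continuous_on_eq_continuous_at\<close>)
  then show ?thesis using that by (auto simp: has_real_derivative_iff_has_vector_derivative)
qed

context domain
begin

text \<open>In the expansion, the term linear in the vorticity has the stream function
  \<open>- H (\<omega>0 x)\<close> as its coefficient and balances the energy; the integral of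
  \<open>G\<close> of the vorticity is conserved by itself, and the remaining terms do not involve
  the time.\<close>

lemma Lyapunov_conserved:
  assumes sol: "alpha_euler_solution \<alpha> D n \<gamma> I v" and ab: "{a..b} \<subseteq> I" "a \<le> b"
    and v0: "admissible v0" "\<And>x. x \<in> S \<Longrightarrow> pd S 1 v0 x $ 1 + pd S 2 v0 x $ 2 = 0"
    and \<omega>0: "continuous_on S \<omega>0"
    and \<phi>: "\<And>x i. x \<in> D \<Longrightarrow> has_pderiv \<phi> i ((- perp (v0 x)) $ i) x" "\<And>x. x \<in> D \<Longrightarrow> \<phi> x = - H (\<omega>0 x)"
    and G: "\<And>w. (G has_real_derivative H w) (at w)" "continuous_on UNIV H"
  defines "\<Lambda> \<equiv> \<lambda>s. (LINT x:D|lborel. energy_density \<alpha> (\<lambda>x. v s x - v0 x) (\<lambda>x. v s x - v0 x) x) / 2 +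
    (LINT x:D|lborel. G (vorticity \<alpha> S (v s) x) - G (\<omega>0 x) - H (\<omega>0 x) * (vorticity \<alpha> S (v s) x - \<omega>0 x))"
  shows "\<Lambda> b = \<Lambda> a"
proof -
  have Hc: "continuous_on S (\<lambda>x. H (\<omega>0 x))" by (rule continuous_on_compose2[OF G(2) \<omega>0]) simp
  have \<phi>c: "continuous_on D \<phi>"
    by (rule continuous_on_eq[where f="\<lambda>x. - H (\<omega>0 x)"])
      (use continuous_on_subset[OF Hc S(2)] \<phi>(2) in \<open>auto intro!: continuous_intros\<close>)
  obtain B where B: "B \<ge> 0" "\<And>x. x \<in> S \<Longrightarrow> norm (H (\<omega>0 x)) \<le> B" using continuous_S_bounded[OF Hc] by blast
  have \<phi>b: "\<bar>\<phi> x\<bar> \<le> B" if "x \<in> D" for x using B(2)[of x] \<phi>(2)[OF that] that S(2) by auto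
  define \<omega> where "\<omega> s = vorticity \<alpha> S (v s)" for s
  have Gc: "continuous_on UNIV G" using G(1) DERIV_continuous_on has_field_derivative_at_within by blast
  have split: "(LINT x:D|lborel. G (\<omega> s x) - G (\<omega>0 x) - H (\<omega>0 x) * (\<omega> s x - \<omega>0 x))
      = (LINT x:D|lborel. G (\<omega> s x)) + (LINT x:D|lborel. \<phi> x * \<omega> s x) - (LINT x:D|lborel. G (\<omega>0 x) - H (\<omega>0 x) * \<omega>0 x)"
    if s: "s \<in> I" for s
  proof -
    have wc: "continuous_on S (\<omega> s)" unfolding \<omega>_def
      by (rule continuous_on_time_section[OF vorticity_continuous[OF solution_C_space[OF sol]] s order_refl])
    have i1: "set_integrable lborel D (\<lambda>x. G (\<omega> s x))"
      by (intro set_integrable_S continuous_on_compose2[OF Gc wc]) simp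
    have i2: "set_integrable lborel D (\<lambda>x. - H (\<omega>0 x) * \<omega> s x)"
      by (intro set_integrable_S continuous_intros Hc wc)
    have i3: "set_integrable lborel D (\<lambda>x. G (\<omega>0 x) - H (\<omega>0 x) * \<omega>0 x)"
      by (intro set_integrable_S continuous_intros Hc \<omega>0 continuous_on_compose2[OF Gc \<omega>0]) simp
    have "(LINT x:D|lborel. \<phi> x * \<omega> s x) = (LINT x:D|lborel. - H (\<omega>0 x) * \<omega> s x)"
      by (rule set_lebesgue_integral_cong) (use D \<phi>(2) in auto)
    moreover have "(LINT x:D|lborel. G (\<omega> s x) - G (\<omega>0 x) - H (\<omega>0 x) * (\<omega> s x - \<omega>0 x))
      = (LINT x:D|lborel. (G (\<omega> s x) + - H (\<omega>0 x) * \<omega> s x) - (G (\<omega>0 x) - H (\<omega>0 x) * \<omega>0 x))"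
      by (rule arg_cong[where f="set_lebesgue_integral lborel D"]) (auto simp: fun_eq_iff algebra_simps)
    ultimately show ?thesis
      unfolding set_integral_diff(2)[OF set_integral_add(1)[OF i1 i2] i3] set_integral_add(2)[OF i1 i2] by simp
  qed
  have "a \<in> I" "b \<in> I" using ab by auto
  moreover have "(LINT x:D|lborel. energy_density \<alpha> (\<lambda>x. v b x - v0 x) (\<lambda>x. v b x - v0 x) x) / 2 + (LINT x:D|lborel. \<phi> x * \<omega> b x)
     = (LINT x:D|lborel. energy_density \<alpha> (\<lambda>x. v a x - v0 x) (\<lambda>x. v a x - v0 x) x) / 2 + (LINT x:D|lborel. \<phi> x * \<omega> a x)"
    unfolding \<omega>_def by (rule energy_stream_conserved[OF sol ab v0 \<phi>c \<phi>(1) \<phi>b])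
  moreover have "(LINT x:D|lborel. G (\<omega> b x)) = (LINT x:D|lborel. G (\<omega> a x))"
    unfolding \<omega>_def by (rule Casimir_conserved[OF sol ab G])
  ultimately show ?thesis unfolding \<Lambda>_def \<omega>_def[symmetric] by (simp add: split)
qed

end

theorem theorem4p5:
  fixes \<alpha> :: real
    and D :: "(real^2) set"
    and n :: nat
    and \<gamma> :: "nat \<Rightarrow> real \<Rightarrow> real^2"
    and v0 :: "real^2 \<Rightarrow> real^2"
    and \<phi>0 \<omega>0 :: "real^2 \<Rightarrow> real"
    and F F' :: "real \<Rightarrow> real"
  assumes "\<alpha> > 0"
    and "multiconnected_domain D n \<gamma>"
    and "steady_state \<alpha> D n \<gamma> v0"
    and "stream_function D \<phi>0 v0"
    and "\<omega>0 = vorticity \<alpha> (closure D) v0"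
    and "\<forall>w\<in>{(INF x\<in>closure D. \<omega>0 x)..(SUP x\<in>closure D. \<omega>0 x)}.
           (F has_real_derivative F' w)
             (at w within {(INF x\<in>closure D. \<omega>0 x)..(SUP x\<in>closure D. \<omega>0 x)})"
    and "\<forall>x\<in>D. \<phi>0 x = F (\<omega>0 x)"
    and "0 < (INF x\<in>D. ereal (- F' (\<omega>0 x)))"
    and "(INF x\<in>D. ereal (- F' (\<omega>0 x))) \<le> (SUP x\<in>D. ereal (- F' (\<omega>0 x)))"
    and "(SUP x\<in>D. ereal (- F' (\<omega>0 x))) < \<infinity>"
  shows "\<exists>K>0. \<forall>I v. is_interval I \<and> 0 \<in> I \<and> alpha_euler_solution \<alpha> D n \<gamma> I v \<longrightarrow>
           (\<forall>t\<in>I.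
              (L2_norm_on D (\<lambda>x. v t x - v0 x))\<^sup>2
              + \<alpha>\<^sup>2 * (L2_norm_grad D (\<lambda>x. v t x - v0 x))\<^sup>2
              + (L2_norm_on D (\<lambda>x. vorticity \<alpha> (closure D) (v t) x - \<omega>0 x))\<^sup>2
              \<le> K * ((L2_norm_on D (\<lambda>x. v 0 x - v0 x))\<^sup>2
                 + \<alpha>\<^sup>2 * (L2_norm_grad D (\<lambda>x. v 0 x - v0 x))\<^sup>2
                 + (L2_norm_on D (\<lambda>x. vorticity \<alpha> (closure D) (v 0) x - \<omega>0 x))\<^sup>2))"
proof -
  interpret domain D n \<gamma> using assms(2) by (simp add: domain_def)
  note cl = S_def[symmetric]
  have sol0: "alpha_euler_solution \<alpha> D n \<gamma> UNIV (\<lambda>t. v0)" using assms(3) by (simp add: steady_state_def)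
  have v0: "admissible v0" "\<And>x. x \<in> S \<Longrightarrow> pd S 1 v0 x $ 1 + pd S 2 v0 x $ 2 = 0"
    using solution_admissible[OF sol0, of 0] solution_divergence_free[OF sol0, of 0] by auto
  have \<omega>0: "\<omega>0 = vorticity \<alpha> S v0" using assms(5) by (simp add: S_def)
  have wc: "continuous_on S \<omega>0"
    using continuous_on_time_section[OF vorticity_continuous[OF solution_C_space[OF sol0]], of 0 S \<alpha>] by (simp add: \<omega>0)
  have Sne: "S \<noteq> {}" using curve_in_S[of 0 0] by auto
  then have Dne: "D \<noteq> {}" by (auto simp: S_def)
  have cw: "compact (\<omega>0 ` S)" by (intro compact_continuous_image wc S)
  define m where "m = (INF x\<in>closure D. \<omega>0 x)"
  define M where "M = (SUP x\<in>closure D. \<omega>0 x)"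
  have bdd: "bdd_below (\<omega>0 ` S)" "bdd_above (\<omega>0 ` S)"
    using compact_imp_bounded[OF cw] bounded_imp_bdd_below bounded_imp_bdd_above by auto
  have range: "\<omega>0 x \<in> {m..M}" if "x \<in> S" for x
    using cINF_lower[OF bdd(1) that] cSUP_upper[OF that bdd(2)] by (simp add: m_def M_def cl)
  \<comment> \<open>The bounds on \<open>F'\<close> are given at values taken in \<open>D\<close>,
    whereas \<open>m\<close> and \<open>M\<close> are extremes over the closure and may be attained
    on the boundary only. Connectedness provides every value strictly in between.\<close>
  have inner: "\<exists>x\<in>D. \<omega>0 x = w" if w: "w \<in> {m<..<M}" for w
  proof -
    have "connected (\<omega>0 ` D)"
      using dom by (intro connected_continuous_image continuous_on_subset[OF wc S(2)]) (auto simp: multiconnected_domain_def)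
    moreover have "\<exists>x\<in>D. \<omega>0 x < w"
    proof (rule ccontr)
      assume "\<not> ?thesis"
      then have "w \<le> \<omega>0 x" if "x \<in> S" for x
        using continuous_ge_on_closure[of D \<omega>0 x w] wc that by (auto simp: S_def not_less)
      then have "w \<le> m" unfolding m_def cl by (intro cINF_greatest Sne)
      then show False using w by simp
    qed
    moreover have "\<exists>x\<in>D. w < \<omega>0 x"
    proof (rule ccontr)
      assume "\<not> ?thesis"
      then have "\<omega>0 x \<le> w" if "x \<in> S" for x
        using continuous_le_on_closure[of D \<omega>0 x w] wc that by (auto simp: S_def not_less)
      then have "M \<le> w" unfolding M_def cl by (intro cSUP_least Sne)
      then show False using w by simp
    qed
    ultimately have "w \<in> \<omega>0 ` D"
      unfolding connected_iff_interval by (meson image_eqI less_imp_le)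
    then show ?thesis by auto
  qed
  \<comment> \<open>Strict inequalities in the extended reals leave room for a positive real lower
    bound, and likewise for a real upper bound \<open>c2\<close>.\<close>
  obtain c1 where c1: "0 < c1" "\<And>x. x \<in> D \<Longrightarrow> c1 \<le> - F' (\<omega>0 x)"
  proof -
    obtain c where c: "ereal 0 < ereal c" "ereal c < (INF x\<in>D. ereal (- F' (\<omega>0 x)))"
      using ereal_dense2[OF assms(8)[unfolded zero_ereal_def]] by auto
    have "c \<le> - F' (\<omega>0 x)" if "x \<in> D" for x
      using less_le_trans[OF c(2) INF_lower[OF that]] by simp
    then show ?thesis using that[of c] c by simp
  qed
  obtain c2 where c2: "\<And>x. x \<in> D \<Longrightarrow> - F' (\<omega>0 x) \<le> c2"
  proof -
    obtain c where c: "(SUP x\<in>D. ereal (- F' (\<omega>0 x))) < ereal c"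
      using ereal_dense2[OF assms(10)] by auto
    have "- F' (\<omega>0 x) \<le> c" if "x \<in> D" for x
      using le_less_trans[OF SUP_upper[OF that] c] by simp
    then show ?thesis using that[of c] by simp
  qed
  have mM: "m \<le> M" "c1 \<le> c2" using Dne S(2) range c1 c2 by fastforce+
  obtain H where H: "continuous_on UNIV H" "\<And>w. w \<in> {m..M} \<Longrightarrow> H w = - F w"
    "\<And>s t. s \<le> t \<Longrightarrow> c1 * (t - s) \<le> H t - H s" "\<And>s t. s \<le> t \<Longrightarrow> H t - H s \<le> c2 * (t - s)"
  proof (rule clamped_extension[of m M F F' c1 c2])
    show "(F has_real_derivative F' w) (at w within {m..M})" if "w \<in> {m..M}" for w
      using assms(6) that unfolding m_def M_def by blast
    show "c1 \<le> - F' w" "- F' w \<le> c2" if "w \<in> {m<..<M}" for w using inner[OF that] c1 c2 by auto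
  qed (use mM in auto)
  obtain G where G: "\<And>w. (G has_real_derivative H w) (at w)" using continuous_antiderivative[OF H(1)] by blast
  have taylor: "c1 / 2 * (s - r)\<^sup>2 \<le> G s - G r - H r * (s - r)" "G s - G r - H r * (s - r) \<le> c2 / 2 * (s - r)\<^sup>2" for s r
    by (rule convexity_bounds[OF G H(3,4)]; assumption)+
  have \<phi>1: "has_pderiv \<phi>0 i ((- perp (v0 x)) $ i) x" if x: "x \<in> D" for x i
  proof -
    have "\<phi>0 differentiable (at x within D)" "v0 x = - perp_gradient D \<phi>0 x"
      using assms(4) x by (auto simp: stream_function_def differentiable_on_def)
    moreover have "at x within D = at x" by (rule at_within_open[OF x D(1)])
    ultimately have "(\<phi>0 has_derivative frechet_derivative \<phi>0 (at x within D)) (at x)"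
      using frechet_derivative_works by metis
    from has_pderiv_of_derivative[OF this]
    have p: "has_pderiv \<phi>0 i (pd D i \<phi>0 x) x" by (simp add: pd_def)
    have "(- perp (v0 x)) $ i = pd D i \<phi>0 x"
      unfolding \<open>v0 x = _\<close> perp_gradient_def using exhaust_2[of i] by auto
    then show ?thesis using p by simp
  qed
  have \<phi>2: "\<phi>0 x = - H (\<omega>0 x)" if "x \<in> D" for x
    using assms(7) that H(2)[OF range[OF subsetD[OF S(2) that]]] by simp
  define N where "N v t = (L2_norm_on D (\<lambda>x. v t x - v0 x))\<^sup>2 + \<alpha>\<^sup>2 * (L2_norm_grad D (\<lambda>x. v t x - v0 x))\<^sup>2
     + (L2_norm_on D (\<lambda>x. vorticity \<alpha> (closure D) (v t) x - \<omega>0 x))\<^sup>2" for v :: "real \<Rightarrow> real^2 \<Rightarrow> real^2" and t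
  define \<Lambda> where "\<Lambda> v s = (LINT x:D|lborel. energy_density \<alpha> (\<lambda>x. v s x - v0 x) (\<lambda>x. v s x - v0 x) x) / 2 +
    (LINT x:D|lborel. G (vorticity \<alpha> S (v s) x) - G (\<omega>0 x) - H (\<omega>0 x) * (vorticity \<alpha> S (v s) x - \<omega>0 x))"
    for v :: "real \<Rightarrow> real^2 \<Rightarrow> real^2" and s
  \<comment> \<open>The energy enters \<open>\<Lambda>\<close> with the exact factor 1/2, the
    vorticity part with a factor between \<open>c1 / 2\<close> and \<open>c2 / 2\<close>.\<close>
  have bounds: "min 1 c1 / 2 * N v t \<le> \<Lambda> v t \<and> \<Lambda> v t \<le> max 1 c2 / 2 * N v t"
    if sol: "alpha_euler_solution \<alpha> D n \<gamma> I v" and t: "t \<in> I" for I v t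
  proof -
    define a where "a = (\<lambda>x. v t x - v0 x)"
    define z where "z = vorticity \<alpha> S (v t)"
    have ada: "admissible a" unfolding a_def by (rule admissible_diff[OF solution_admissible[OF sol t] v0(1)])
    note A = admissible_props[OF ada]
    have zc: "continuous_on S z" unfolding z_def
      by (rule continuous_on_time_section[OF vorticity_continuous[OF solution_C_space[OF sol]] t order_refl])
    have i1: "set_integrable lborel D (\<lambda>x. (norm (a x))\<^sup>2)"
      unfolding power2_norm_eq_inner by (intro set_integrable_S continuous_intros A)
    have i2: "set_integrable lborel D (\<lambda>x. \<alpha>\<^sup>2 * (pd S 1 a x \<bullet> pd S 1 a x + pd S 2 a x \<bullet> pd S 2 a x))"
      by (intro set_integrable_S continuous_intros A)
    define X where "X = (LINT x:D|lborel. energy_density \<alpha> a a x)"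
    define Y where "Y = (LINT x:D|lborel. (norm (z x - \<omega>0 x))\<^sup>2)"
    define Z where "Z = (LINT x:D|lborel. G (z x) - G (\<omega>0 x) - H (\<omega>0 x) * (z x - \<omega>0 x))"
    have "X = (LINT x:D|lborel. (norm (a x))\<^sup>2 + \<alpha>\<^sup>2 * (pd S 1 a x \<bullet> pd S 1 a x + pd S 2 a x \<bullet> pd S 2 a x))"
      unfolding X_def energy_density_def power2_norm_eq_inner ..
    also have "\<dots> = (L2_norm_on D a)\<^sup>2 + \<alpha>\<^sup>2 * (L2_norm_grad D a)\<^sup>2"
      unfolding set_integral_add(2)[OF i1 i2] L2_norm_on_square L2_norm_grad_square[OF ada] by simp
    finally have X: "X = (L2_norm_on D a)\<^sup>2 + \<alpha>\<^sup>2 * (L2_norm_grad D a)\<^sup>2" .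
    then have X0: "X \<ge> 0" by simp
    have N: "N v t = X + Y"
      unfolding N_def X Y_def L2_norm_on_square[of "\<lambda>x. vorticity \<alpha> (closure D) (v t) x - \<omega>0 x"] by (simp add: a_def z_def cl)
    have Y0: "Y \<ge> 0" unfolding Y_def L2_norm_on_square[symmetric] by simp
    have L: "\<Lambda> v t = X / 2 + Z" by (simp add: \<Lambda>_def X_def Z_def a_def z_def)
    have Gc: "continuous_on UNIV G" using G DERIV_continuous_on has_field_derivative_at_within by blast
    have iZ: "set_integrable lborel D (\<lambda>x. G (z x) - G (\<omega>0 x) - H (\<omega>0 x) * (z x - \<omega>0 x))"
      by (intro set_integrable_S continuous_intros zc wc continuous_on_compose2[OF Gc zc] continuous_on_compose2[OF Gc wc]
        continuous_on_compose2[OF H(1) wc]) auto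
    have iY: "set_integrable lborel D (\<lambda>x. c * (norm (z x - \<omega>0 x))\<^sup>2)" for c
      by (intro set_integrable_S continuous_intros zc wc)
    have "c1 / 2 * Y \<le> Z" unfolding Y_def Z_def set_integral_mult_right[symmetric]
      by (rule set_integral_mono[OF iY iZ]) (use taylor(1) in simp)
    moreover have "Z \<le> c2 / 2 * Y" unfolding Y_def Z_def set_integral_mult_right[symmetric]
      by (rule set_integral_mono[OF iZ iY]) (use taylor(2) in simp)
    moreover have "min 1 c1 * X \<le> 1 * X" "min 1 c1 * Y \<le> c1 * Y" "1 * X \<le> max 1 c2 * X" "c2 * Y \<le> max 1 c2 * Y"
      using X0 Y0 by (intro mult_right_mono; simp)+
    ultimately show ?thesis unfolding N L by (simp add: distrib_left)
  qed
  \<comment> \<open>The ratio of the two comparison constants in \<open>bounds\<close>.\<close>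
  define K where "K = max 1 c2 / min 1 c1"
  have pos: "min 1 c1 > 0" "max 1 c2 > 0" using c1 by auto
  show ?thesis
  proof (intro exI[of _ K] conjI allI impI ballI)
    show "K > 0" using pos by (simp add: K_def)
    fix I v t
    assume "is_interval I \<and> 0 \<in> I \<and> alpha_euler_solution \<alpha> D n \<gamma> I v" and t: "t \<in> I"
    then have I: "is_interval I" "0 \<in> I" and sol: "alpha_euler_solution \<alpha> D n \<gamma> I v" by auto
    \<comment> \<open>\<open>t\<close> may be negative, so conservation is used on the interval
      spanned by 0 and \<open>t\<close>.\<close>
    have sub: "{min 0 t..max 0 t} \<subseteq> I" 
    proof
      have "min 0 t \<in> I" "max 0 t \<in> I" using I(2) t by (simp_all add: min_def max_def)
      then show "s \<in> I" if "s \<in> {min 0 t..max 0 t}" for s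
        using mem_is_interval_1_I[OF I(1)] that unfolding atLeastAtMost_iff by blast
    qed
    have "\<Lambda> v (max 0 t) = \<Lambda> v (min 0 t)"
      unfolding \<Lambda>_def by (rule Lyapunov_conserved[OF sol sub _ v0 wc \<phi>1 \<phi>2 G H(1)]) simp_all
    then have eq: "\<Lambda> v t = \<Lambda> v 0" by (cases "0 \<le> t") simp_all
    have "min 1 c1 / 2 * N v t \<le> max 1 c2 / 2 * N v 0"
      using bounds[OF sol t] bounds[OF sol I(2)] eq by linarith
    then have "N v t \<le> K * N v 0" using pos(1) unfolding K_def by (simp add: field_simps)
    then show "(L2_norm_on D (\<lambda>x. v t x - v0 x))\<^sup>2 + \<alpha>\<^sup>2 * (L2_norm_grad D (\<lambda>x. v t x - v0 x))\<^sup>2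
        + (L2_norm_on D (\<lambda>x. vorticity \<alpha> (closure D) (v t) x - \<omega>0 x))\<^sup>2
       \<le> K * ((L2_norm_on D (\<lambda>x. v 0 x - v0 x))\<^sup>2 + \<alpha>\<^sup>2 * (L2_norm_grad D (\<lambda>x. v 0 x - v0 x))\<^sup>2
        + (L2_norm_on D (\<lambda>x. vorticity \<alpha> (closure D) (v 0) x - \<omega>0 x))\<^sup>2)"
      unfolding N_def .
  qed
qed

end
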